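(* Let $N=3$ or $N=4$, $r\ge2$, $2^*=\frac{2N}{N-2}$, $\Lambda_N=\frac{(N-2)^2}{4}$, $\lambda_j\in(0,\Lambda_N)$ for $j=1,\dots,r$, and suppose that for all $k\ne j$: $\alpha_{jk}+\alpha_{kj}=2^*$, $\alpha_{jk}\ge2$, $\alpha_{kj}\ge2$, $\beta_{jk}=\beta_{kj}>0$. Then any positive solution $(u_1,\dots,u_r)$ of $$-\Delta u_j-\frac{\lambda_j}{|x|^2}u_j=u_j^{2^*-1}+\sum_{k\ne j}\beta_{jk}\alpha_{jk}u_j^{\alpha_{jk}-1}u_k^{\alpha_{kj}}\ \text{ in }\mathbb{R}^N,\qquad u_j\in D^{1,2}(\mathbb{R}^N),\quad j=1,\dots,r,$$ is radially symmetric with respect to the origin.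
   Context: $D^{1,2}(\mathbb{R}^N)$ is the completion of $C_c^\infty(\mathbb{R}^N)$ in the norm $(\int|\nabla u|^2)^{1/2}$. A solution is positive if $u_j>0$ in $\mathbb{R}^N\setminus\{0\}$ for all $j=1,\dots,r$. Radially symmetric means that each $u_j$ is radially symmetric. *)

theory Defs
  imports "HOL-Analysis.Analysis"
begin

definition partial_deriv :: "'n \<Rightarrow> (real^'n \<Rightarrow> real) \<Rightarrow> real^'n \<Rightarrow> real" where
  "partial_deriv i f x = frechet_derivative f (at x) (axis i 1)"

definition grad :: "(real^'n \<Rightarrow> real) \<Rightarrow> real^'n \<Rightarrow> real^'n" where
  "grad f x = (\<chi> i. partial_deriv i f x)"

primrec iter_partial :: "'n list \<Rightarrow> (real^'n \<Rightarrow> real) \<Rightarrow> real^'n \<Rightarrow> real" where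
  "iter_partial [] f = f"
| "iter_partial (i # is) f = partial_deriv i (iter_partial is f)"

text \<open>The space of test functions. If every iterated partial derivative is (totally)
  differentiable everywhere, then all of them are continuous, so this is smoothness.\<close>

definition test_fun :: "(real^'n \<Rightarrow> real) \<Rightarrow> bool" where
  "test_fun f \<longleftrightarrow>
     (\<forall>is x. iter_partial is f differentiable (at x)) \<and> compact (closure {x. f x \<noteq> 0})"

definition sobolev_exp :: "nat \<Rightarrow> real" where
  "sobolev_exp N = 2 * real N / (real N - 2)"

definition hardy_const :: "nat \<Rightarrow> real" where
  "hardy_const N = (real N - 2)\<^sup>2 / 4"

text \<open>The completion of the test functions in the norm of the gradient in \<open>L\<^sup>2\<close>, for dimension at
  least 3, realised as a space of functions: by the Sobolev inequality a Cauchy sequence in this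
  norm also converges in \<open>L\<close> with exponent \<^term>\<open>sobolev_exp CARD('n)\<close>, and the element of the
  completion that it represents is identified with this limit \<open>u\<close>; its gradient is the
  \<open>L\<^sup>2\<close>-limit \<open>G\<close>, which is determined by \<open>u\<close> up to null sets. As usual, functions that agree almost
  everywhere represent the same element; \<open>u\<close> is an arbitrary representative.\<close>

definition has_D12_gradient :: "(real^'n \<Rightarrow> real) \<Rightarrow> (real^'n \<Rightarrow> real^'n) \<Rightarrow> bool" where
  "has_D12_gradient u G \<longleftrightarrow>
     u \<in> borel_measurable lebesgue \<and> G \<in> borel_measurable lebesgue \<and>
     (\<exists>\<phi>. (\<forall>m. test_fun (\<phi> m)) \<and>
        (\<lambda>m::nat. \<integral>\<^sup>+x. ennreal ((norm (grad (\<phi> m) x - G x))\<^sup>2) \<partial>lebesgue) \<longlonglongrightarrow> 0 \<and>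
        (\<lambda>m. \<integral>\<^sup>+x. ennreal (\<bar>\<phi> m x - u x\<bar> powr sobolev_exp CARD('n)) \<partial>lebesgue) \<longlonglongrightarrow> 0)"

definition D12 :: "(real^'n \<Rightarrow> real) set" where
  "D12 = {u. \<exists>G. has_D12_gradient u G}"

definition D12_grad :: "(real^'n \<Rightarrow> real) \<Rightarrow> real^'n \<Rightarrow> real^'n" where
  "D12_grad u = (SOME G. has_D12_gradient u G)"

text \<open>Weak solutions of the system. In dimension at least 3, if the \<open>u j\<close> lie in \<^term>\<open>D12\<close> and are
  positive, and the exponents satisfy, for \<open>k \<noteq> j\<close>, \<open>\<alpha> j k \<ge> 1\<close> and \<open>\<alpha> j k + \<alpha> k j = sobolev_exp CARD('n)\<close>, all
  integrands below are integrable by the Sobolev and Hoelder inequalities. The powers are meaningful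
  for nonnegative \<open>u\<close> only; the definition is meant to be used for positive solutions. The value of
  the Hardy potential at the origin (\<open>x / 0 = 0\<close>) is irrelevant.\<close>

definition weak_solution ::
  "nat \<Rightarrow> (nat \<Rightarrow> real) \<Rightarrow> (nat \<Rightarrow> nat \<Rightarrow> real) \<Rightarrow> (nat \<Rightarrow> nat \<Rightarrow> real) \<Rightarrow>
   (nat \<Rightarrow> real^'n \<Rightarrow> real) \<Rightarrow> bool" where
  "weak_solution r lam \<alpha> \<beta> u \<longleftrightarrow>
     (\<forall>j\<in>{1..r}. u j \<in> D12 \<and>
       (\<forall>\<phi>. test_fun \<phi> \<longrightarrow>
          (\<integral>x. D12_grad (u j) x \<bullet> grad \<phi> x - lam j / (norm x)\<^sup>2 * u j x * \<phi> x \<partial>lebesgue) =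
          (\<integral>x. (u j x powr (sobolev_exp CARD('n) - 1)
               + (\<Sum>k\<in>{1..r} - {j}. \<beta> j k * \<alpha> j k * u j x powr (\<alpha> j k - 1) * u k x powr \<alpha> k j))
             * \<phi> x \<partial>lebesgue)))"

definition positive_solution ::
  "nat \<Rightarrow> (nat \<Rightarrow> real) \<Rightarrow> (nat \<Rightarrow> nat \<Rightarrow> real) \<Rightarrow> (nat \<Rightarrow> nat \<Rightarrow> real) \<Rightarrow>
   (nat \<Rightarrow> real^'n \<Rightarrow> real) \<Rightarrow> bool" where
  "positive_solution r lam \<alpha> \<beta> u \<longleftrightarrow>
     weak_solution r lam \<alpha> \<beta> u \<and> (\<forall>j\<in>{1..r}. \<forall>x. x \<noteq> 0 \<longrightarrow> u j x > 0)"

text \<open>Radial symmetry with respect to the origin, for an element of \<^term>\<open>D12\<close> given by an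
  arbitrary representative. The lemma below shows that a representative which is continuous
  away from the origin is then radially symmetric at every point.\<close>

definition radially_symmetric :: "(real^'n \<Rightarrow> real) \<Rightarrow> bool" where
  "radially_symmetric u \<longleftrightarrow> (\<exists>g. AE x in lebesgue. u x = g (norm x))"

lemma radially_symmetric_continuous:
  fixes u :: "real^'n \<Rightarrow> real"
  assumes rad: "radially_symmetric u" and cont: "continuous_on (- {0}) u"
    and xy: "norm x = norm y"
  shows "u x = u y"
proof (rule ccontr)
  assume neq: "u x \<noteq> u y"
  then have "x \<noteq> 0" using xy by auto
  obtain g where "AE x in lebesgue. u x = g (norm x)"
    using rad unfolding radially_symmetric_def by blast
  then have neg: "negligible {z. u z \<noteq> g (norm z)}" (is "negligible ?S")
    unfolding eventually_ae_filter_negligible using negligible_subset by blast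
  obtain T where T: "orthogonal_transformation T" "T x = y"
    using orthogonal_transformation_exists[OF xy] by blast
  define T' where "T' = inv T"
  have T': "orthogonal_transformation T'" "T' (T z) = z" for z
    using orthogonal_transformation_inv[OF T(1)] orthogonal_transformation_inj[OF T(1)]
    by (simp_all add: T'_def inv_f_f)
  have neg': "negligible (T' ` ?S)"
    using neg T'(1)
    by (intro negligible_differentiable_image_negligible)
       (auto intro: linear_imp_differentiable_on orthogonal_transformation_linear)
  have normT: "norm (T z) = norm z" for z
    using T(1) by (rule orthogonal_transformation_norm)
  have contT: "continuous_on (- {0}) (\<lambda>z. u (T z))"
  proof (rule continuous_on_compose2[OF cont])
    show "continuous_on (- {0}) T"
      using orthogonal_transformation_linear[OF T(1)]
      by (intro linear_continuous_on) (simp add: linear_conv_bounded_linear)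
    show "T ` (- {0}) \<subseteq> - {0}"
    proof (rule image_subsetI)
      fix z :: "real^'n" assume "z \<in> - {0}"
      then have "norm (T z) \<noteq> 0" by (simp add: normT)
      then show "T z \<in> - {0}" by simp
    qed
  qed
  let ?U = "- {0} \<inter> (\<lambda>z. u z - u (T z)) -` (- {0})"
  have "open ?U"
    by (intro continuous_open_preimage continuous_on_diff cont contT open_Compl closed_singleton)
  moreover have "x \<in> ?U" using \<open>x \<noteq> 0\<close> neq T(2) by auto
  moreover have "?U \<subseteq> ?S \<union> T' ` ?S"
  proof
    fix z assume "z \<in> ?U"
    then have "u z \<noteq> u (T z)" by simp
    then consider "z \<in> ?S" | "T z \<in> ?S"
      by (metis (mono_tags) mem_Collect_eq normT)
    then show "z \<in> ?S \<union> T' ` ?S"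
    proof cases
      case 2
      then have "T' (T z) \<in> T' ` ?S" by (rule imageI)
      then show ?thesis unfolding T'(2) by (rule UnI2)
    qed (rule UnI1)
  qed
  then have "negligible ?U" by (rule negligible_subset[OF negligible_Un[OF neg neg']])
  ultimately show False using open_not_negligible[of ?U] by (metis empty_iff)
qed

end

theory Submission
  imports Defs
begin

text \<open>Moving planes, carried out entirely at the level of weak solutions. For a unit vector \<open>e\<close> and
  \<open>\<mu> \<ge> 0\<close>, let \<open>R\<close> be the reflection in the hyperplane \<open>x \<bullet> e = \<mu>\<close>. Since \<open>R\<close> moves the points of the
  half-space \<open>x \<bullet> e > \<mu>\<close> closer to the origin and the nonlinearity is cooperative, testing the equations
  of \<open>u j\<close> and \<open>u j \<circ> R\<close> with the positive part of \<open>u j - u j \<circ> R\<close> on this half-space, and using the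
  Hardy inequality with its sharp constant and the Sobolev inequality, shows that \<open>u j \<le> u j \<circ> R\<close> there
  for all \<open>j\<close>, as soon as the set where one of these inequalities fails carries little of the critical Lebesgue
  norm of the solution. This starts the method at infinity. If the inequalities hold for
  some \<open>\<mu> > 0\<close>, they are strict almost everywhere, because the Hardy potential is strictly
  decreasing in the distance from the origin; by continuity of reflections in Lebesgue spaces they persist
  slightly below \<open>\<mu>\<close>. Hence they hold down to \<open>\<mu> = 0\<close>, for every direction \<open>e\<close>, and \<open>u j\<close> is
  invariant under all reflections in hyperplanes through the origin. No regularity theory and no
  maximum principle is needed.\<close>

section \<open>Hoelder's inequality and reflections\<close>

text \<open>The components may be singular at the origin and are fixed only up to null sets, so
  every stage is expressed through \<open>mass\<close>, the integral of \<open>U powr p\<close> over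
  the set where some inequality fails. The bound 2 on the coupling exponents is used as follows:
  \<open>\<alpha> j k - 1\<close> and \<open>\<alpha> k j\<close> are then at least 1, so a
  difference of nonlinearities is at most a multiple of \<open>U powr (p - 2)\<close> times the
  positive differences, and no lower bound on a component enters. Two such exponents can add up to
  2N/(N-2) only for N \<le> 4. The weight \<open>U powr (p - 2)\<close> is integrable to the power
  p/(p-2), which is what Hoelder and Sobolev require to bound the interaction by the Dirichlet
  energies times a power of the mass; the Hardy term is absorbed since each \<open>lam j\<close> is
  strictly below the Hardy constant. Strictness at one positive offset makes the mass tend to 0 near
  it by dominated convergence, and the smallness threshold is the same for all directions and
  offsets. At the end, invariance under a reflection holds off a null set that depends on the
  direction; Fubini's theorem removes this dependence.\<close>

lemma weighted_AM_GM:
  fixes x w :: "'a \<Rightarrow> real"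
  assumes "finite K" "\<And>k. k \<in> K \<Longrightarrow> 0 < w k" "(\<Sum>k\<in>K. w k) = 1" "\<And>k. k \<in> K \<Longrightarrow> 0 \<le> x k"
  shows "(\<Prod>k\<in>K. x k powr w k) \<le> (\<Sum>k\<in>K. w k * x k)"
\<comment> \<open>A zero entry makes the product zero, as \<open>0 powr w = 0\<close>; otherwise all
  logarithms make sense and Jensen's inequality for \<open>exp\<close> applies.\<close>
proof (cases "\<exists>k\<in>K. x k = 0")
  case True
  then have "(\<Prod>k\<in>K. x k powr w k) = 0"
    using assms(1) by (auto intro!: prod_zero)
  moreover have "0 \<le> (\<Sum>k\<in>K. w k * x k)"
    using assms by (intro sum_nonneg mult_nonneg_nonneg) (auto intro: less_imp_le)
  ultimately show ?thesis by simp
next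
  case False
  then have pos: "x k > 0" if "k \<in> K" for k using assms(4)[OF that] that by fastforce
  have ne: "K \<noteq> {}" using assms(3) by auto
  have "(\<Prod>k\<in>K. x k powr w k) = (\<Prod>k\<in>K. exp (w k * ln (x k)))"
    using False by (intro prod.cong refl) (simp add: powr_def)
  also have "\<dots> = exp (\<Sum>k\<in>K. w k *\<^sub>R ln (x k))"
    by (simp add: exp_sum[OF assms(1)])
  also have "\<dots> \<le> (\<Sum>k\<in>K. w k * exp (ln (x k)))"
    using assms(1-3) ne
    by (intro convex_on_sum[OF _ _ exp_convex]) (auto intro: less_imp_le)
  also have "\<dots> = (\<Sum>k\<in>K. w k * x k)"
    using pos by (intro sum.cong refl) auto
  finally show ?thesis .
qed

text \<open>Sends \<open>top\<close> to \<open>top\<close> and 0 to 0 for every exponent, so that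
  integrals which may be infinite can be raised to a power without side conditions.\<close>

definition epow :: "ennreal \<Rightarrow> real \<Rightarrow> ennreal" where
  "epow x w = (if x = top then top else ennreal (enn2real x powr w))"

lemma epow_top [simp]: "epow top w = top"
  by (simp add: epow_def)

lemma epow_ennreal [simp]: "0 \<le> x \<Longrightarrow> epow (ennreal x) w = ennreal (x powr w)"
  by (simp add: epow_def)

lemma epow_eq_0_iff [simp]: "epow x w = 0 \<longleftrightarrow> x = 0"
  by (cases x) (auto simp: epow_def ennreal_eq_0_iff)

lemma epow_eq_top_iff [simp]: "epow x w = top \<longleftrightarrow> x = top"
  by (cases x) (auto simp: epow_def)

lemma measurable_epow [measurable]:
  assumes [measurable]: "f \<in> borel_measurable M"
  shows "(\<lambda>x. epow (f x) w) \<in> borel_measurable M"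
  unfolding epow_def by measurable

lemma epow_mono: "x \<le> y \<Longrightarrow> 0 \<le> w \<Longrightarrow> epow x w \<le> epow y w"
  by (cases x; cases y) (auto intro!: powr_mono2 simp: epow_def top_unique)

lemma epow_epow: "epow (epow x a) b = epow x (a * b)"
  by (cases x) (auto simp: epow_def powr_powr)

lemma epow_1 [simp]: "epow x 1 = x"
  by (cases x) (auto simp: epow_def)

text \<open>AM-GM for the normalised factors \<open>f k / A k\<close>. With \<open>A k\<close> the
  integral of \<open>f k\<close>, integrating the sum on the right leaves the sum of the weights,
  which is 1.\<close>

lemma epow_prod_le:
  fixes f A :: "'a \<Rightarrow> ennreal"
  assumes K: "finite K" "\<And>k. k \<in> K \<Longrightarrow> 0 < w k" "(\<Sum>k\<in>K. w k) = 1"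
    and A: "\<And>k. k \<in> K \<Longrightarrow> A k \<noteq> 0" "\<And>k. k \<in> K \<Longrightarrow> A k \<noteq> top"
  shows "(\<Prod>k\<in>K. epow (f k) (w k)) \<le>
    (\<Prod>k\<in>K. epow (A k) (w k)) * (\<Sum>k\<in>K. ennreal (w k) * (f k / A k))"
proof (cases "\<exists>k\<in>K. f k = top")
  case True
  then obtain k where k: "k \<in> K" "f k = top" by auto
  have "ennreal (w k) * (f k / A k) = top"
    using k A[OF k(1)] K(2)[OF k(1)]
    by (simp add: ennreal_top_divide ennreal_mult_top)
  then have "(\<Sum>k\<in>K. ennreal (w k) * (f k / A k)) = top"
    using k(1) K(1) by (metis (mono_tags, lifting) ennreal_add_eq_top sum.remove)
  moreover have "(\<Prod>k\<in>K. epow (A k) (w k)) \<noteq> 0"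
    using K(1) A by auto
  ultimately show ?thesis by (simp only: ennreal_mult_top if_False top_greatest)
next
  case False
  define x where "x k = enn2real (f k)" for k
  define a where "a k = enn2real (A k)" for k
  have f: "f k = ennreal (x k)" "0 \<le> x k" if "k \<in> K" for k
    using False that by (auto simp: x_def less_top)
  have a: "A k = ennreal (a k)" "0 < a k" if "k \<in> K" for k
    using A[OF that] by (cases "A k"; auto simp: a_def)+
  have "(\<Prod>k\<in>K. epow (f k) (w k)) = (\<Prod>k\<in>K. ennreal (x k powr w k))"
    using f by (intro prod.cong refl) auto
  also have "\<dots> = ennreal (\<Prod>k\<in>K. x k powr w k)"
    by (simp add: prod_ennreal)
  also have "(\<Prod>k\<in>K. x k powr w k) = (\<Prod>k\<in>K. a k powr w k) * (\<Prod>k\<in>K. (x k / a k) powr w k)"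
    unfolding prod.distrib[symmetric]
  proof (intro prod.cong refl)
    fix k assume k: "k \<in> K"
    show "x k powr w k = a k powr w k * (x k / a k) powr w k"
      using f(2)[OF k] a(2)[OF k] by (simp add: powr_divide)
  qed
  also have "\<dots> \<le> (\<Prod>k\<in>K. a k powr w k) * (\<Sum>k\<in>K. w k * (x k / a k))"
    using K f(2) a(2) by (intro mult_left_mono weighted_AM_GM) (auto intro!: prod_nonneg divide_nonneg_pos)
  also have "ennreal \<dots> = ennreal (\<Prod>k\<in>K. a k powr w k) * ennreal (\<Sum>k\<in>K. w k * (x k / a k))"
    by (simp add: ennreal_mult' prod_nonneg)
  also have "ennreal (\<Prod>k\<in>K. a k powr w k) = (\<Prod>k\<in>K. epow (A k) (w k))"
    by (subst prod_ennreal[symmetric]) (use a in \<open>auto intro!: prod.cong simp: less_imp_le\<close>)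
  also have "ennreal (\<Sum>k\<in>K. w k * (x k / a k)) = (\<Sum>k\<in>K. ennreal (w k) * (f k / A k))"
  proof (subst sum_ennreal[symmetric])
    show "0 \<le> w k * (x k / a k)" if "k \<in> K" for k
      using K(2)[OF that] f(2)[OF that] a(2)[OF that] by simp
    show "(\<Sum>k\<in>K. ennreal (w k * (x k / a k))) = (\<Sum>k\<in>K. ennreal (w k) * (f k / A k))"
    proof (intro sum.cong refl)
      fix k assume k: "k \<in> K"
      show "ennreal (w k * (x k / a k)) = ennreal (w k) * (f k / A k)"
        using K(2)[OF k] f[OF k] a[OF k] by (simp add: ennreal_mult divide_ennreal del: times_divide_eq_right)
    qed
  qed
  finally show ?thesis by (simp add: ennreal_leI)
qed

text \<open>Normalisation divides by the integrals, so the values 0 and \<open>top\<close> are split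
  off beforehand. The form with finitely many factors is what the Loomis-Whitney argument
  consumes.\<close>

proposition Hoelder_nn_integral:
  fixes f :: "'b \<Rightarrow> 'a \<Rightarrow> ennreal"
  assumes K: "finite K" "\<And>k. k \<in> K \<Longrightarrow> 0 < w k" "(\<Sum>k\<in>K. w k) = 1"
    and f [measurable]: "\<And>k. k \<in> K \<Longrightarrow> f k \<in> borel_measurable M"
  shows "(\<integral>\<^sup>+x. (\<Prod>k\<in>K. epow (f k x) (w k)) \<partial>M) \<le> (\<Prod>k\<in>K. epow (\<integral>\<^sup>+x. f k x \<partial>M) (w k))"
proof (cases "\<exists>k\<in>K. (\<integral>\<^sup>+x. f k x \<partial>M) = 0")
  case True
  then obtain k where k: "k \<in> K" "(\<integral>\<^sup>+x. f k x \<partial>M) = 0" by auto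
  then have "AE x in M. f k x = 0" using f[OF k(1)] nn_integral_0_iff_AE by blast
  then have "AE x in M. (\<Prod>k\<in>K. epow (f k x) (w k)) = 0"
    by eventually_elim (use k(1) K(1) in auto)
  then have "(\<integral>\<^sup>+x. (\<Prod>k\<in>K. epow (f k x) (w k)) \<partial>M) = 0"
    using nn_integral_cong_AE[of "\<lambda>x. (\<Prod>k\<in>K. epow (f k x) (w k))" "\<lambda>_. 0" M] by simp
  then show ?thesis by simp
next
  case n0: False
  define A where "A k = (\<integral>\<^sup>+x. f k x \<partial>M)" for k
  show ?thesis
  proof (cases "\<exists>k\<in>K. A k = top")
    case True
    then obtain k where "k \<in> K" "A k = top" by auto
    then have "(\<Prod>k\<in>K. epow (A k) (w k)) = top"
      using n0 K(1) by (auto simp: A_def ennreal_prod_eq_top)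
    then show ?thesis by (simp add: A_def)
  next
    case False
    have A: "A k \<noteq> 0" "A k \<noteq> top" if "k \<in> K" for k
      using n0 False that by (auto simp: A_def)
    have "(\<integral>\<^sup>+x. (\<Prod>k\<in>K. epow (f k x) (w k)) \<partial>M) \<le>
        (\<integral>\<^sup>+x. (\<Prod>k\<in>K. epow (A k) (w k)) * (\<Sum>k\<in>K. ennreal (w k) * (f k x / A k)) \<partial>M)"
      by (intro nn_integral_mono epow_prod_le K A)
    also have "\<dots> = (\<Prod>k\<in>K. epow (A k) (w k)) * (\<Sum>k\<in>K. ennreal (w k) * (A k / A k))"
      by (simp add: nn_integral_cmult nn_integral_sum nn_integral_divide A_def)
    also have "(\<Sum>k\<in>K. ennreal (w k) * (A k / A k)) = (\<Sum>k\<in>K. ennreal (w k))"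
      using A by (intro sum.cong refl) (auto simp: ennreal_divide_self less_top[symmetric] zero_less_iff_neq_zero)
    also have "\<dots> = 1" using K by (subst sum_ennreal) (auto simp: less_imp_le)
    finally show ?thesis by (simp add: A_def)
  qed
qed

lemma Hoelder_nn_integral2:
  fixes f g :: "'a \<Rightarrow> ennreal"
  assumes ab: "0 < a" "0 < b" "a + b = 1"
    and f [measurable]: "f \<in> borel_measurable M" "g \<in> borel_measurable M"
  shows "(\<integral>\<^sup>+x. epow (f x) a * epow (g x) b \<partial>M) \<le> epow (\<integral>\<^sup>+x. f x \<partial>M) a * epow (\<integral>\<^sup>+x. g x \<partial>M) b"
  using Hoelder_nn_integral[of "UNIV :: bool set" "\<lambda>k. if k then a else b" "\<lambda>k. if k then f else g" M] ab f
  by (simp add: UNIV_bool mult.commute add.commute)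

text \<open>Along indices where the integrals drop below \<open>(1/2)^k\<close>, the sum of the
  chosen functions has a finite integral; it is finite almost everywhere and its terms tend to 0
  there.\<close>

lemma L1_AE_subseq:
  fixes f :: "nat \<Rightarrow> 'a \<Rightarrow> ennreal"
  assumes [measurable]: "\<And>m. f m \<in> borel_measurable M"
    and lim: "(\<lambda>m. \<integral>\<^sup>+x. f m x \<partial>M) \<longlonglongrightarrow> 0"
  shows "\<exists>s. strict_mono s \<and> (AE x in M. (\<lambda>m. f (s m) x) \<longlonglongrightarrow> 0)"
proof -
  have ev: "\<exists>n0. \<forall>n\<ge>n0. (\<integral>\<^sup>+x. f n x \<partial>M) < ennreal ((1/2)^k)" for k :: nat
    using order_tendstoD(2)[OF lim, of "ennreal ((1/2)^k)"]
    by (auto simp: eventually_sequentially)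
  then obtain n0 where n0: "\<And>k n. n \<ge> n0 k \<Longrightarrow> (\<integral>\<^sup>+x. f n x \<partial>M) < ennreal ((1/2)^k)" by metis
  define s where "s = rec_nat (n0 0) (\<lambda>k v. max (Suc v) (n0 (Suc k)))"
  have s_Suc: "s (Suc k) = max (Suc (s k)) (n0 (Suc k))" for k by (simp add: s_def)
  have sm: "strict_mono s" by (rule strict_mono_Suc_iff[THEN iffD2]) (simp add: s_Suc less_max_iff_disj)
  have s_ge: "s k \<ge> n0 k" for k by (cases k) (simp_all add: s_def)
  have "(\<integral>\<^sup>+x. (\<Sum>k. f (s k) x) \<partial>M) = (\<Sum>k. \<integral>\<^sup>+x. f (s k) x \<partial>M)"
    by (intro nn_integral_suminf) auto
  also have "\<dots> \<le> (\<Sum>k. ennreal ((1/2)^k))"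
    by (intro suminf_le) (auto intro: less_imp_le n0[OF s_ge])
  also have "\<dots> = ennreal (\<Sum>k. (1/2)^k)" by (rule suminf_ennreal2) auto
  finally have "(\<integral>\<^sup>+x. (\<Sum>k. f (s k) x) \<partial>M) \<noteq> \<infinity>" by (auto simp: top_unique)
  then have "AE x in M. (\<Sum>k. f (s k) x) \<noteq> \<infinity>" by (intro nn_integral_noteq_infinite) auto
  then have "AE x in M. (\<lambda>k. f (s k) x) \<longlonglongrightarrow> 0"
  proof eventually_elim
    case (elim x)
    have fin: "f (s k) x \<noteq> top" for k
    proof
      assume "f (s k) x = top"
      moreover have "(\<Sum>i\<in>{k}. f (s i) x) \<le> (\<Sum>i. f (s i) x)" by (intro sum_le_suminf) auto
      ultimately show False using elim by (simp add: top_unique)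
    qed
    have eq: "ennreal (enn2real (f (s k) x)) = f (s k) x" for k using fin[of k] by (simp add: less_top)
    have "summable (\<lambda>k. enn2real (f (s k) x))"
      by (rule summable_suminf_not_top) (use elim eq in auto)
    then have "(\<lambda>k. enn2real (f (s k) x)) \<longlonglongrightarrow> 0" by (rule summable_LIMSEQ_zero)
    then have "(\<lambda>k. ennreal (enn2real (f (s k) x))) \<longlonglongrightarrow> ennreal 0" by (rule tendsto_ennrealI)
    then show ?case by (simp add: eq)
  qed
  with sm show ?thesis by blast
qed

lemma powr_add_le:
  fixes a b q :: real
  assumes "0 \<le> a" "0 \<le> b" "0 \<le> q"
  shows "(a + b) powr q \<le> 2 powr q * (a powr q + b powr q)"
proof -
  have "(a + b) powr q \<le> (2 * max a b) powr q" using assms by (intro powr_mono2) auto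
  also have "\<dots> = 2 powr q * max a b powr q" using assms by (simp add: powr_mult)
  also have "max a b powr q \<le> a powr q + b powr q" by (simp add: max_def)
  finally show ?thesis by simp
qed

section \<open>Reflections in hyperplanes and invariance of Lebesgue measure\<close>

definition refl_hyp :: "real^'n \<Rightarrow> real \<Rightarrow> real^'n \<Rightarrow> real^'n" where
  "refl_hyp e \<mu> x = x - (2 * (x \<bullet> e - \<mu>)) *\<^sub>R e"

lemma refl_hyp_invol [simp]: "norm e = 1 \<Longrightarrow> refl_hyp e \<mu> (refl_hyp e \<mu> x) = x"
  by (simp add: refl_hyp_def inner_diff_left algebra_simps dot_square_norm)

lemma refl_hyp_inner: "norm e = 1 \<Longrightarrow> refl_hyp e \<mu> x \<bullet> e = 2 * \<mu> - x \<bullet> e"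
  by (simp add: refl_hyp_def inner_diff_left dot_square_norm)

text \<open>Reduces an affine reflection to the orthogonal map \<open>refl_hyp e 0\<close> and a
  translation; isometry and invariance of the measure follow from the two factors.\<close>

lemma refl_hyp_shift: "refl_hyp e \<mu> x = refl_hyp e 0 x + (2 * \<mu>) *\<^sub>R e"
  by (simp add: refl_hyp_def algebra_simps)

lemma linear_refl_hyp0: "linear (refl_hyp e 0)"
  by (rule linearI) (simp_all add: refl_hyp_def inner_add_left algebra_simps)

lemma refl_hyp0_inner: "norm e = 1 \<Longrightarrow> refl_hyp e 0 x \<bullet> refl_hyp e 0 y = x \<bullet> y"
  by (simp add: refl_hyp_def inner_diff_left inner_diff_right dot_square_norm algebra_simps inner_commute)

lemma refl_hyp0_adjoint: "refl_hyp e 0 x \<bullet> y = x \<bullet> refl_hyp e 0 y"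
  by (simp add: refl_hyp_def inner_diff_left inner_diff_right algebra_simps inner_commute)

lemma orthogonal_refl_hyp0: "norm e = 1 \<Longrightarrow> orthogonal_transformation (refl_hyp e 0)"
  by (simp add: orthogonal_transformation_def linear_refl_hyp0 refl_hyp0_inner)

lemma norm_refl_hyp0 [simp]: "norm e = 1 \<Longrightarrow> norm (refl_hyp e 0 x) = norm x"
  by (simp add: norm_eq_sqrt_inner refl_hyp0_inner)

text \<open>The source of monotonicity in the method: for \<mu> \<ge> 0 and
  \<open>x \<bullet> e > \<mu>\<close> the subtracted term is nonnegative, and positive if \<mu> >
  0, so the Hardy potential is larger at the reflected point.\<close>

lemma norm_refl_hyp_sq:
  "norm e = 1 \<Longrightarrow> (norm (refl_hyp e \<mu> x))\<^sup>2 = (norm x)\<^sup>2 - 4 * \<mu> * (x \<bullet> e - \<mu>)"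
  unfolding refl_hyp_def power2_norm_eq_inner norm_eq_1
  by (simp add: inner_diff_left inner_diff_right algebra_simps inner_commute)

lemma refl_hyp_vimage: "norm e = 1 \<Longrightarrow> refl_hyp e \<mu> -` A = refl_hyp e \<mu> ` A"
  by (auto intro!: image_eqI[where x="refl_hyp e \<mu> _"])

lemma refl_hyp_diff: "norm e = 1 \<Longrightarrow> norm (refl_hyp e \<mu> x - refl_hyp e \<mu> y) = norm (x - y)"
  by (subst (1 2) refl_hyp_shift)
     (simp add: linear_diff[OF linear_refl_hyp0, symmetric])

text \<open>The uniqueness argument for translation invariant measures, by Fubini and without
  determinants. The double integral of the indicators of the unit ball \<open>A\<close> and of
  \<open>B\<close> is computed in two orders; since \<open>T\<close> preserves \<open>A\<close>, one
  order gives the volume of \<open>A\<close> times the image measure of \<open>B\<close>, the other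
  the volume of \<open>A\<close> times that of \<open>B\<close>, and the volume of \<open>A\<close>
  cancels.\<close>

lemma distr_lborel_orthogonal:
  fixes T :: "'a::euclidean_space \<Rightarrow> 'a"
  assumes T: "orthogonal_transformation T"
  shows "distr lborel borel T = lborel"
proof (rule measure_eqI)
  fix B assume "B \<in> sets (distr lborel borel T)"
  then have [measurable]: "B \<in> sets borel" by simp
  have [measurable]: "T \<in> borel_measurable borel"
    using orthogonal_transformation_linear[OF T]
    by (intro borel_measurable_continuous_onI linear_continuous_on) (simp add: linear_conv_bounded_linear)
  \<comment> \<open>Translating y by \<open>- S x\<close> replaces \<open>T y\<close> by
    \<open>T y - x\<close>, which moves x from the indicator of the ball to that of
    \<open>B\<close>.\<close>
  define S where "S = inv T"
  have S: "T (y - S x) = T y - x" for x y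
    using orthogonal_transformation_surj[OF T]
    by (simp add: S_def linear_diff[OF orthogonal_transformation_linear[OF T]] surj_f_inv_f)
  define A where "A = (ball 0 1 :: 'a set)"
  have [measurable]: "A \<in> sets borel" by (simp add: A_def)
  have AT: "T y \<in> A \<longleftrightarrow> y \<in> A" for y
    by (simp add: A_def orthogonal_transformation_norm[OF T])
  have tr: "(\<integral>\<^sup>+x. f (c + x) \<partial>lborel) = (\<integral>\<^sup>+x. f x \<partial>lborel)"
    if [measurable]: "f \<in> borel_measurable borel" for f :: "'a \<Rightarrow> ennreal" and c
    by (subst (2) lborel_distr_plus[of c, symmetric]) (simp add: nn_integral_distr)
  have neg: "(\<integral>\<^sup>+x. f (c - x) \<partial>lborel) = (\<integral>\<^sup>+x. f x \<partial>lborel)"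
    if [measurable]: "f \<in> borel_measurable borel" for f :: "'a \<Rightarrow> ennreal" and c
    by (subst (2) lborel_affine[of "-1" c]) (simp_all add: nn_integral_distr nn_integral_density)
  have "emeasure lborel A * emeasure (distr lborel borel T) B
      = (\<integral>\<^sup>+y. (\<integral>\<^sup>+x. indicator A x \<partial>lborel) * indicator B (T y) \<partial>lborel)"
  proof (subst nn_integral_cmult)
    have "emeasure (distr lborel borel T) B = (\<integral>\<^sup>+y. indicator B y \<partial>distr lborel borel T)" by simp
    also have "\<dots> = (\<integral>\<^sup>+y. indicator B (T y) \<partial>lborel)" by (rule nn_integral_distr) auto
    finally show "emeasure lborel A * emeasure (distr lborel borel T) B
      = (\<integral>\<^sup>+x. indicator A x \<partial>lborel) * (\<integral>\<^sup>+y. indicator B (T y) \<partial>lborel)" by simp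
  qed auto
  also have "\<dots> = (\<integral>\<^sup>+y. (\<integral>\<^sup>+x. indicator A (T y + x) \<partial>lborel) * indicator B (T y) \<partial>lborel)"
    by (subst tr) auto
  also have "\<dots> = (\<integral>\<^sup>+y. (\<integral>\<^sup>+x. indicator A (T y + x) * indicator B (T y) \<partial>lborel) \<partial>lborel)"
    by (intro nn_integral_cong nn_integral_multc[symmetric]) auto
  also have "\<dots> = (\<integral>\<^sup>+x. (\<integral>\<^sup>+y. indicator A (T y + x) * indicator B (T y) \<partial>lborel) \<partial>lborel)"
    by (rule lborel_pair.Fubini') measurable
  also have "\<dots> = (\<integral>\<^sup>+x. (\<integral>\<^sup>+y. indicator A (T (- S x + y) + x) * indicator B (T (- S x + y)) \<partial>lborel) \<partial>lborel)"
    by (intro nn_integral_cong tr[symmetric]) measurable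
  also have "\<dots> = (\<integral>\<^sup>+x. (\<integral>\<^sup>+y. indicator A y * indicator B (T y - x) \<partial>lborel) \<partial>lborel)"
    using S by (simp add: indicator_def AT)
  also have "\<dots> = (\<integral>\<^sup>+y. (\<integral>\<^sup>+x. indicator A y * indicator B (T y - x) \<partial>lborel) \<partial>lborel)"
    by (rule lborel_pair.Fubini') measurable
  also have "\<dots> = (\<integral>\<^sup>+y. indicator A y * emeasure lborel B \<partial>lborel)"
    by (intro nn_integral_cong) (simp add: nn_integral_cmult neg)
  also have "\<dots> = emeasure lborel A * emeasure lborel B"
    by (simp add: nn_integral_multc)
  finally have "emeasure lborel A * emeasure (distr lborel borel T) B = emeasure lborel A * emeasure lborel B" .
  moreover have "emeasure lborel A \<noteq> 0" "emeasure lborel A \<noteq> top"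
    using emeasure_lborel_ball_finite[of "0::'a" 1] content_ball_pos[of 1 "0::'a"]
    by (auto simp: A_def measure_def)
  ultimately show "emeasure (distr lborel borel T) B = emeasure lborel B"
    by (simp add: ennreal_mult_cancel_left)
qed simp

lemma distr_lborel_refl_hyp:
  assumes e: "norm e = 1"
  shows "distr lborel borel (refl_hyp e \<mu>) = lborel"
proof -
  have [measurable]: "refl_hyp e 0 \<in> borel_measurable borel" unfolding refl_hyp_def by measurable
  have "distr lborel borel (refl_hyp e \<mu>) = distr (distr lborel borel (refl_hyp e 0)) borel ((+) ((2 * \<mu>) *\<^sub>R e))"
    by (subst distr_distr) (auto simp: o_def refl_hyp_shift[of e \<mu>, abs_def] add.commute)
  also have "\<dots> = lborel"
    by (simp add: distr_lborel_orthogonal[OF orthogonal_refl_hyp0[OF e]] lborel_distr_plus)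
  finally show ?thesis .
qed

text \<open>Measurability with respect to the completed measure on both sides requires that
  preimages of null sets be null; invariance of the Borel measure supplies this, and push-forward
  then commutes with completion.\<close>

lemma
  assumes e: "norm e = 1"
  shows measurable_refl_hyp [measurable]: "refl_hyp e \<mu> \<in> lebesgue \<rightarrow>\<^sub>M lebesgue"
    and distr_refl_hyp: "distr lebesgue lebesgue (refl_hyp e \<mu>) = lebesgue"
proof -
  have [measurable]: "refl_hyp e \<mu> \<in> borel_measurable borel" unfolding refl_hyp_def by measurable
  have d: "distr lebesgue lborel (refl_hyp e \<mu>) = lborel"
    using distr_lborel_refl_hyp[OF e, of \<mu>] by (simp add: distr_completion cong: distr_cong)
  show "refl_hyp e \<mu> \<in> lebesgue \<rightarrow>\<^sub>M lebesgue"
    by (simp add: completion.measurable_completion2 d measurable_completion)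
  have "distr lebesgue lebesgue (refl_hyp e \<mu>) = completion (distr lebesgue lborel (refl_hyp e \<mu>))"
    by (rule completion.completion_distr_eq[symmetric]) (auto simp: d measurable_completion)
  then show "distr lebesgue lebesgue (refl_hyp e \<mu>) = lebesgue" by (simp add: d)
qed

lemma nn_integral_refl_hyp:
  assumes "norm e = 1" "f \<in> borel_measurable lebesgue"
  shows "(\<integral>\<^sup>+x. f (refl_hyp e \<mu> x) \<partial>lebesgue) = (\<integral>\<^sup>+x. f x \<partial>lebesgue)"
  using nn_integral_distr[OF measurable_refl_hyp[OF assms(1), of \<mu>], of f] assms
  by (simp add: distr_refl_hyp)

lemma integral_refl_hyp:
  fixes f :: "real^'n \<Rightarrow> 'b::{banach,second_countable_topology}"
  assumes "norm e = 1" "f \<in> borel_measurable lebesgue"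
  shows "(\<integral>x. f (refl_hyp e \<mu> x) \<partial>lebesgue) = (\<integral>x. f x \<partial>lebesgue)"
    and "integrable lebesgue (\<lambda>x. f (refl_hyp e \<mu> x)) \<longleftrightarrow> integrable lebesgue f"
  using integral_distr[OF measurable_refl_hyp[OF assms(1), of \<mu>], of f]
        integrable_distr_eq[OF measurable_refl_hyp[OF assms(1), of \<mu>], of f] assms
  by (simp_all add: distr_refl_hyp)

lemma AE_refl_hyp:
  assumes "norm e = 1" "AE x in lebesgue. P x"
  shows "AE x in lebesgue. P (refl_hyp e \<mu> x)"
  using AE_distrD[OF measurable_refl_hyp[OF assms(1)], of P] assms
  unfolding distr_refl_hyp[OF assms(1)] by blast

section \<open>Smooth functions and test functions\<close>

text \<open>\<open>test_fun\<close> without the support condition, for multipliers such as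
  \<open>x \<bullet> e\<close> and powers of the distance.\<close>

definition smooth :: "(real^'n \<Rightarrow> real) \<Rightarrow> bool" where
  "smooth f \<longleftrightarrow> (\<forall>is x. iter_partial is f differentiable (at x))"

lemma test_fun_iff: "test_fun f \<longleftrightarrow> smooth f \<and> bounded {x. f x \<noteq> 0}"
  unfolding test_fun_def smooth_def by simp

lemma iter_partial_append: "iter_partial (is @ js) f = iter_partial is (iter_partial js f)"
  by (induction "is") auto

lemma smooth_differentiable: "smooth f \<Longrightarrow> f differentiable (at x)"
  unfolding smooth_def by (metis iter_partial.simps(1))

lemma smooth_partial_deriv: "smooth f \<Longrightarrow> smooth (partial_deriv i f)"
  unfolding smooth_def using iter_partial_append[of _ "[i]" f] by (metis iter_partial.simps)

lemma partial_deriv_eq: "(f has_derivative D) (at x) \<Longrightarrow> partial_deriv i f x = D (axis i 1)"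
  unfolding partial_deriv_def by (simp add: frechet_derivative_at[symmetric])

lemma has_derivative_grad:
  fixes f :: "real^'n \<Rightarrow> real"
  assumes "f differentiable (at x)"
  shows "(f has_derivative (\<lambda>h. h \<bullet> grad f x)) (at x)"
proof -
  let ?D = "frechet_derivative f (at x)"
  have D: "(f has_derivative ?D) (at x)" using assms by (simp add: frechet_derivative_works)
  have lin: "linear ?D" using D by (rule has_derivative_linear)
  have "?D h = h \<bullet> grad f x" for h
  proof -
    have "?D h = ?D (\<Sum>i\<in>UNIV. (h $ i) *\<^sub>R axis i 1)"
      using basis_expansion[of h] by (simp only: scalar_mult_eq_scaleR)
    also have "\<dots> = h \<bullet> grad f x"
      by (simp add: linear_sum[OF lin] linear_cmul[OF lin] inner_vec_def grad_def partial_deriv_def)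
    finally show ?thesis .
  qed
  then have "?D = (\<lambda>h. h \<bullet> grad f x)" by auto
  with D show ?thesis by simp
qed

lemma grad_eqI:
  assumes "(f has_derivative (\<lambda>h. h \<bullet> g)) (at x)"
  shows "grad f x = g"
  using partial_deriv_eq[OF assms]
  by (simp add: grad_def vec_eq_iff inner_axis')

lemma grad_nth [simp]: "grad f x $ i = partial_deriv i f x"
  by (simp add: grad_def)

text \<open>\<open>smooth\<close> quantifies over lists of derivatives, and the derivative of a
  product is no longer a product, so an induction over the list does not close. This class is stable
  under partial derivatives and consists of differentiable functions; hence it coincides with
  \<open>smooth\<close>, and its introduction rules become closure properties of
  \<open>smooth\<close>.\<close>

inductive smooth_alg :: "(real^'n \<Rightarrow> real) \<Rightarrow> bool" where
  sa_base: "smooth f \<Longrightarrow> smooth_alg f"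
| sa_const: "smooth_alg (\<lambda>x. c)"
| sa_inner: "smooth_alg (\<lambda>x. x \<bullet> e)"
| sa_add: "smooth_alg f \<Longrightarrow> smooth_alg g \<Longrightarrow> smooth_alg (\<lambda>x. f x + g x)"
| sa_mult: "smooth_alg f \<Longrightarrow> smooth_alg g \<Longrightarrow> smooth_alg (\<lambda>x. f x * g x)"
| sa_powr: "smooth_alg f \<Longrightarrow> (\<And>x. f x > 0) \<Longrightarrow> smooth_alg (\<lambda>x. f x powr p)"
| sa_refl: "smooth_alg f \<Longrightarrow> smooth_alg (\<lambda>x. f (refl_hyp e \<mu> x))"

lemma has_derivative_refl_hyp: "(refl_hyp e \<mu> has_derivative refl_hyp e 0) (at x)"
  unfolding refl_hyp_def by (auto intro!: derivative_eq_intros ext)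

lemma smooth_alg_differentiable: "smooth_alg f \<Longrightarrow> f differentiable (at x)"
proof (induction arbitrary: x rule: smooth_alg.induct)
  case (sa_base f)
  then show ?case by (rule smooth_differentiable)
next
  case (sa_inner e)
  show ?case unfolding differentiable_def by (rule exI, rule derivative_eq_intros) (auto intro!: derivative_eq_intros)
next
  case (sa_powr f p)
  have "(f has_derivative frechet_derivative f (at x)) (at x)"
    using sa_powr.IH by (simp add: frechet_derivative_works)
  from has_derivative_powr[OF this has_derivative_const[of p]] sa_powr.hyps(2)[of x]
  show ?case unfolding differentiable_def by auto
next
  case (sa_refl f e \<mu>)
  show ?case
    using differentiable_chain_at[of "refl_hyp e \<mu>" x f] sa_refl.IH[of "refl_hyp e \<mu> x"]
      has_derivative_refl_hyp[of e \<mu> x]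
    by (auto simp: o_def differentiable_def)
qed auto

lemma smooth_alg_sum: "finite I \<Longrightarrow> (\<And>i. i \<in> I \<Longrightarrow> smooth_alg (f i)) \<Longrightarrow> smooth_alg (\<lambda>x. \<Sum>i\<in>I. f i x)"
  by (induction I rule: finite_induct) (auto intro: smooth_alg.sa_const smooth_alg.sa_add)

lemma smooth_alg_partial_deriv: "smooth_alg f \<Longrightarrow> smooth_alg (partial_deriv i f)"
proof (induction arbitrary: i rule: smooth_alg.induct)
  case (sa_base f)
  then show ?case by (intro smooth_alg.sa_base smooth_partial_deriv)
next
  case (sa_const c)
  have "partial_deriv i (\<lambda>x. c) = (\<lambda>x. 0)"
    by (rule ext, subst partial_deriv_eq[OF has_derivative_const]) simp
  then show ?case by (simp add: smooth_alg.sa_const)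
next
  case (sa_inner e)
  have "((\<lambda>x. x \<bullet> e) has_derivative (\<lambda>h. h \<bullet> e)) (at x)" for x
    by (auto intro!: derivative_eq_intros)
  then have "partial_deriv i (\<lambda>x. x \<bullet> e) = (\<lambda>x. axis i 1 \<bullet> e)"
    using partial_deriv_eq by blast
  then show ?case by (simp add: smooth_alg.sa_const)
next
  case (sa_add f g)
  have "((\<lambda>x. f x + g x) has_derivative (\<lambda>h. h \<bullet> grad f x + h \<bullet> grad g x)) (at x)" for x
    by (intro has_derivative_add has_derivative_grad smooth_alg_differentiable sa_add)
  then have "partial_deriv i (\<lambda>x. f x + g x) = (\<lambda>x. partial_deriv i f x + partial_deriv i g x)"
    by (intro ext) (subst partial_deriv_eq, assumption, simp add: inner_axis')
  then show ?case using sa_add by (simp add: smooth_alg.sa_add)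
next
  case (sa_mult f g)
  have "((\<lambda>x. f x * g x) has_derivative (\<lambda>h. f x * (h \<bullet> grad g x) + (h \<bullet> grad f x) * g x)) (at x)" for x
    by (intro has_derivative_mult has_derivative_grad smooth_alg_differentiable sa_mult)
  then have "partial_deriv i (\<lambda>x. f x * g x) = (\<lambda>x. f x * partial_deriv i g x + partial_deriv i f x * g x)"
    by (intro ext) (subst partial_deriv_eq, assumption, simp add: inner_axis')
  then show ?case using sa_mult by (auto intro!: smooth_alg.sa_add smooth_alg.sa_mult)
next
  case (sa_powr f p)
  have "((\<lambda>x. f x powr p) has_derivative (\<lambda>h. p * f x powr (p - 1) * (h \<bullet> grad f x))) (at x)" for x
  proof -
    have "((\<lambda>x. f x powr p) has_derivative (\<lambda>h. f x powr p * (0 * ln (f x) + (h \<bullet> grad f x) * p / f x))) (at x)"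
      using sa_powr.hyps(2)[of x]
      by (intro has_derivative_powr has_derivative_grad smooth_alg_differentiable sa_powr has_derivative_const) auto
    also have "(\<lambda>h. f x powr p * (0 * ln (f x) + (h \<bullet> grad f x) * p / f x)) =
        (\<lambda>h. p * f x powr (p - 1) * (h \<bullet> grad f x))"
      using sa_powr.hyps(2)[of x] by (auto simp: powr_diff field_simps)
    finally show ?thesis .
  qed
  then have "partial_deriv i (\<lambda>x. f x powr p) = (\<lambda>x. p * f x powr (p - 1) * partial_deriv i f x)"
    by (intro ext) (subst partial_deriv_eq, assumption, simp add: inner_axis')
  then show ?case using sa_powr by (auto intro!: smooth_alg.sa_mult smooth_alg.sa_powr intro: smooth_alg.sa_const)
next
  case (sa_refl f e \<mu>)
  have D: "((\<lambda>x. f (refl_hyp e \<mu> x)) has_derivative (\<lambda>h. refl_hyp e 0 h \<bullet> grad f (refl_hyp e \<mu> x))) (at x)" for x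
    using has_derivative_compose[OF has_derivative_refl_hyp
        has_derivative_grad[OF smooth_alg_differentiable[OF sa_refl.hyps]]] .
  have "partial_deriv i (\<lambda>x. f (refl_hyp e \<mu> x)) =
      (\<lambda>x. \<Sum>k\<in>UNIV. refl_hyp e 0 (axis i 1) $ k * partial_deriv k f (refl_hyp e \<mu> x))"
    by (rule ext, subst partial_deriv_eq[OF D]) (simp add: inner_vec_def)
  moreover have "smooth_alg (partial_deriv k f)" for k by (rule sa_refl.IH)
  ultimately show ?case
    by (auto intro!: smooth_alg_sum smooth_alg.sa_mult intro: smooth_alg.sa_const smooth_alg.sa_refl)
qed


lemma smooth_alg_iff: "smooth_alg f \<longleftrightarrow> smooth f"
proof
  assume f: "smooth_alg f"
  have "smooth_alg (iter_partial is f)" for "is"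
    by (induction "is") (auto intro: f smooth_alg_partial_deriv)
  then show "smooth f" unfolding smooth_def using smooth_alg_differentiable by blast
qed (rule smooth_alg.sa_base)

lemmas smooth_const = smooth_alg.sa_const[unfolded smooth_alg_iff]
  and smooth_inner = smooth_alg.sa_inner[unfolded smooth_alg_iff]
  and smooth_add = smooth_alg.sa_add[unfolded smooth_alg_iff]
  and smooth_mult = smooth_alg.sa_mult[unfolded smooth_alg_iff]
  and smooth_powr = smooth_alg.sa_powr[unfolded smooth_alg_iff]
  and smooth_refl = smooth_alg.sa_refl[unfolded smooth_alg_iff]

lemma smooth_power: "smooth f \<Longrightarrow> smooth (\<lambda>x. f x ^ n)"
  by (induction n) (auto intro: smooth_const smooth_mult)

lemma smooth_sum: "finite I \<Longrightarrow> (\<And>i. i \<in> I \<Longrightarrow> smooth (f i)) \<Longrightarrow> smooth (\<lambda>x. \<Sum>i\<in>I. f i x)"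
  using smooth_alg_sum[unfolded smooth_alg_iff] .

lemma smooth_norm_sq: "smooth (\<lambda>x::real^'n. (norm x)\<^sup>2)"
proof -
  have "(\<lambda>x::real^'n. (norm x)\<^sup>2) = (\<lambda>x. \<Sum>i\<in>UNIV. (x \<bullet> axis i 1) * (x \<bullet> axis i 1))"
    by (simp add: power2_norm_eq_inner inner_axis fun_eq_iff, simp add: inner_vec_def)
  moreover have "smooth (\<lambda>x::real^'n. \<Sum>i\<in>UNIV. (x \<bullet> axis i 1) * (x \<bullet> axis i 1))"
    by (auto intro!: smooth_sum smooth_mult smooth_inner)
  ultimately show ?thesis by (simp only:)
qed

lemma smooth_has_derivative: "smooth f \<Longrightarrow> (f has_derivative (\<lambda>h. h \<bullet> grad f x)) (at x)"
  by (intro has_derivative_grad smooth_differentiable)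

lemma smooth_continuous: "smooth f \<Longrightarrow> continuous_on S f"
  by (meson continuous_at_imp_continuous_on differentiable_imp_continuous_within smooth_differentiable)

lemma smooth_grad_continuous: "smooth f \<Longrightarrow> continuous_on S (grad f)"
  unfolding grad_def by (intro continuous_on_vec_lambda smooth_continuous smooth_partial_deriv)

lemma smooth_borel [measurable]: "smooth f \<Longrightarrow> f \<in> borel_measurable borel"
  by (intro borel_measurable_continuous_onI smooth_continuous)

lemma smooth_grad_borel [measurable]: "smooth f \<Longrightarrow> grad f \<in> borel_measurable borel"
  by (intro borel_measurable_continuous_onI smooth_grad_continuous)

lemma grad_mult:
  "smooth f \<Longrightarrow> smooth g \<Longrightarrow> grad (\<lambda>x. f x * g x) x = f x *\<^sub>R grad g x + g x *\<^sub>R grad f x"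
  by (intro grad_eqI, rule has_derivative_eq_rhs)
     (rule has_derivative_mult smooth_has_derivative | assumption | simp add: inner_add_right fun_eq_iff)+

lemma grad_add:
  "smooth f \<Longrightarrow> smooth g \<Longrightarrow> grad (\<lambda>x. f x + g x) x = grad f x + grad g x"
  by (intro grad_eqI, rule has_derivative_eq_rhs)
     (rule has_derivative_add smooth_has_derivative | assumption | simp add: inner_add_right fun_eq_iff)+

lemma grad_compose:
  assumes "smooth f" "(h has_real_derivative d) (at (f x))"
  shows "grad (\<lambda>x. h (f x)) x = d *\<^sub>R grad f x"
proof (rule grad_eqI)
  have "(h has_derivative (\<lambda>t. t * d)) (at (f x))"
    using assms(2) by (simp add: has_field_derivative_def mult.commute[of _ d])
  from has_derivative_compose[OF smooth_has_derivative[OF assms(1)] this]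
  show "((\<lambda>x. h (f x)) has_derivative (\<lambda>k. k \<bullet> d *\<^sub>R grad f x)) (at x)"
    by (simp add: mult.commute)
qed

lemma grad_refl:
  assumes "smooth f"
  shows "grad (\<lambda>x. f (refl_hyp e \<mu> x)) x = refl_hyp e 0 (grad f (refl_hyp e \<mu> x))"
  by (rule grad_eqI)
     (use has_derivative_compose[OF has_derivative_refl_hyp smooth_has_derivative[OF assms]] in
       \<open>simp add: refl_hyp0_adjoint\<close>)

section \<open>Test functions: closure properties, bounds, and integrals of derivatives\<close>

lemma test_fun_smooth: "test_fun f \<Longrightarrow> smooth f"
  by (simp add: test_fun_iff)

lemma test_funI:
  assumes "smooth g" "test_fun f" "\<And>x. f x = 0 \<Longrightarrow> g x = 0"
  shows "test_fun g"
  using assms unfolding test_fun_iff by (auto elim!: bounded_subset)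

lemma test_fun_support:
  assumes "test_fun f"
  obtains K where "K > 0" "\<And>x. norm x > K \<Longrightarrow> f x = 0" "\<And>x. norm x > K \<Longrightarrow> grad f x = 0"
proof -
  obtain K where K: "K > 0" "\<And>x. f x \<noteq> 0 \<Longrightarrow> norm x \<le> K"
    using assms unfolding test_fun_iff bounded_pos by auto
  have "grad f x = 0" if "norm x > K" for x
  proof (rule grad_eqI, rule has_derivative_transform_within_open[of "\<lambda>x. 0" _ _ _ "- cball 0 K"])
    show "((\<lambda>x. 0) has_derivative (\<lambda>h. h \<bullet> 0)) (at x)" by simp
    show "x \<in> - cball 0 K" using that by simp
    show "0 = f y" if "y \<in> - cball 0 K" for y using K(2)[of y] that by force
  qed auto
  with K that show thesis by (meson not_le)
qed

lemma test_fun_partial_deriv: "test_fun f \<Longrightarrow> test_fun (partial_deriv i f)"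
proof -
  assume f: "test_fun f"
  obtain K where "K > 0" and "\<And>x. norm x > K \<Longrightarrow> grad f x = 0" by (rule test_fun_support[OF f]) blast
  then have "norm x > K \<Longrightarrow> partial_deriv i f x = 0" for x using grad_nth[of f x i] by simp
  then have "bounded {x. partial_deriv i f x \<noteq> 0}"
    unfolding bounded_iff by (intro exI[of _ K]) (auto simp: not_le[symmetric])
  with f show ?thesis by (simp add: test_fun_iff smooth_partial_deriv)
qed

lemma test_fun_mult: "test_fun f \<Longrightarrow> smooth g \<Longrightarrow> test_fun (\<lambda>x. f x * g x)"
  by (rule test_funI[of _ f]) (auto intro: smooth_mult test_fun_smooth)

lemma test_fun_add:
  assumes "test_fun f" "test_fun g" shows "test_fun (\<lambda>x. f x + g x)"
proof -
  have "bounded ({x. f x \<noteq> 0} \<union> {x. g x \<noteq> 0})" using assms by (simp add: test_fun_iff)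
  then have "bounded {x. f x + g x \<noteq> 0}" by (rule bounded_subset) auto
  with assms show ?thesis by (simp add: test_fun_iff smooth_add)
qed

lemma test_fun_cmult: "test_fun f \<Longrightarrow> test_fun (\<lambda>x. c * f x)"
  by (rule test_funI[of _ f]) (auto intro: smooth_mult smooth_const test_fun_smooth)

lemma test_fun_refl:
  assumes "norm e = 1" "test_fun f" shows "test_fun (\<lambda>x. f (refl_hyp e \<mu> x))"
proof -
  have "{x. f (refl_hyp e \<mu> x) \<noteq> 0} = refl_hyp e \<mu> ` {x. f x \<noteq> 0}"
    using refl_hyp_vimage[OF assms(1), of \<mu> "{x. f x \<noteq> 0}"] by auto
  moreover have "bounded (refl_hyp e \<mu> ` {x. f x \<noteq> 0})"
  proof -
    obtain B where B: "\<And>x. f x \<noteq> 0 \<Longrightarrow> norm x \<le> B"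
      using assms(2) by (auto simp: test_fun_iff bounded_iff)
    have "norm (refl_hyp e \<mu> x) \<le> B + \<bar>2 * \<mu>\<bar>" if "f x \<noteq> 0" for x
      using B[OF that] norm_triangle_ineq[of "refl_hyp e 0 x" "(2 * \<mu>) *\<^sub>R e"] assms(1)
      by (simp add: refl_hyp_shift[of e \<mu>])
    then show ?thesis by (auto simp: bounded_iff)
  qed
  ultimately show ?thesis using assms by (simp add: test_fun_iff smooth_refl)
qed

lemma test_fun_bounded:
  fixes f :: "real^'n \<Rightarrow> real"
  assumes "test_fun f"
  obtains B where "B > 0" "\<And>x. \<bar>f x\<bar> \<le> B" "\<And>x. norm (grad f x) \<le> B"
proof -
  obtain K where K: "K > 0" "\<And>x. norm x > K \<Longrightarrow> f x = 0" "\<And>x. norm x > K \<Longrightarrow> grad f x = 0"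
    by (rule test_fun_support[OF assms]) blast
  have "compact (f ` cball 0 K)" "compact (grad f ` cball 0 K)"
    by (intro compact_continuous_image smooth_continuous smooth_grad_continuous test_fun_smooth assms compact_cball)+
  then have "bounded (f ` cball 0 K)" "bounded (grad f ` cball 0 K)"
    by (auto intro: compact_imp_bounded)
  then obtain a b where ab0: "\<And>y. y \<in> f ` cball 0 K \<Longrightarrow> norm y \<le> a" "\<And>y. y \<in> grad f ` cball 0 K \<Longrightarrow> norm y \<le> b"
    unfolding bounded_iff by blast
  have ab: "\<And>x. norm x \<le> K \<Longrightarrow> \<bar>f x\<bar> \<le> a" "\<And>x. norm x \<le> K \<Longrightarrow> norm (grad f x) \<le> b" for x :: "real^'n"
    using ab0 by auto
  show thesis
  proof (rule that[of "1 + \<bar>a\<bar> + \<bar>b\<bar>"])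
    show "\<bar>f x\<bar> \<le> 1 + \<bar>a\<bar> + \<bar>b\<bar>" for x using ab(1)[of x] K(2)[of x] by (cases "norm x \<le> K") auto
    show "norm (grad f x) \<le> 1 + \<bar>a\<bar> + \<bar>b\<bar>" for x using ab(2)[of x] K(3)[of x] by (cases "norm x \<le> K") auto
  qed simp
qed

lemma test_fun_Lipschitz:
  assumes "test_fun f"
  obtains L where "L > 0" "\<And>x y. \<bar>f x - f y\<bar> \<le> L * norm (x - y)"
proof -
  obtain B where B: "B > 0" "\<And>x. norm (grad f x) \<le> B" by (rule test_fun_bounded[OF assms]) blast
  have "norm (f x - f y) \<le> B * norm (x - y)" for x y
  proof (rule differentiable_bound[of UNIV f "\<lambda>x h. h \<bullet> grad f x"])
    show "(f has_derivative (\<lambda>h. h \<bullet> grad f x)) (at x within UNIV)" for x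
      using smooth_has_derivative[OF test_fun_smooth[OF assms]] by simp
    show "onorm (\<lambda>h. h \<bullet> grad f x) \<le> B" for x
    proof (rule onorm_le)
      fix h show "norm (h \<bullet> grad f x) \<le> B * norm h"
        using Cauchy_Schwarz_ineq2[of h "grad f x"] mult_left_mono[OF B(2)[of x], of "norm h"]
        by (simp add: mult.commute)
    qed
  qed auto
  with B(1) that show thesis by (simp add: real_norm_def)
qed

lemma integrable_compact_support:
  fixes f :: "'a::euclidean_space \<Rightarrow> 'b::{banach, second_countable_topology}"
  assumes "continuous_on UNIV f" "\<And>x. norm x > K \<Longrightarrow> f x = 0"
  shows "integrable lebesgue f"
proof -
  have "integrable lborel (\<lambda>x. indicator (cball 0 K) x *\<^sub>R f x)"
    by (rule borel_integrable_compact) (auto intro: continuous_on_subset[OF assms(1)])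
  also have "(\<lambda>x. indicator (cball 0 K) x *\<^sub>R f x) = f"
    using assms(2) by (auto simp: indicator_def fun_eq_iff not_le)
  finally show ?thesis
    using borel_measurable_continuous_onI[OF assms(1)] by (subst integrable_completion) auto
qed

text \<open>Difference quotients have integral 0 by translation invariance, and they converge to the
  derivative under a common bound coming from the Lipschitz constant.\<close>

lemma integral_partial_deriv_eq_0:
  fixes f :: "real^'n \<Rightarrow> real"
  assumes f: "test_fun f"
  shows "(\<integral>x. partial_deriv i f x \<partial>lebesgue) = 0"
proof -
  obtain L where L: "L > 0" "\<And>x y. \<bar>f x - f y\<bar> \<le> L * norm (x - y)" by (rule test_fun_Lipschitz[OF f]) blast
  obtain K where K: "K > 0" "\<And>x. norm x > K \<Longrightarrow> f x = 0" by (rule test_fun_support[OF f]) blast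
  define e where "e = (axis i 1 :: real^'n)"
  have e: "norm e = 1" by (simp add: e_def)
  define c where "c m = (1 / real (Suc m))" for m
  define q where "q m x = (f (x + c m *\<^sub>R e) - f x) / c m" for m x
  have c: "c m > 0" "c m \<le> 1" for m by (auto simp: c_def)
  have [measurable]: "f \<in> borel_measurable borel" "partial_deriv i f \<in> borel_measurable borel"
    using test_fun_smooth[OF f] smooth_partial_deriv[of f i] by auto
  have fi: "integrable lborel f"
    using integrable_compact_support[of f K] K(2) smooth_continuous[OF test_fun_smooth[OF f]]
    by (subst (asm) integrable_completion) auto
  \<comment> \<open>The steps \<open>c m\<close> are at most 1, so all quotients vanish outside the
    ball of radius \<open>K + 1\<close>.\<close>
  have "(\<lambda>m. \<integral>x. q m x \<partial>lborel) \<longlonglongrightarrow> (\<integral>x. partial_deriv i f x \<partial>lborel)"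
  proof (rule integral_dominated_convergence[where w="\<lambda>x. indicator (cball 0 (K+1)) x *\<^sub>R L"])
    show "q m \<in> borel_measurable lborel" for m unfolding q_def by measurable
    show "integrable lborel (\<lambda>x::real^'n. indicator (cball 0 (K+1)) x *\<^sub>R L)"
      by (rule borel_integrable_compact) auto
    have "(\<lambda>m. q m x) \<longlonglongrightarrow> partial_deriv i f x" for x
    proof -
      have "((\<lambda>t. f (x + t *\<^sub>R e)) has_derivative (\<lambda>t. (t *\<^sub>R e) \<bullet> grad f x)) (at 0)"
        by (rule has_derivative_compose[of "\<lambda>t. x + t *\<^sub>R e" "\<lambda>t. t *\<^sub>R e" 0 UNIV f, simplified])
           (auto intro!: derivative_eq_intros smooth_has_derivative test_fun_smooth[OF f])
      then have "((\<lambda>t. f (x + t *\<^sub>R e)) has_real_derivative partial_deriv i f x) (at 0)"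
        unfolding has_field_derivative_def by (rule has_derivative_eq_rhs) (auto simp: e_def inner_axis' fun_eq_iff)
      then have "((\<lambda>t. (f (x + t *\<^sub>R e) - f x) / t) \<longlongrightarrow> partial_deriv i f x) (at 0)"
        by (simp add: DERIV_def)
      moreover have "filterlim c (at 0) sequentially"
        unfolding filterlim_at c_def using LIMSEQ_inverse_real_of_nat
        by (auto simp: inverse_eq_divide)
      ultimately show ?thesis unfolding q_def by (rule filterlim_compose)
    qed
    then show "AE x in lborel. (\<lambda>m. q m x) \<longlonglongrightarrow> partial_deriv i f x" by simp
    show "AE x in lborel. norm (q m x) \<le> indicator (cball 0 (K+1)) x *\<^sub>R L" for m
    proof (intro AE_I2)
      fix x show "norm (q m x) \<le> indicator (cball 0 (K+1)) x *\<^sub>R L"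
      proof (cases "norm x \<le> K + 1")
        case True
        have "\<bar>f (x + c m *\<^sub>R e) - f x\<bar> \<le> L * c m"
          using L(2)[of "x + c m *\<^sub>R e" x] c[of m] e by simp
        then show ?thesis using True c[of m] by (simp add: q_def field_simps)
      next
        case False
        have "norm x \<le> norm (x + c m *\<^sub>R e) + norm (c m *\<^sub>R e)"
          using norm_triangle_ineq4[of "x + c m *\<^sub>R e" "c m *\<^sub>R e"] by simp
        then have "norm (x + c m *\<^sub>R e) > K" using False e c[of m] by simp
        then show ?thesis using False K(2)[of x] K(2)[of "x + c m *\<^sub>R e"] L by (simp add: q_def)
      qed
    qed
  qed auto
  moreover have "(\<integral>x. q m x \<partial>lborel) = 0" for m
  proof -
    have eq: "lborel = distr lborel borel ((+) (c m *\<^sub>R e))" by (simp add: lborel_distr_plus)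
    have "(\<integral>x. f (x + c m *\<^sub>R e) \<partial>lborel) = (\<integral>x. f x \<partial>lborel)"
      by (subst (2) eq) (simp add: integral_distr add.commute)
    moreover have "integrable lborel (\<lambda>x. f (x + c m *\<^sub>R e))"
      using fi by (subst (asm) eq) (simp add: integrable_distr_eq add.commute)
    ultimately show ?thesis using fi by (simp add: q_def)
  qed
  ultimately have "(\<integral>x. partial_deriv i f x \<partial>lborel) = 0" by (simp add: LIMSEQ_const_iff)
  then show ?thesis by (simp add: integral_completion)
qed

section \<open>Sobolev and Hardy inequalities for test functions\<close>

definition line_integral :: "'a::euclidean_space \<Rightarrow> ('a \<Rightarrow> ennreal) \<Rightarrow> 'a \<Rightarrow> ennreal" where
  "line_integral b g x = (\<integral>\<^sup>+t. g (x + t *\<^sub>R b) \<partial>lborel)"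

lemma measurable_line_integral [measurable]:
  assumes [measurable]: "g \<in> borel_measurable borel"
  shows "line_integral b g \<in> borel_measurable borel"
  unfolding line_integral_def[abs_def] by measurable

lemma line_integral_mono: "(\<And>x. f x \<le> g x) \<Longrightarrow> line_integral b f x \<le> line_integral b g x"
  unfolding line_integral_def by (intro nn_integral_mono)

lemma line_integral_shift:
  assumes [measurable]: "g \<in> borel_measurable borel"
  shows "line_integral b g (x + s *\<^sub>R b) = line_integral b g x"
proof -
  have "line_integral b g x = (\<integral>\<^sup>+t. g (x + (s + t) *\<^sub>R b) \<partial>lborel)"
    unfolding line_integral_def
    by (subst lborel_distr_plus[of s, symmetric]) (simp add: nn_integral_distr)
  then show ?thesis by (simp add: line_integral_def algebra_simps)
qed

lemma line_integral_shift':
  assumes "\<And>x s. g (x + s *\<^sub>R c) = g x"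
  shows "line_integral b g (x + s *\<^sub>R c) = line_integral b g x"
proof -
  have "g (x + s *\<^sub>R c + t *\<^sub>R b) = g (x + t *\<^sub>R b)" for t
    using assms[of "x + t *\<^sub>R b" s] by (simp add: algebra_simps)
  then show ?thesis by (simp add: line_integral_def)
qed

lemma measurable_foldr_line_integral [measurable]:
  "g \<in> borel_measurable borel \<Longrightarrow> foldr line_integral bs g \<in> borel_measurable borel"
  by (induction bs) auto

lemma foldr_line_integral_shift:
  "(\<And>x s. g (x + s *\<^sub>R c) = g x) \<Longrightarrow> foldr line_integral bs g (x + s *\<^sub>R c) = foldr line_integral bs g x"
  by (induction bs arbitrary: x s) (auto intro: line_integral_shift')

text \<open>Connects the recursive form, in which one direction is integrated out at a time, with a
  product measure; along all of \<open>Basis\<close> and from the base point 0 that product becomes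
  Lebesgue measure.\<close>

lemma foldr_line_integral_eq_PiM:
  fixes g :: "'a::euclidean_space \<Rightarrow> ennreal"
  assumes [measurable]: "g \<in> borel_measurable borel" and "distinct bs"
  shows "foldr line_integral bs g x =
    (\<integral>\<^sup>+f. g (x + (\<Sum>b\<in>set bs. f b *\<^sub>R b)) \<partial>(\<Pi>\<^sub>M b\<in>set bs. lborel))"
  using assms(2)
proof (induction bs arbitrary: x)
  case Nil
  interpret product_sigma_finite "\<lambda>_::'a. lborel :: real measure" ..
  show ?case by (simp add: PiM_empty nn_integral_count_space_finite)
next
  case (Cons b bs)
  interpret product_sigma_finite "\<lambda>_::'a. lborel :: real measure" ..
  have b: "b \<notin> set bs" using Cons.prems by simp
  have "(\<integral>\<^sup>+f. g (x + (\<Sum>c\<in>set (b # bs). f c *\<^sub>R c)) \<partial>(\<Pi>\<^sub>M c\<in>set (b # bs). lborel)) =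
    (\<integral>\<^sup>+f. g (x + (\<Sum>c\<in>insert b (set bs). f c *\<^sub>R c)) \<partial>(\<Pi>\<^sub>M c\<in>insert b (set bs). lborel))" by simp
  also have "\<dots> = (\<integral>\<^sup>+t. (\<integral>\<^sup>+f. g (x + (\<Sum>c\<in>insert b (set bs). (f(b := t)) c *\<^sub>R c)) \<partial>(\<Pi>\<^sub>M c\<in>set bs. lborel)) \<partial>lborel)"
    by (rule product_nn_integral_insert_rev) (use b in auto)
  also have "\<dots> = (\<integral>\<^sup>+t. (\<integral>\<^sup>+f. g ((x + t *\<^sub>R b) + (\<Sum>c\<in>set bs. f c *\<^sub>R c)) \<partial>(\<Pi>\<^sub>M c\<in>set bs. lborel)) \<partial>lborel)"
  proof (intro nn_integral_cong)
    fix t f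
    have "(\<Sum>c\<in>set bs. (f(b := t)) c *\<^sub>R c) = (\<Sum>c\<in>set bs. f c *\<^sub>R c)"
      using b by (intro sum.cong) auto
    then show "g (x + (\<Sum>c\<in>insert b (set bs). (f(b := t)) c *\<^sub>R c)) = g ((x + t *\<^sub>R b) + (\<Sum>c\<in>set bs. f c *\<^sub>R c))"
      using b by (simp add: add.assoc)
  qed
  also have "\<dots> = foldr line_integral (b # bs) g x"
    using Cons by (simp add: line_integral_def[of b])
  finally show ?case by simp
qed

lemma foldr_line_integral_Basis:
  fixes g :: "'a::euclidean_space \<Rightarrow> ennreal"
  assumes [measurable]: "g \<in> borel_measurable borel" and "distinct bs" "set bs = Basis"
  shows "foldr line_integral bs g 0 = (\<integral>\<^sup>+x. g x \<partial>lborel)"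
  unfolding foldr_line_integral_eq_PiM[OF assms(1,2)] assms(3)
  by (subst (2) lborel_eq) (simp add: nn_integral_distr)

text \<open>The inequality of Loomis and Whitney, integrating out one coordinate at a time: the
  factor that does not depend on that coordinate is constant, and the remaining
  \<open>DIM('a) - 1\<close> factors are handled by Hoelder's inequality.\<close>

lemma Loomis_Whitney_iterated:
  fixes g :: "'a::euclidean_space \<Rightarrow> 'a \<Rightarrow> ennreal"
  assumes [measurable]: "\<And>k. g k \<in> borel_measurable borel"
    and g: "\<And>k x s. k \<in> Basis \<Longrightarrow> g k (x + s *\<^sub>R k) = g k x"
    and dim: "DIM('a) \<ge> 2" and w: "w = 1 / (real DIM('a) - 1)"
    and "set bs \<subseteq> Basis"
  shows "foldr line_integral bs (\<lambda>x. \<Prod>k\<in>Basis. epow (g k x) w) x \<le>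
    (\<Prod>k\<in>Basis. epow (foldr line_integral (filter (\<lambda>c. c \<noteq> k) bs) (g k) x) w)"
  using assms(5)
proof (induction bs arbitrary: x)
  case Nil
  show ?case by simp
next
  case (Cons b bs)
  then have b: "b \<in> Basis" by simp
  have w0: "w > 0" using dim by (simp add: w)
  define h where "h k = foldr line_integral (filter (\<lambda>c. c \<noteq> k) bs) (g k)" for k
  have [measurable]: "h k \<in> borel_measurable borel" for k unfolding h_def by measurable
  have hb: "h b (x + t *\<^sub>R b) = h b x" for t
    unfolding h_def by (rule foldr_line_integral_shift) (rule g[OF b])
  have "foldr line_integral (b # bs) (\<lambda>x. \<Prod>k\<in>Basis. epow (g k x) w) x
      \<le> line_integral b (\<lambda>x. \<Prod>k\<in>Basis. epow (h k x) w) x"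
    using Cons by (auto simp: h_def intro!: line_integral_mono)
  also have "\<dots> = (\<integral>\<^sup>+t. epow (h b x) w * (\<Prod>k\<in>Basis - {b}. epow (h k (x + t *\<^sub>R b)) w) \<partial>lborel)"
    unfolding line_integral_def
    by (intro nn_integral_cong) (simp add: prod.remove[OF finite_Basis b] hb)
  also have "\<dots> = epow (h b x) w * (\<integral>\<^sup>+t. (\<Prod>k\<in>Basis - {b}. epow (h k (x + t *\<^sub>R b)) w) \<partial>lborel)"
    by (rule nn_integral_cmult) measurable
  also have "\<dots> \<le> epow (h b x) w * (\<Prod>k\<in>Basis - {b}. epow (\<integral>\<^sup>+t. h k (x + t *\<^sub>R b) \<partial>lborel) w)"
  proof (intro mult_left_mono Hoelder_nn_integral)
    have "real (card (Basis - {b} :: 'a set)) = real DIM('a) - 1"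
      using b dim by (simp add: card_Diff_singleton of_nat_diff)
    then show "(\<Sum>k\<in>Basis - {b}. w) = 1" using dim by (simp add: w)
  qed (use w0 in auto)
  also have "\<dots> = (\<Prod>k\<in>Basis. epow (foldr line_integral (filter (\<lambda>c. c \<noteq> k) (b # bs)) (g k) x) w)"
    unfolding prod.remove[OF finite_Basis b]
    by (intro arg_cong2[where f="(*)"] prod.cong) (auto simp: h_def line_integral_def)
  finally show ?case .
qed

text \<open>Multiplying the N directional bounds, each to the power 1/(N-1), yields a product whose
  factor number k is constant in direction k: the situation of Loomis and Whitney.\<close>

proposition Gagliardo_Nirenberg_nn_integral:
  fixes f :: "'a::euclidean_space \<Rightarrow> ennreal"
  assumes [measurable]: "\<And>k. F k \<in> borel_measurable borel"
    and f: "\<And>k x. k \<in> Basis \<Longrightarrow> f x \<le> line_integral k (F k) x"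
    and dim: "DIM('a) \<ge> 2" and w: "w = 1 / (real DIM('a) - 1)"
  shows "(\<integral>\<^sup>+x. (\<Prod>k\<in>(Basis :: 'a set). epow (f x) w) \<partial>lborel) \<le> (\<Prod>k\<in>Basis. epow (\<integral>\<^sup>+x. F k x \<partial>lborel) w)"
proof -
  obtain bs :: "'a list" where bs: "distinct bs" "set bs = Basis"
    using finite_distinct_list[OF finite_Basis] by metis
  have w0: "w \<ge> 0" using dim by (simp add: w)
  have "(\<integral>\<^sup>+x. (\<Prod>k\<in>(Basis :: 'a set). epow (f x) w) \<partial>lborel)
      \<le> (\<integral>\<^sup>+x. (\<Prod>k\<in>Basis. epow (line_integral k (F k) x) w) \<partial>lborel)"
    by (intro nn_integral_mono prod_mono_ennreal epow_mono f w0)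
  also have "\<dots> = foldr line_integral bs (\<lambda>x. \<Prod>k\<in>Basis. epow (line_integral k (F k) x) w) 0"
    by (rule foldr_line_integral_Basis[symmetric]) (use bs in auto)
  also have "\<dots> \<le> (\<Prod>k\<in>Basis. epow (foldr line_integral (filter (\<lambda>c. c \<noteq> k) bs) (line_integral k (F k)) 0) w)"
    by (rule Loomis_Whitney_iterated) (use bs dim w in \<open>auto simp: line_integral_shift\<close>)
  also have "\<dots> = (\<Prod>k\<in>Basis. epow (\<integral>\<^sup>+x. F k x \<partial>lborel) w)"
  proof (intro prod.cong refl arg_cong2[where f=epow])
    fix k :: 'a assume k: "k \<in> Basis"
    \<comment> \<open>The innermost line integral restores the direction k that the filter removed,
      so the list is again an enumeration of \<open>Basis\<close>.\<close>
    have "foldr line_integral (filter (\<lambda>c. c \<noteq> k) bs @ [k]) (F k) 0 = (\<integral>\<^sup>+x. F k x \<partial>lborel)"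
      by (rule foldr_line_integral_Basis) (use bs k in auto)
    then show "foldr line_integral (filter (\<lambda>c. c \<noteq> k) bs) (line_integral k (F k)) 0 = (\<integral>\<^sup>+x. F k x \<partial>lborel)"
      by simp
  qed
  finally show ?thesis .
qed

section \<open>Sobolev's inequality for test functions\<close>

lemma DERIV_abs_powr:
  fixes y q :: real
  assumes "q > 1"
  shows "((\<lambda>y. \<bar>y\<bar> powr q) has_real_derivative q * sgn y * \<bar>y\<bar> powr (q - 1)) (at y)"
proof -
  consider "y > 0" | "y < 0" | "y = 0" by linarith
  then show ?thesis
  proof cases
    case 1
    have "((\<lambda>y. y powr q) has_real_derivative q * y powr (q - 1)) (at y)"
      using 1 by (auto intro!: derivative_eq_intros)
    then show ?thesis
      using 1 by (subst DERIV_cong_ev[where g="\<lambda>y. y powr q", OF refl _ refl])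
        (auto intro!: eventually_mono[OF eventually_nhds_in_open[of "{0<..}" y]])
  next
    case 2
    have "((\<lambda>y. (- y) powr q) has_real_derivative - (q * (- y) powr (q - 1))) (at y)"
      using 2 by (auto intro!: derivative_eq_intros)
    then show ?thesis
      using 2 by (subst DERIV_cong_ev[where g="\<lambda>y. (- y) powr q", OF refl _ refl])
        (auto intro!: eventually_mono[OF eventually_nhds_in_open[of "{..<0}" y]])
  next
    \<comment> \<open>Since q > 1, the difference quotient at 0 is bounded by
      \<open>\<bar>h\<bar> powr (q - 1)\<close>, which tends to 0; the chain rule therefore holds
      across zeros of the test function.\<close>
    case 3
    have "((\<lambda>h::real. \<bar>h\<bar> powr (q - 1)) \<longlongrightarrow> 0) (at 0)"
      using assms by (auto intro!: tendsto_eq_intros)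
    then have "((\<lambda>h::real. \<bar>h\<bar> powr q / h) \<longlongrightarrow> 0) (at 0)"
      by (rule Lim_null_comparison[rotated])
        (auto simp: eventually_at_filter powr_diff intro!: always_eventually)
    then show ?thesis using 3 by (simp add: DERIV_def)
  qed
qed

text \<open>Fundamental theorem of calculus for \<open>\<bar>\<phi>\<bar> powr q\<close> on the line
  through x in direction k, started at a point beyond the support.\<close>

lemma test_fun_powr_le_line_integral:
  fixes \<phi> :: "real^'n \<Rightarrow> real"
  assumes \<phi>: "test_fun \<phi>" and q: "q > 1" and k: "k \<in> Basis"
  shows "ennreal (\<bar>\<phi> x\<bar> powr q) \<le>
    line_integral k (\<lambda>x. ennreal (q * \<bar>\<phi> x\<bar> powr (q - 1) * norm (grad \<phi> x))) x"
proof -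
  obtain K where K: "K > 0" "\<And>x. norm x > K \<Longrightarrow> \<phi> x = 0"
    by (rule test_fun_support[OF \<phi>]) blast
  have sm: "smooth \<phi>" by (rule test_fun_smooth[OF \<phi>])
  \<comment> \<open>Large enough that \<open>x - T *\<^sub>R k\<close> has norm above
    \<open>K\<close>, because k is a unit vector.\<close>
  define T where "T = norm x + K + 1"
  define h where "h t = x + t *\<^sub>R k" for t
  define H where "H t = \<bar>\<phi> (h t)\<bar> powr q" for t
  define H' where "H' t = q * sgn (\<phi> (h t)) * \<bar>\<phi> (h t)\<bar> powr (q - 1) * (k \<bullet> grad \<phi> (h t))" for t
  have h_cont: "isCont h t" for t unfolding h_def by (auto intro!: continuous_intros)
  have phi_cont: "isCont \<phi> y" "isCont (grad \<phi>) y" for y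
    using smooth_continuous[OF sm, of UNIV] smooth_grad_continuous[OF sm, of UNIV]
    by (auto simp: continuous_on_eq_continuous_at)
  have phih: "isCont (\<lambda>t. \<phi> (h t)) t" "isCont (\<lambda>t. grad \<phi> (h t)) t" for t
    by (rule isCont_o2[OF h_cont phi_cont(1)] isCont_o2[OF h_cont phi_cont(2)])+
  have D: "(H has_real_derivative H' t) (at t)" for t
  proof -
    have "((\<lambda>t. \<phi> (h t)) has_derivative (\<lambda>s. (s *\<^sub>R k) \<bullet> grad \<phi> (h t))) (at t)"
      unfolding h_def
      by (rule has_derivative_compose[of "\<lambda>t. x + t *\<^sub>R k" "\<lambda>t. t *\<^sub>R k" t UNIV \<phi>, simplified])
         (auto intro!: derivative_eq_intros smooth_has_derivative sm)
    then have "((\<lambda>t. \<phi> (h t)) has_real_derivative (k \<bullet> grad \<phi> (h t))) (at t)"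
      unfolding has_field_derivative_def by (rule has_derivative_eq_rhs) auto
    from DERIV_chain2[OF DERIV_abs_powr[OF q] this] show ?thesis by (simp add: H_def[abs_def] H'_def)
  qed
  have H'_cont: "isCont H' t" for t
  proof -
    have c: "isCont (\<lambda>y::real. sgn y * \<bar>y\<bar> powr (q - 1)) y" for y
    proof (cases "y = 0")
      case True
      have "((\<lambda>h::real. \<bar>h\<bar> powr (q - 1)) \<longlongrightarrow> 0) (at 0)"
        using q by (auto intro!: tendsto_eq_intros)
      then have "((\<lambda>y::real. sgn y * \<bar>y\<bar> powr (q - 1)) \<longlongrightarrow> 0) (at 0)"
        by (rule Lim_null_comparison[rotated]) (auto simp: abs_mult eventually_at_filter abs_sgn_eq)
      then show ?thesis using True by (simp add: isCont_def)
    next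
      case False
      then show ?thesis by (intro continuous_intros isCont_sgn) auto
    qed
    have "isCont (\<lambda>t. sgn (\<phi> (h t)) * \<bar>\<phi> (h t)\<bar> powr (q - 1)) t"
      by (rule isCont_o2[OF phih(1) c])
    then have "isCont (\<lambda>t. q * (sgn (\<phi> (h t)) * \<bar>\<phi> (h t)\<bar> powr (q - 1)) * (k \<bullet> grad \<phi> (h t))) t"
      by (intro isCont_mult[of _ _ "\<lambda>t. k \<bullet> grad \<phi> (h t)"] isCont_mult[of _ "\<lambda>_. q"] continuous_const continuous_inner phih)
    then show ?thesis by (simp add: H'_def[abs_def] mult.assoc)
  qed
  have "norm (h (- T)) > K"
  proof -
    have "T = norm (T *\<^sub>R k)" using k K(1) by (simp add: T_def)
    also have "\<dots> \<le> norm x + norm (h (- T))"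
      using norm_triangle_ineq4[of x "h (- T)"] by (simp add: h_def)
    finally show ?thesis by (simp add: T_def)
  qed
  then have H0: "H (- T) = 0" using K(2) by (simp add: H_def)
  have T: "- T \<le> 0" using K(1) norm_ge_zero[of x] unfolding T_def by linarith
  have int: "(\<integral>t. H' t * indicator {- T..0} t \<partial>lborel) = H 0 - H (- T)"
    by (rule integral_FTC_Icc_real[OF T D]) (rule H'_cont)
  have "integrable lborel (\<lambda>t. indicator {- T..0} t *\<^sub>R H' t)"
    by (intro borel_integrable_compact) (auto intro!: continuous_at_imp_continuous_on H'_cont)
  then have intg: "integrable lborel (\<lambda>t. H' t * indicator {- T..0} t)" by (simp add: mult.commute)
  have "ennreal (\<bar>\<phi> x\<bar> powr q) = ennreal (norm (\<integral>t. H' t * indicator {- T..0} t \<partial>lborel))"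
    unfolding int H0 by (simp add: H_def h_def)
  also have "\<dots> \<le> (\<integral>\<^sup>+t. ennreal (norm (H' t * indicator {- T..0} t)) \<partial>lborel)"
    by (rule integral_norm_bound_ennreal[OF intg])
  also have "\<dots> \<le> (\<integral>\<^sup>+t. ennreal (q * \<bar>\<phi> (h t)\<bar> powr (q - 1) * norm (grad \<phi> (h t))) \<partial>lborel)"
  proof (intro nn_integral_mono ennreal_leI)
    fix t
    have "\<bar>k \<bullet> grad \<phi> (h t)\<bar> \<le> norm (grad \<phi> (h t))"
      using Cauchy_Schwarz_ineq2[of k "grad \<phi> (h t)"] k by simp
    then have "q * \<bar>sgn (\<phi> (h t))\<bar> * \<bar>\<phi> (h t)\<bar> powr (q - 1) * \<bar>k \<bullet> grad \<phi> (h t)\<bar>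
        \<le> q * 1 * \<bar>\<phi> (h t)\<bar> powr (q - 1) * norm (grad \<phi> (h t))"
      using q by (intro mult_mono) (auto simp: abs_sgn_eq)
    then show "norm (H' t * indicator {- T..0} t) \<le> q * \<bar>\<phi> (h t)\<bar> powr (q - 1) * norm (grad \<phi> (h t))"
      using q by (auto simp: H'_def abs_mult indicator_def)
  qed
  finally show ?thesis by (simp add: line_integral_def h_def)
qed

lemma test_fun_powr_integrable:
  assumes \<phi>: "test_fun \<phi>" and q: "q > 0"
  shows "integrable lebesgue (\<lambda>x. \<bar>\<phi> x\<bar> powr q)"
proof -
  obtain K where K: "K > 0" "\<And>x. norm x > K \<Longrightarrow> \<phi> x = 0"
    by (rule test_fun_support[OF \<phi>]) blast
  show ?thesis
  proof (rule integrable_compact_support)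
    show "continuous_on UNIV (\<lambda>x. \<bar>\<phi> x\<bar> powr q)"
      using q by (auto intro!: continuous_intros smooth_continuous[OF test_fun_smooth[OF \<phi>]] continuous_on_powr')
    show "norm x > K \<Longrightarrow> \<bar>\<phi> x\<bar> powr q = 0" for x using K(2)[of x] by simp
  qed
qed

lemma test_fun_grad_sq_integrable:
  assumes \<phi>: "test_fun \<phi>"
  shows "integrable lebesgue (\<lambda>x. (norm (grad \<phi> x))\<^sup>2)"
proof -
  obtain K where K: "K > 0" "\<And>x. norm x > K \<Longrightarrow> grad \<phi> x = 0"
    by (rule test_fun_support[OF \<phi>]) blast
  show ?thesis
  proof (rule integrable_compact_support)
    show "continuous_on UNIV (\<lambda>x. (norm (grad \<phi> x))\<^sup>2)"
      by (intro continuous_intros smooth_grad_continuous[OF test_fun_smooth[OF \<phi>]])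
    show "norm x > K \<Longrightarrow> (norm (grad \<phi> x))\<^sup>2 = 0" for x using K(2)[of x] by simp
  qed
qed

text \<open>This is the exponent \<gamma> to which a test function is raised before
  Gagliardo-Nirenberg is applied. Differentiating the power produces the factor \<gamma>, which
  thereby becomes the constant, not the sharp one, in the inequality.\<close>

definition sobolev_const :: "nat \<Rightarrow> real" where
  "sobolev_const N = 2 * (real N - 1) / (real N - 2)"

text \<open>Gagliardo-Nirenberg for \<open>\<bar>\<phi>\<bar> powr \<gamma>\<close> followed by
  Cauchy-Schwarz bounds the integral \<open>a\<close> by a power of
  \<open>\<gamma> * sqrt a * sqrt d\<close>. Compact support makes \<open>a\<close> finite, so its
  power can be absorbed on the left.\<close>

proposition Sobolev_test_fun:
  fixes \<phi> :: "real^'n \<Rightarrow> real"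
  assumes \<phi>: "test_fun \<phi>" and N: "CARD('n) \<ge> 3"
  shows "epow (\<integral>\<^sup>+x. ennreal (\<bar>\<phi> x\<bar> powr sobolev_exp CARD('n)) \<partial>lebesgue) (2 / sobolev_exp CARD('n))
    \<le> ennreal ((sobolev_const CARD('n))\<^sup>2) * (\<integral>\<^sup>+x. ennreal ((norm (grad \<phi> x))\<^sup>2) \<partial>lebesgue)"
proof -
  define N where "N = real CARD('n)"
  have N3: "N \<ge> 3" using N by (simp add: N_def)
  define p where "p = sobolev_exp CARD('n)"
  define \<gamma> where "\<gamma> = sobolev_const CARD('n)"
  have p_eq: "p = 2 * N / (N - 2)" by (simp add: p_def sobolev_exp_def N_def)
  have \<gamma>_eq: "\<gamma> = 2 * (N - 1) / (N - 2)" by (simp add: \<gamma>_def sobolev_const_def N_def)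
  have \<gamma>1: "\<gamma> > 1" and p0: "p > 0" using N3 by (simp_all add: \<gamma>_eq p_eq field_simps)
  \<comment> \<open>These identities determine \<gamma>: by the first, the left side of
    Gagliardo-Nirenberg is the integral of \<open>\<bar>\<phi>\<bar> powr p\<close>; by the second,
    Cauchy-Schwarz reproduces that same integral on the right.\<close>
  have \<gamma>p: "\<gamma> * (N / (N - 1)) = p" "(\<gamma> - 1) * 2 = p"
  proof -
    have "N - 1 \<noteq> 0" "N - 2 \<noteq> 0" using N3 by auto
    then show "\<gamma> * (N / (N - 1)) = p" unfolding \<gamma>_eq p_eq by (simp add: frac_eq_eq)
    from \<open>N - 2 \<noteq> 0\<close> show "(\<gamma> - 1) * 2 = p" unfolding \<gamma>_eq p_eq by (simp add: field_simps)
  qed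
  have sm: "smooth \<phi>" by (rule test_fun_smooth[OF \<phi>])
  have [measurable]: "\<phi> \<in> borel_measurable borel" "grad \<phi> \<in> borel_measurable borel"
    using sm by auto
  define a where "a = (\<integral>x. \<bar>\<phi> x\<bar> powr p \<partial>lebesgue)"
  define d where "d = (\<integral>x. (norm (grad \<phi> x))\<^sup>2 \<partial>lebesgue)"
  have a: "(\<integral>\<^sup>+x. ennreal (\<bar>\<phi> x\<bar> powr p) \<partial>lebesgue) = ennreal a"
    unfolding a_def by (rule nn_integral_eq_integral[OF test_fun_powr_integrable[OF \<phi> p0]]) auto
  have d: "(\<integral>\<^sup>+x. ennreal ((norm (grad \<phi> x))\<^sup>2) \<partial>lebesgue) = ennreal d"
    unfolding d_def by (rule nn_integral_eq_integral[OF test_fun_grad_sq_integrable[OF \<phi>]]) auto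
  have ad0: "a \<ge> 0" "d \<ge> 0" by (simp_all add: a_def d_def)
  define F where "F x = ennreal (\<gamma> * \<bar>\<phi> x\<bar> powr (\<gamma> - 1) * norm (grad \<phi> x))" for x
  have [measurable]: "F \<in> borel_measurable borel" unfolding F_def[abs_def] by measurable
  have "ennreal a = (\<integral>\<^sup>+x. (\<Prod>k\<in>(Basis :: (real^'n) set). epow (ennreal (\<bar>\<phi> x\<bar> powr \<gamma>)) (1 / (N - 1))) \<partial>lborel)"
  proof -
    have "(\<Prod>k\<in>(Basis :: (real^'n) set). epow (ennreal (\<bar>\<phi> x\<bar> powr \<gamma>)) (1 / (N - 1))) = ennreal (\<bar>\<phi> x\<bar> powr p)" for x
    proof -
      have "((\<bar>\<phi> x\<bar> powr \<gamma>) powr (1 / (N - 1))) ^ CARD('n) = \<bar>\<phi> x\<bar> powr (\<gamma> * (1 / (N - 1)) * N)"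
        unfolding powr_powr N_def[symmetric]
        by (cases "\<phi> x = 0") (simp_all add: powr_realpow[symmetric] powr_powr N_def)
      also have "\<gamma> * (1 / (N - 1)) * N = p" using \<gamma>p(1) by (simp add: field_simps)
      finally show ?thesis by (simp add: ennreal_power)
    qed
    then show ?thesis unfolding a[symmetric] by (simp add: nn_integral_completion)
  qed
  also have "\<dots> \<le> (\<Prod>k\<in>(Basis :: (real^'n) set). epow (\<integral>\<^sup>+x. F x \<partial>lborel) (1 / (N - 1)))"
    by (rule Gagliardo_Nirenberg_nn_integral)
       (use test_fun_powr_le_line_integral[OF \<phi> \<gamma>1] N in \<open>auto simp: F_def[abs_def] N_def\<close>)
  finally have GN: "ennreal a \<le> epow (\<integral>\<^sup>+x. F x \<partial>lborel) (1 / (N - 1)) ^ CARD('n)" by simp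
  have "(\<integral>\<^sup>+x. F x \<partial>lborel) =
      (\<integral>\<^sup>+x. ennreal \<gamma> * (epow (ennreal (\<bar>\<phi> x\<bar> powr p)) (1/2) * epow (ennreal ((norm (grad \<phi> x))\<^sup>2)) (1/2)) \<partial>lborel)"
  proof (intro nn_integral_cong)
    fix x
    have "(\<bar>\<phi> x\<bar> powr p) powr (1/2) = \<bar>\<phi> x\<bar> powr (\<gamma> - 1)"
      unfolding powr_powr by (rule arg_cong[where f="\<lambda>t. \<bar>\<phi> x\<bar> powr t"]) (use \<gamma>p(2) in simp)
    moreover have "((norm (grad \<phi> x))\<^sup>2) powr (1/2) = norm (grad \<phi> x)"
      by (simp add: powr_half_sqrt)
    ultimately show "F x = ennreal \<gamma> * (epow (ennreal (\<bar>\<phi> x\<bar> powr p)) (1/2) * epow (ennreal ((norm (grad \<phi> x))\<^sup>2)) (1/2))"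
      using \<gamma>1 by (simp add: F_def ennreal_mult mult.assoc)
  qed
  also have "\<dots> = ennreal \<gamma> * (\<integral>\<^sup>+x. (epow (ennreal (\<bar>\<phi> x\<bar> powr p)) (1/2) * epow (ennreal ((norm (grad \<phi> x))\<^sup>2)) (1/2)) \<partial>lborel)"
    by (rule nn_integral_cmult) measurable
  also have "\<dots> \<le> ennreal \<gamma> * (epow (\<integral>\<^sup>+x. ennreal (\<bar>\<phi> x\<bar> powr p) \<partial>lborel) (1/2) * epow (\<integral>\<^sup>+x. ennreal ((norm (grad \<phi> x))\<^sup>2) \<partial>lborel) (1/2))"
    by (intro mult_left_mono Hoelder_nn_integral2) auto
  also have "\<dots> = ennreal (\<gamma> * sqrt a * sqrt d)"
    using a d ad0 \<gamma>1 by (simp add: nn_integral_completion powr_half_sqrt ennreal_mult mult.assoc)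
  finally have F: "(\<integral>\<^sup>+x. F x \<partial>lborel) \<le> ennreal (\<gamma> * sqrt a * sqrt d)" .
  have "ennreal a \<le> epow (ennreal (\<gamma> * sqrt a * sqrt d)) (1 / (N - 1)) ^ CARD('n)"
    by (rule order_trans[OF GN]) (use F N3 in \<open>auto intro!: power_mono epow_mono\<close>)
  then have *: "a \<le> ((\<gamma> * sqrt a * sqrt d) powr (1 / (N - 1))) ^ CARD('n)"
    using ad0 \<gamma>1 by (simp add: ennreal_power)
  have "a powr (2 / p) \<le> \<gamma>\<^sup>2 * d"
  proof (cases "a = 0")
    case True
    then show ?thesis using ad0 by simp
  next
    case False
    with ad0 have a_pos: "a > 0" by simp
    have d_pos: "d > 0"
    proof (rule ccontr)
      assume "\<not> d > 0"
      with ad0 have "d = 0" by simp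
      with * a_pos show False by (simp add: power_0_left)
    qed
    have "a \<le> (\<gamma> * sqrt a * sqrt d) powr (N / (N - 1))"
    proof -
      have "((\<gamma> * sqrt a * sqrt d) powr (1 / (N - 1))) ^ CARD('n) = ((\<gamma> * sqrt a * sqrt d) powr (1 / (N - 1))) powr N"
        using a_pos d_pos \<gamma>1 by (simp add: powr_realpow N_def)
      with * show ?thesis by (simp add: powr_powr)
    qed
    \<comment> \<open>Logarithms make the absorption linear: the remaining coefficient of
      \<open>ln a\<close> is (N-2)/(2(N-1)), and multiplying by 2(N-1)/N turns it into 2/p.\<close>
    then have "ln a \<le> (N / (N - 1)) * (ln \<gamma> + ln a / 2 + ln d / 2)"
      using a_pos d_pos \<gamma>1
      by (simp add: ln_le_cancel_iff[symmetric, of a] ln_powr ln_mult ln_sqrt del: ln_le_cancel_iff)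
    then have "(2 / p) * ln a \<le> 2 * ln \<gamma> + ln d"
      using N3 by (simp add: p_eq field_simps)
    then have "ln (a powr (2 / p)) \<le> ln (\<gamma>\<^sup>2 * d)"
      using a_pos d_pos \<gamma>1 by (simp add: ln_powr ln_mult ln_realpow)
    then show ?thesis using a_pos d_pos \<gamma>1 by (subst (asm) ln_le_cancel_iff) auto
  qed
  then have "ennreal (a powr (2 / p)) \<le> ennreal (\<gamma>\<^sup>2) * ennreal d"
    using ad0 by (simp add: ennreal_mult[symmetric] ennreal_leI)
  then show ?thesis unfolding p_def[symmetric] \<gamma>_def[symmetric] a d using ad0 by simp
qed


text \<open>The divergence of \<phi> squared times the field x/(\<bar>x\<bar>^2 + \<epsilon>)
  integrates to 0. Expanding it and completing a square with c = (N-2)/2 gives the inequality for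
  the regularised weight, already with the sharp constant c^2; Fatou's lemma then removes
  \<epsilon>.\<close>

proposition Hardy_test_fun:
  fixes \<phi> :: "real^'n \<Rightarrow> real"
  assumes \<phi>: "test_fun \<phi>" and N: "CARD('n) \<ge> 3"
  shows "ennreal (hardy_const CARD('n)) * (\<integral>\<^sup>+x. ennreal ((\<phi> x)\<^sup>2 / (norm x)\<^sup>2) \<partial>lebesgue)
    \<le> (\<integral>\<^sup>+x. ennreal ((norm (grad \<phi> x))\<^sup>2) \<partial>lebesgue)"
proof -
  define c where "c = (real CARD('n) - 2) / 2"
  have c: "c > 0" "hardy_const CARD('n) = c\<^sup>2" "real CARD('n) = 2 * c + 2"
    using N by (simp_all add: c_def hardy_const_def power_divide field_simps)
  have sm: "smooth \<phi>" by (rule test_fun_smooth[OF \<phi>])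
  have [measurable]: "\<phi> \<in> borel_measurable borel" "grad \<phi> \<in> borel_measurable borel"
    using sm by auto
  obtain K where K: "K > 0" "\<And>x. norm x > K \<Longrightarrow> \<phi> x = 0"
    by (rule test_fun_support[OF \<phi>]) blast
  define d where "d = (\<integral>x. (norm (grad \<phi> x))\<^sup>2 \<partial>lebesgue)"
  note di = test_fun_grad_sq_integrable[OF \<phi>]
  have d: "(\<integral>\<^sup>+x. ennreal ((norm (grad \<phi> x))\<^sup>2) \<partial>lebesgue) = ennreal d"
    unfolding d_def by (rule nn_integral_eq_integral[OF di]) auto
  have eps: "c\<^sup>2 * (\<integral>x. (\<phi> x)\<^sup>2 / ((norm x)\<^sup>2 + \<epsilon>) \<partial>lebesgue) \<le> d"
       "integrable lebesgue (\<lambda>x. (\<phi> x)\<^sup>2 / ((norm x)\<^sup>2 + \<epsilon>))" if \<epsilon>: "\<epsilon> > 0" for \<epsilon>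
  proof -
    define s where "s x = (norm x)\<^sup>2 + \<epsilon>" for x :: "real^'n"
    have s: "s x > 0" for x unfolding s_def using \<epsilon> by (simp add: add_nonneg_pos)
    have s_sm: "smooth s" unfolding s_def[abs_def] by (intro smooth_add smooth_norm_sq smooth_const)
    have s_inv: "smooth (\<lambda>x. inverse (s x))"
      using smooth_powr[OF s_sm s, of "-1"] s by (simp add: powr_minus less_imp_le)
    define G where "G i x = (\<phi> x)\<^sup>2 * ((x \<bullet> axis i 1) * inverse (s x))" for i :: 'n and x
    have Gt: "test_fun (G i)" for i
      unfolding G_def[abs_def]
      by (rule test_funI[OF _ \<phi>]) (auto intro!: smooth_mult smooth_power sm smooth_inner s_inv)
    have sD: "(s has_derivative (\<lambda>h. 2 * (x \<bullet> h))) (at x)" for x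
      unfolding s_def power2_norm_eq_inner
      by (auto intro!: derivative_eq_intros simp: inner_commute)
    have G': "partial_deriv i (G i) x = 2 * \<phi> x * partial_deriv i \<phi> x * (x $ i / s x)
        + (\<phi> x)\<^sup>2 * (1 / s x - 2 * (x $ i)\<^sup>2 / (s x)\<^sup>2)" for i x
    proof -
      have D: "(G i has_derivative (\<lambda>h. (\<phi> x)\<^sup>2 * ((x \<bullet> axis i 1) * (- (inverse (s x) * (2 * (x \<bullet> h)) * inverse (s x))) + (h \<bullet> axis i 1) * inverse (s x))
           + (2 * (h \<bullet> grad \<phi> x) * \<phi> x) * ((x \<bullet> axis i 1) * inverse (s x)))) (at x)"
        unfolding G_def[abs_def]
        using s[of x]
        by (auto intro!: derivative_eq_intros smooth_has_derivative[OF sm] sD)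
      show ?thesis unfolding partial_deriv_eq[OF D] using s[of x]
        by (simp add: inner_axis inner_axis' field_simps power2_eq_square)
    qed
    define A where "A x = (\<Sum>i\<in>UNIV. partial_deriv i (G i) x)" for x
    have Ai: "integrable lebesgue (partial_deriv i (G i))" for i
    proof -
      note t = test_fun_partial_deriv[OF Gt[of i], of i]
      obtain K' where "K' > 0" "\<And>x. norm x > K' \<Longrightarrow> partial_deriv i (G i) x = 0"
        by (rule test_fun_support[OF t]) blast
      then show ?thesis
        by (intro integrable_compact_support smooth_continuous test_fun_smooth t)
    qed
    have A0: "(\<integral>x. A x \<partial>lebesgue) = 0" "integrable lebesgue A"
      unfolding A_def[abs_def] using Ai
      by (auto simp: Bochner_Integration.integral_sum integral_partial_deriv_eq_0[OF Gt])
    have A: "A x = 2 * \<phi> x * ((x \<bullet> grad \<phi> x) / s x) + (\<phi> x)\<^sup>2 * ((2 * c + 2) / s x - 2 * (norm x)\<^sup>2 / (s x)\<^sup>2)" for x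
    proof -
      have "A x = 2 * \<phi> x * ((\<Sum>i\<in>UNIV. x $ i * partial_deriv i \<phi> x) / s x)
          + (\<phi> x)\<^sup>2 * (real CARD('n) / s x - 2 * (\<Sum>i\<in>UNIV. (x $ i)\<^sup>2) / (s x)\<^sup>2)"
        unfolding A_def G'
        by (simp add: sum.distrib sum_subtractf sum_distrib_left sum_divide_distrib algebra_simps)
      also have "(\<Sum>i\<in>UNIV. (x $ i)\<^sup>2) = (norm x)\<^sup>2"
        unfolding power2_norm_eq_inner inner_vec_def by (simp add: power2_eq_square)
      also have "(\<Sum>i\<in>UNIV. x $ i * partial_deriv i \<phi> x) = x \<bullet> grad \<phi> x"
        by (simp add: inner_vec_def)
      finally show ?thesis by (simp add: c(3))
    qed
    \<comment> \<open>Completing the square bounds the cross term below by minus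
      \<open>c * r\<close> minus the gradient term. What remains is (2c+2)P - (c+2)r, and r \<le> P
      makes this at least cP; here 2c + 2 = N is the divergence of the identity field.\<close>
    have le: "c * ((\<phi> x)\<^sup>2 / s x) \<le> A x + (norm (grad \<phi> x))\<^sup>2 / c" for x
    proof -
      have nx: "(norm x)\<^sup>2 \<le> s x" using \<epsilon> by (simp add: s_def)
      have i: "\<bar>x \<bullet> grad \<phi> x\<bar> \<le> norm x * norm (grad \<phi> x)" by (rule Cauchy_Schwarz_ineq2)
      have "0 \<le> (c * \<bar>\<phi> x\<bar> * norm x / s x - norm (grad \<phi> x))\<^sup>2" by simp
      also have "\<dots> = c\<^sup>2 * (\<phi> x)\<^sup>2 * ((norm x)\<^sup>2 / (s x)\<^sup>2) - 2 * c * \<bar>\<phi> x\<bar> * (norm x * norm (grad \<phi> x)) / s x + (norm (grad \<phi> x))\<^sup>2"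
        by (simp add: power2_diff power_mult_distrib power_divide algebra_simps)
      finally have 1: "2 * c * \<bar>\<phi> x\<bar> * (norm x * norm (grad \<phi> x)) / s x \<le> c\<^sup>2 * (\<phi> x)\<^sup>2 * ((norm x)\<^sup>2 / (s x)\<^sup>2) + (norm (grad \<phi> x))\<^sup>2" by simp
      have "\<bar>2 * \<phi> x * ((x \<bullet> grad \<phi> x) / s x)\<bar> = 2 * \<bar>\<phi> x\<bar> * \<bar>x \<bullet> grad \<phi> x\<bar> / s x"
        using s[of x] by (simp add: abs_mult)
      also have "\<dots> \<le> 2 * \<bar>\<phi> x\<bar> * (norm x * norm (grad \<phi> x)) / s x"
        using s[of x] i by (intro divide_right_mono mult_left_mono) auto
      also have "\<dots> = (2 * c * \<bar>\<phi> x\<bar> * (norm x * norm (grad \<phi> x)) / s x) / c" using c by simp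
      also have "\<dots> \<le> (c\<^sup>2 * (\<phi> x)\<^sup>2 * ((norm x)\<^sup>2 / (s x)\<^sup>2) + (norm (grad \<phi> x))\<^sup>2) / c"
        using 1 c by (intro divide_right_mono) auto
      also have "\<dots> = c * (\<phi> x)\<^sup>2 * ((norm x)\<^sup>2 / (s x)\<^sup>2) + (norm (grad \<phi> x))\<^sup>2 / c"
        using c by (simp add: field_simps power2_eq_square)
      finally have 2: "- (2 * \<phi> x * ((x \<bullet> grad \<phi> x) / s x)) \<le> c * (\<phi> x)\<^sup>2 * ((norm x)\<^sup>2 / (s x)\<^sup>2) + (norm (grad \<phi> x))\<^sup>2 / c"
        by linarith
      have 3: "(norm x)\<^sup>2 / (s x)\<^sup>2 \<le> 1 / s x"
        using nx s[of x] by (simp add: field_simps power2_eq_square)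
      define P where "P = (\<phi> x)\<^sup>2 / s x"
      define r where "r = (\<phi> x)\<^sup>2 * ((norm x)\<^sup>2 / (s x)\<^sup>2)"
      define t where "t = 2 * \<phi> x * ((x \<bullet> grad \<phi> x) / s x)"
      have "A x = t + (2 * c + 2) * P - 2 * r"
        unfolding A P_def r_def t_def by (simp add: algebra_simps)
      moreover have "r \<le> P" unfolding P_def r_def using mult_left_mono[OF 3, of "(\<phi> x)\<^sup>2"] by simp
      then have "(c + 2) * r \<le> (c + 2) * P" using c by (intro mult_left_mono) auto
      moreover have "- t \<le> c * r + (norm (grad \<phi> x))\<^sup>2 / c" using 2 unfolding t_def r_def by (simp only: mult.assoc)
      ultimately show ?thesis unfolding P_def[symmetric] by (simp add: algebra_simps)
    qed
    show int: "integrable lebesgue (\<lambda>x. (\<phi> x)\<^sup>2 / ((norm x)\<^sup>2 + \<epsilon>))"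
    proof (rule integrable_compact_support)
      show "continuous_on UNIV (\<lambda>x. (\<phi> x)\<^sup>2 / ((norm x)\<^sup>2 + \<epsilon>))"
        using s by (intro continuous_intros smooth_continuous[OF sm]) (auto simp: s_def less_imp_neq[THEN not_sym])
      show "norm x > K \<Longrightarrow> (\<phi> x)\<^sup>2 / ((norm x)\<^sup>2 + \<epsilon>) = 0" for x using K(2)[of x] by simp
    qed
    have "(\<integral>x. c * ((\<phi> x)\<^sup>2 / s x) \<partial>lebesgue) \<le> (\<integral>x. A x + (norm (grad \<phi> x))\<^sup>2 / c \<partial>lebesgue)"
      using int di A0(2) le
      by (intro integral_mono integrable_mult_right Bochner_Integration.integrable_add integrable_divide)
         (auto simp: s_def)
    also have "\<dots> = d / c" using A0 di by (simp add: d_def)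
    finally have "c * (\<integral>x. (\<phi> x)\<^sup>2 / s x \<partial>lebesgue) \<le> d / c" by (simp only: integral_mult_right_zero)
    then show "c\<^sup>2 * (\<integral>x. (\<phi> x)\<^sup>2 / ((norm x)\<^sup>2 + \<epsilon>) \<partial>lebesgue) \<le> d"
      using c(1) by (simp add: field_simps power2_eq_square s_def)
  qed
  define \<epsilon> where "\<epsilon> m = 1 / real (Suc m)" for m
  have \<epsilon>: "\<epsilon> m > 0" "\<epsilon> (Suc m) \<le> \<epsilon> m" for m by (simp_all add: \<epsilon>_def frac_le)
  have \<epsilon>0: "\<epsilon> \<longlonglongrightarrow> 0" unfolding \<epsilon>_def using LIMSEQ_inverse_real_of_nat by (simp add: inverse_eq_divide)
  have lim: "(\<lambda>m. ennreal ((\<phi> x)\<^sup>2 / ((norm x)\<^sup>2 + \<epsilon> m))) \<longlonglongrightarrow> ennreal ((\<phi> x)\<^sup>2 / (norm x)\<^sup>2)" if "x \<noteq> 0" for x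
    using that \<epsilon>0 by (intro tendsto_ennrealI tendsto_divide tendsto_const) (auto intro: tendsto_eq_intros)
  have AE0: "AE x in lebesgue. x \<noteq> (0::real^'n)"
    by (rule AE_I'[of "{0}"]) (auto simp: null_sets_def)
  have "(\<integral>\<^sup>+x. ennreal ((\<phi> x)\<^sup>2 / (norm x)\<^sup>2) \<partial>lebesgue) =
      (\<integral>\<^sup>+x. liminf (\<lambda>m. ennreal ((\<phi> x)\<^sup>2 / ((norm x)\<^sup>2 + \<epsilon> m))) \<partial>lebesgue)"
    by (rule nn_integral_cong_AE, rule AE_mp[OF AE0])
       (auto intro!: AE_I2 lim_imp_Liminf[OF sequentially_bot, symmetric] lim)
  also have "\<dots> \<le> liminf (\<lambda>m. \<integral>\<^sup>+x. ennreal ((\<phi> x)\<^sup>2 / ((norm x)\<^sup>2 + \<epsilon> m)) \<partial>lebesgue)"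
    by (intro nn_integral_liminf) (auto intro!: measurable_completion)
  also have "\<dots> \<le> ennreal (d / c\<^sup>2)"
  proof (rule Liminf_le)
    show "\<forall>\<^sub>F m in sequentially. (\<integral>\<^sup>+x. ennreal ((\<phi> x)\<^sup>2 / ((norm x)\<^sup>2 + \<epsilon> m)) \<partial>lebesgue) \<le> ennreal (d / c\<^sup>2)"
    proof (intro always_eventually allI)
      fix m
      have "(\<integral>\<^sup>+x. ennreal ((\<phi> x)\<^sup>2 / ((norm x)\<^sup>2 + \<epsilon> m)) \<partial>lebesgue) =
          ennreal (\<integral>x. (\<phi> x)\<^sup>2 / ((norm x)\<^sup>2 + \<epsilon> m) \<partial>lebesgue)"
        by (rule nn_integral_eq_integral[OF eps(2)[OF \<epsilon>(1)]]) (use \<epsilon>(1)[of m] in auto)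
      also have "\<dots> \<le> ennreal (d / c\<^sup>2)"
        using eps(1)[OF \<epsilon>(1)[of m]] c(1) by (intro ennreal_leI) (simp add: field_simps)
      finally show "(\<integral>\<^sup>+x. ennreal ((\<phi> x)\<^sup>2 / ((norm x)\<^sup>2 + \<epsilon> m)) \<partial>lebesgue) \<le> ennreal (d / c\<^sup>2)" .
    qed
  qed simp
  finally have "ennreal (c\<^sup>2) * (\<integral>\<^sup>+x. ennreal ((\<phi> x)\<^sup>2 / (norm x)\<^sup>2) \<partial>lebesgue) \<le> ennreal (c\<^sup>2) * ennreal (d / c\<^sup>2)"
    by (rule mult_left_mono) simp
  also have "\<dots> = ennreal d" using c(1) by (subst ennreal_mult'[symmetric]) auto
  finally show ?thesis unfolding d c(2) .
qed

section \<open>Lebesgue spaces\<close>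

lemma epow_less_top_iff [simp]: "epow x w < top \<longleftrightarrow> x < top"
  by (simp add: less_top[symmetric])

text \<open>The q-th power of the usual distance. Without the root, the triangle inequality holds
  pointwise up to the factor \<open>2 powr q\<close>, and this suffices for all convergence
  arguments.\<close>

definition Lq_dist :: "real \<Rightarrow> (real^'n \<Rightarrow> 'b::euclidean_space) \<Rightarrow> (real^'n \<Rightarrow> 'b) \<Rightarrow> ennreal" where
  "Lq_dist q f g = (\<integral>\<^sup>+x. ennreal (norm (f x - g x) powr q) \<partial>lebesgue)"

definition in_Lq :: "real \<Rightarrow> (real^'n \<Rightarrow> 'b::euclidean_space) \<Rightarrow> bool" where
  "in_Lq q f \<longleftrightarrow> f \<in> borel_measurable lebesgue \<and> (\<integral>\<^sup>+x. ennreal (norm (f x) powr q) \<partial>lebesgue) < top"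

lemma in_LqD [measurable_dest]: "in_Lq q f \<Longrightarrow> f \<in> borel_measurable lebesgue"
  by (simp add: in_Lq_def)

lemma in_Lq_iff_dist: "in_Lq q f \<longleftrightarrow> f \<in> borel_measurable lebesgue \<and> Lq_dist q f (\<lambda>_. 0) < top"
  by (simp add: in_Lq_def Lq_dist_def)

lemma Lq_dist_triangle:
  assumes [measurable]: "f \<in> borel_measurable lebesgue" "g \<in> borel_measurable lebesgue" "h \<in> borel_measurable lebesgue"
    and q: "q \<ge> 0"
  shows "Lq_dist q f h \<le> ennreal (2 powr q) * (Lq_dist q f g + Lq_dist q g h)"
proof -
  have "norm (f x - h x) powr q \<le> 2 powr q * (norm (f x - g x) powr q + norm (g x - h x) powr q)" for x
  proof -
    have "norm (f x - h x) powr q \<le> (norm (f x - g x) + norm (g x - h x)) powr q"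
      using q norm_triangle_ineq[of "f x - g x" "g x - h x"] by (intro powr_mono2) auto
    also have "\<dots> \<le> 2 powr q * (norm (f x - g x) powr q + norm (g x - h x) powr q)"
      using q by (intro powr_add_le) auto
    finally show ?thesis .
  qed
  then have "Lq_dist q f h \<le> (\<integral>\<^sup>+x. ennreal (2 powr q) * (ennreal (norm (f x - g x) powr q) + ennreal (norm (g x - h x) powr q)) \<partial>lebesgue)"
    unfolding Lq_dist_def
    by (intro nn_integral_mono) (simp add: ennreal_mult[symmetric] ennreal_plus[symmetric] ennreal_leI del: ennreal_plus)
  also have "\<dots> = ennreal (2 powr q) * (Lq_dist q f g + Lq_dist q g h)"
    by (simp add: nn_integral_cmult nn_integral_add Lq_dist_def)
  finally show ?thesis .
qed

lemma Lq_dist_commute: "Lq_dist q f g = Lq_dist q g f"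
  by (simp add: Lq_dist_def norm_minus_commute)

lemma Lq_dist_add_le:
  assumes [measurable]: "f \<in> borel_measurable lebesgue" "g \<in> borel_measurable lebesgue"
     "f' \<in> borel_measurable lebesgue" "g' \<in> borel_measurable lebesgue"
    and q: "q \<ge> 0"
  shows "Lq_dist q (\<lambda>x. f x + g x) (\<lambda>x. f' x + g' x) \<le> ennreal (2 powr q) * (Lq_dist q f f' + Lq_dist q g g')"
proof -
  have "Lq_dist q (\<lambda>x. f x + g x) (\<lambda>x. f' x + g' x) \<le> ennreal (2 powr q) *
     (Lq_dist q (\<lambda>x. f x + g x) (\<lambda>x. f' x + g x) + Lq_dist q (\<lambda>x. f' x + g x) (\<lambda>x. f' x + g' x))"
    by (rule Lq_dist_triangle[OF _ _ _ q]) auto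
  then show ?thesis by (simp add: Lq_dist_def)
qed

lemma tendsto_0_le_ennreal:
  fixes f g :: "nat \<Rightarrow> ennreal"
  assumes "\<And>m. f m \<le> g m" "g \<longlonglongrightarrow> 0"
  shows "f \<longlonglongrightarrow> 0"
  by (rule tendsto_sandwich[OF _ _ tendsto_const assms(2)]) (auto simp: assms(1))

lemma Lq_tendsto_trans:
  assumes "\<And>m. f m \<in> borel_measurable lebesgue" "\<And>m. g m \<in> borel_measurable lebesgue" "h \<in> borel_measurable lebesgue"
    and q: "q \<ge> 0"
    and lim: "(\<lambda>m. Lq_dist q (f m) (g m)) \<longlonglongrightarrow> 0" "(\<lambda>m. Lq_dist q (g m) h) \<longlonglongrightarrow> 0"
  shows "(\<lambda>m. Lq_dist q (f m) h) \<longlonglongrightarrow> 0"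
proof (rule tendsto_0_le_ennreal)
  show "Lq_dist q (f m) h \<le> ennreal (2 powr q) * (Lq_dist q (f m) (g m) + Lq_dist q (g m) h)" for m
    by (rule Lq_dist_triangle) (use assms in auto)
  have "(\<lambda>m. ennreal (2 powr q) * (Lq_dist q (f m) (g m) + Lq_dist q (g m) h)) \<longlonglongrightarrow> ennreal (2 powr q) * (0 + 0)"
    by (intro tendsto_mult_ennreal tendsto_add lim tendsto_const) auto
  then show "(\<lambda>m. ennreal (2 powr q) * (Lq_dist q (f m) (g m) + Lq_dist q (g m) h)) \<longlonglongrightarrow> 0" by simp
qed

lemma Lq_tendsto_add:
  assumes "\<And>m. f m \<in> borel_measurable lebesgue" "\<And>m. g m \<in> borel_measurable lebesgue"
     "f' \<in> borel_measurable lebesgue" "g' \<in> borel_measurable lebesgue"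
    and q: "q \<ge> 0"
    and lim: "(\<lambda>m. Lq_dist q (f m) f') \<longlonglongrightarrow> 0" "(\<lambda>m. Lq_dist q (g m) g') \<longlonglongrightarrow> 0"
  shows "(\<lambda>m. Lq_dist q (\<lambda>x. f m x + g m x) (\<lambda>x. f' x + g' x)) \<longlonglongrightarrow> 0"
proof (rule tendsto_0_le_ennreal)
  show "Lq_dist q (\<lambda>x. f m x + g m x) (\<lambda>x. f' x + g' x) \<le> ennreal (2 powr q) * (Lq_dist q (f m) f' + Lq_dist q (g m) g')" for m
    by (rule Lq_dist_add_le) (use assms in auto)
  have "(\<lambda>m. ennreal (2 powr q) * (Lq_dist q (f m) f' + Lq_dist q (g m) g')) \<longlonglongrightarrow> ennreal (2 powr q) * (0 + 0)"
    by (intro tendsto_mult_ennreal tendsto_add lim tendsto_const) auto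
  then show "(\<lambda>m. ennreal (2 powr q) * (Lq_dist q (f m) f' + Lq_dist q (g m) g')) \<longlonglongrightarrow> 0" by simp
qed

lemma Lq_dist_scale_le:
  assumes "\<And>x. norm (f x - g x) \<le> c * norm (f' x - g' x)" "c \<ge> 0" "q \<ge> 0"
   and [measurable]: "f' \<in> borel_measurable lebesgue" "g' \<in> borel_measurable lebesgue"
  shows "Lq_dist q f g \<le> ennreal (c powr q) * Lq_dist q f' g'"
proof -
  have "Lq_dist q f g \<le> (\<integral>\<^sup>+x. ennreal (c powr q) * ennreal (norm (f' x - g' x) powr q) \<partial>lebesgue)"
    unfolding Lq_dist_def
  proof (intro nn_integral_mono)
    fix x
    have "norm (f x - g x) powr q \<le> (c * norm (f' x - g' x)) powr q"
      using assms by (intro powr_mono2) auto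
    also have "\<dots> = c powr q * norm (f' x - g' x) powr q" using assms by (simp add: powr_mult)
    finally show "ennreal (norm (f x - g x) powr q) \<le> ennreal (c powr q) * ennreal (norm (f' x - g' x) powr q)"
      by (simp add: ennreal_mult[symmetric] ennreal_leI)
  qed
  also have "\<dots> = ennreal (c powr q) * Lq_dist q f' g'" by (simp add: nn_integral_cmult Lq_dist_def)
  finally show ?thesis .
qed

lemma Lq_tendsto_scale:
  assumes "\<And>m x. norm (f m x - g m x) \<le> c * norm (f' m x - g' m x)" "c \<ge> 0" "q \<ge> 0"
   and "\<And>m. f' m \<in> borel_measurable lebesgue" "\<And>m. g' m \<in> borel_measurable lebesgue"
   and lim: "(\<lambda>m. Lq_dist q (f' m) (g' m)) \<longlonglongrightarrow> 0"
  shows "(\<lambda>m. Lq_dist q (f m) (g m)) \<longlonglongrightarrow> 0"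
proof (rule tendsto_0_le_ennreal)
  show "Lq_dist q (f m) (g m) \<le> ennreal (c powr q) * Lq_dist q (f' m) (g' m)" for m
    by (rule Lq_dist_scale_le) (use assms in auto)
  show "(\<lambda>m. ennreal (c powr q) * Lq_dist q (f' m) (g' m)) \<longlonglongrightarrow> 0"
    using tendsto_mult_ennreal[OF tendsto_const[of "ennreal (c powr q)"] lim] by simp
qed

lemma Lq_dominated:
  fixes f :: "nat \<Rightarrow> real^'n \<Rightarrow> 'b::euclidean_space"
  assumes [measurable]: "\<And>m. f m \<in> borel_measurable lebesgue" "g \<in> borel_measurable lebesgue"
    and q: "q > 0"
    and lim: "AE x in lebesgue. (\<lambda>m. f m x) \<longlonglongrightarrow> g x"
    and dom: "\<And>m. AE x in lebesgue. norm (f m x - g x) \<le> norm (w x)" and w: "in_Lq q w"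
  shows "(\<lambda>m. Lq_dist q (f m) g) \<longlonglongrightarrow> 0"
proof -
  have [measurable]: "w \<in> borel_measurable lebesgue" using w by (simp add: in_Lq_def)
  have "(\<lambda>m. \<integral>\<^sup>+x. ennreal (norm (f m x - g x) powr q) \<partial>lebesgue) \<longlonglongrightarrow> (\<integral>\<^sup>+(x::real^'n). 0 \<partial>lebesgue)"
  proof (rule nn_integral_dominated_convergence[where w="\<lambda>x. ennreal (norm (w x) powr q)"])
    show "AE x in lebesgue. ennreal (norm (f m x - g x) powr q) \<le> ennreal (norm (w x) powr q)" for m
      using dom[of m] by eventually_elim (use q in \<open>auto intro!: ennreal_leI powr_mono2\<close>)
    show "AE x in lebesgue. (\<lambda>m. ennreal (norm (f m x - g x) powr q)) \<longlonglongrightarrow> 0"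
      using lim
    proof eventually_elim
      case (elim x)
      have "(\<lambda>m. norm (f m x - g x) powr q) \<longlonglongrightarrow> 0 powr q"
        by (rule tendsto_powr'[OF _ tendsto_const])
           (use elim q in \<open>auto simp: LIM_zero_iff tendsto_norm_zero_iff\<close>)
      then show ?case by (intro tendsto_ennrealI[where x=0, simplified]) auto
    qed
  qed (use w in \<open>auto simp: in_Lq_def\<close>)
  then show ?thesis by (simp add: Lq_dist_def)
qed

lemma Lq_AE_subseq:
  assumes [measurable]: "\<And>m. f m \<in> borel_measurable lebesgue" "g \<in> borel_measurable lebesgue"
    and q: "q > 0" and lim: "(\<lambda>m. Lq_dist q (f m) g) \<longlonglongrightarrow> 0"
  obtains s where "strict_mono s" "AE x in lebesgue. (\<lambda>m. f (s m) x) \<longlonglongrightarrow> g x"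
proof -
  have "\<exists>s. strict_mono s \<and> (AE x in lebesgue. (\<lambda>m. ennreal (norm (f (s m) x - g x) powr q)) \<longlonglongrightarrow> 0)"
    by (rule L1_AE_subseq) (use lim in \<open>auto simp: Lq_dist_def\<close>)
  then obtain s where s: "strict_mono s"
      "AE x in lebesgue. (\<lambda>m. ennreal (norm (f (s m) x - g x) powr q)) \<longlonglongrightarrow> 0" by blast
  have "AE x in lebesgue. (\<lambda>m. f (s m) x) \<longlonglongrightarrow> g x"
    using s(2)
  proof eventually_elim
    case (elim x)
    then have "(\<lambda>m. norm (f (s m) x - g x) powr q) \<longlonglongrightarrow> 0"
      by (subst (asm) ennreal_tendsto_0_iff) auto
    then have "(\<lambda>m. (norm (f (s m) x - g x) powr q) powr (1 / q)) \<longlonglongrightarrow> 0 powr (1 / q)"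
      by (rule tendsto_powr'[OF _ tendsto_const]) (use q in auto)
    then have "(\<lambda>m. norm (f (s m) x - g x)) \<longlonglongrightarrow> 0"
      using q by (simp add: powr_powr)
    then show ?case by (simp add: LIM_zero_iff tendsto_norm_zero_iff)
  qed
  with s(1) show thesis by (rule that)
qed

lemma in_Lq_mono:
  assumes "in_Lq q f" "g \<in> borel_measurable lebesgue" "\<And>x. norm (g x) \<le> c * norm (f x)" "c \<ge> 0" "q \<ge> 0"
  shows "in_Lq q g"
proof -
  have "Lq_dist q g (\<lambda>_. 0) \<le> ennreal (c powr q) * Lq_dist q f (\<lambda>_. 0)"
    by (rule Lq_dist_scale_le) (use assms in \<open>auto simp: in_Lq_def\<close>)
  also have "\<dots> < top" using assms(1) by (simp add: in_Lq_iff_dist ennreal_mult_less_top)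
  finally show ?thesis using assms(2) by (simp add: in_Lq_iff_dist)
qed

lemma in_Lq_limit:
  assumes [measurable]: "\<And>m. in_Lq q (f m)" "g \<in> borel_measurable lebesgue"
    and q: "q \<ge> 0" and lim: "(\<lambda>m. Lq_dist q (f m) g) \<longlonglongrightarrow> 0"
  shows "in_Lq q g"
proof -
  have "\<exists>m. Lq_dist q (f m) g < 1"
    using order_tendstoD(2)[OF lim, of 1] by (auto simp: eventually_sequentially)
  then obtain m where m: "Lq_dist q g (f m) < 1" by (auto simp: Lq_dist_commute)
  have "Lq_dist q g (\<lambda>_. 0) \<le> ennreal (2 powr q) * (Lq_dist q g (f m) + Lq_dist q (f m) (\<lambda>_. 0))"
    by (rule Lq_dist_triangle) (use q assms(1)[of m] in \<open>auto simp: in_Lq_def\<close>)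
  also have "\<dots> < top"
    using order.strict_trans[OF m ennreal_one_less_top] assms(1)[of m]
    by (auto simp: in_Lq_iff_dist ennreal_mult_less_top)
  finally show ?thesis by (simp add: in_Lq_iff_dist)
qed

lemma in_Lq_add:
  assumes "in_Lq q f" "in_Lq q g" "q \<ge> 0"
  shows "in_Lq q (\<lambda>x. f x + g x)"
proof -
  have "Lq_dist q (\<lambda>x. f x + g x) (\<lambda>x. 0 + 0) \<le> ennreal (2 powr q) * (Lq_dist q f (\<lambda>_. 0) + Lq_dist q g (\<lambda>_. 0))"
    by (rule Lq_dist_add_le) (use assms in \<open>auto simp: in_Lq_def\<close>)
  also have "\<dots> < top" using assms by (auto simp: in_Lq_iff_dist ennreal_mult_less_top)
  finally show ?thesis using assms by (auto simp: in_Lq_iff_dist)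
qed

lemma Lq_Hoelder:
  assumes q: "q > 1" "q' > 1" "1 / q + 1 / q' = 1"
    and [measurable]: "f \<in> borel_measurable lebesgue" "g \<in> borel_measurable lebesgue"
  shows "(\<integral>\<^sup>+x. ennreal (norm (f x) * norm (g x)) \<partial>lebesgue) \<le>
    epow (Lq_dist q f (\<lambda>_. 0)) (1 / q) * epow (Lq_dist q' g (\<lambda>_. 0)) (1 / q')"
proof -
  have "(\<integral>\<^sup>+x. ennreal (norm (f x) * norm (g x)) \<partial>lebesgue) =
    (\<integral>\<^sup>+x. epow (ennreal (norm (f x) powr q)) (1 / q) * epow (ennreal (norm (g x) powr q')) (1 / q') \<partial>lebesgue)"
    using q by (intro nn_integral_cong) (simp add: powr_powr ennreal_mult)
  also have "\<dots> \<le> epow (Lq_dist q f (\<lambda>_. 0)) (1 / q) * epow (Lq_dist q' g (\<lambda>_. 0)) (1 / q')"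
    unfolding Lq_dist_def diff_zero using q by (intro Hoelder_nn_integral2) auto
  finally show ?thesis .
qed

lemma Lq_pair_integrable:
  assumes q: "q > 1" "q' > 1" "1 / q + 1 / q' = 1" and f: "in_Lq q f" and g: "in_Lq q' g"
  shows "integrable lebesgue (\<lambda>x. f x \<bullet> g x)" "integrable lebesgue (\<lambda>x. norm (f x) * norm (g x))"
proof -
  have [measurable]: "f \<in> borel_measurable lebesgue" "g \<in> borel_measurable lebesgue"
    using f g by (auto simp: in_Lq_def)
  have "(\<integral>\<^sup>+x. ennreal (norm (f x) * norm (g x)) \<partial>lebesgue) \<le>
    epow (Lq_dist q f (\<lambda>_. 0)) (1 / q) * epow (Lq_dist q' g (\<lambda>_. 0)) (1 / q')"
    by (rule Lq_Hoelder) (use q in auto)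
  also have "\<dots> < top" using f g by (auto simp: in_Lq_iff_dist ennreal_mult_less_top)
  finally have "(\<integral>\<^sup>+x. ennreal (norm (norm (f x) * norm (g x))) \<partial>lebesgue) < \<infinity>" by (simp add: abs_mult)
  then show "integrable lebesgue (\<lambda>x. norm (f x) * norm (g x))"
    unfolding integrable_iff_bounded by auto
  then show "integrable lebesgue (\<lambda>x. f x \<bullet> g x)"
    by (rule Bochner_Integration.integrable_bound) (auto intro!: AE_I2 simp: Cauchy_Schwarz_ineq2)
qed

text \<open>Continuity of the duality pairing in one argument: the means of passing from identities
  for test functions to identities on \<open>D12\<close>.\<close>

lemma Lq_pair_tendsto:
  assumes q: "q > 1" "q' > 1" "1 / q + 1 / q' = 1" and f: "in_Lq q f"
    and g: "\<And>m. in_Lq q' (g m)" "in_Lq q' h" and lim: "(\<lambda>m. Lq_dist q' (g m) h) \<longlonglongrightarrow> 0"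
  shows "(\<lambda>m. \<integral>x. f x \<bullet> g m x \<partial>lebesgue) \<longlonglongrightarrow> (\<integral>x. f x \<bullet> h x \<partial>lebesgue)"
proof -
  have [measurable]: "f \<in> borel_measurable lebesgue" "g m \<in> borel_measurable lebesgue" "h \<in> borel_measurable lebesgue" for m
    using f g by (auto simp: in_Lq_def)
  define c where "c = epow (Lq_dist q f (\<lambda>_. 0)) (1 / q)"
  have c: "c < top" using f by (simp add: c_def in_Lq_iff_dist)
  have int: "integrable lebesgue (\<lambda>x. f x \<bullet> g m x)" "integrable lebesgue (\<lambda>x. f x \<bullet> h x)" for m
    using Lq_pair_integrable(1)[OF q f] g by auto
  have "ennreal (norm ((\<integral>x. f x \<bullet> g m x \<partial>lebesgue) - (\<integral>x. f x \<bullet> h x \<partial>lebesgue))) \<le>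
      c * epow (Lq_dist q' (g m) h) (1 / q')" for m
  proof -
    have "(\<integral>x. f x \<bullet> g m x \<partial>lebesgue) - (\<integral>x. f x \<bullet> h x \<partial>lebesgue) = (\<integral>x. f x \<bullet> (g m x - h x) \<partial>lebesgue)"
      using int by (simp add: inner_diff_right)
    also have "ennreal (norm \<dots>) \<le> (\<integral>\<^sup>+x. ennreal (norm (f x \<bullet> (g m x - h x))) \<partial>lebesgue)"
      using int by (intro integral_norm_bound_ennreal) (simp add: inner_diff_right)
    also have "\<dots> \<le> (\<integral>\<^sup>+x. ennreal (norm (f x) * norm (g m x - h x)) \<partial>lebesgue)"
      by (intro nn_integral_mono ennreal_leI) (simp add: Cauchy_Schwarz_ineq2)
    also have "\<dots> \<le> c * epow (Lq_dist q' (\<lambda>x. g m x - h x) (\<lambda>_. 0)) (1 / q')"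
      unfolding c_def by (rule Lq_Hoelder) (use q in auto)
    finally show ?thesis by (simp add: Lq_dist_def)
  qed
  moreover have "(\<lambda>m. c * epow (Lq_dist q' (g m) h) (1 / q')) \<longlonglongrightarrow> 0"
  proof -
    have "(\<lambda>m. epow (Lq_dist q' (g m) h) (1 / q')) \<longlonglongrightarrow> 0"
    proof (rule order_tendstoI)
      fix a :: ennreal assume a: "0 < a"
      obtain r where r: "r > 0" "ennreal r < a"
      proof (cases a)
        case (real b)
        then show ?thesis using a that[of "b / 2"] by (auto simp: ennreal_less_iff)
      qed (use that[of 1] in auto)
      have "\<forall>\<^sub>F m in sequentially. Lq_dist q' (g m) h < ennreal (r powr q')"
        using order_tendstoD(2)[OF lim, of "ennreal (r powr q')"] r by simp
      then show "\<forall>\<^sub>F m in sequentially. epow (Lq_dist q' (g m) h) (1 / q') < a"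
      proof eventually_elim
        case (elim m)
        have "epow (Lq_dist q' (g m) h) (1 / q') \<le> epow (ennreal (r powr q')) (1 / q')"
          using elim q by (intro epow_mono) auto
        also have "\<dots> = ennreal r" using r q by (simp add: powr_powr)
        finally show ?case using r by simp
      qed
    qed simp
    from tendsto_mult_ennreal[OF tendsto_const[of c] this] c show ?thesis by auto
  qed
  ultimately have "(\<lambda>m. ennreal (norm ((\<integral>x. f x \<bullet> g m x \<partial>lebesgue) - (\<integral>x. f x \<bullet> h x \<partial>lebesgue)))) \<longlonglongrightarrow> 0"
    by (rule tendsto_0_le_ennreal)
  then have "(\<lambda>m. norm ((\<integral>x. f x \<bullet> g m x \<partial>lebesgue) - (\<integral>x. f x \<bullet> h x \<partial>lebesgue))) \<longlonglongrightarrow> 0"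
    by (subst (asm) ennreal_tendsto_0_iff) auto
  then show ?thesis unfolding tendsto_norm_zero_iff by (rule LIM_zero_cancel)
qed

lemma in_Lq_indicator_cball:
  "in_Lq q (\<lambda>x::real^'n. c * indicator (cball 0 K) x :: real)"
proof -
  have m: "(\<lambda>x::real^'n. c * indicator (cball 0 K) x :: real) \<in> borel_measurable lebesgue"
    by (intro measurable_completion borel_measurable_times borel_measurable_indicator) auto
  have "(\<integral>\<^sup>+x. ennreal (norm (c * indicator (cball (0::real^'n) K) x :: real) powr q) \<partial>lebesgue) =
      (\<integral>\<^sup>+x. ennreal (\<bar>c\<bar> powr q) * indicator (cball (0::real^'n) K) x \<partial>lebesgue)"
    by (intro nn_integral_cong) (simp add: indicator_def)
  also have "\<dots> = ennreal (\<bar>c\<bar> powr q) * emeasure lebesgue (cball (0::real^'n) K)"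
    by (rule nn_integral_cmult_indicator) simp
  also have "\<dots> < top"
    using emeasure_lborel_cball_finite[of "0::real^'n" K] by (auto simp: ennreal_mult_less_top)
  finally show ?thesis unfolding in_Lq_def using m by blast
qed

lemma Lq_dist_refl_hyp:
  assumes e: "norm e = 1" and [measurable]: "f \<in> borel_measurable lebesgue" "g \<in> borel_measurable lebesgue"
  shows "Lq_dist q (\<lambda>x. f (refl_hyp e \<mu> x)) (\<lambda>x. g (refl_hyp e \<mu> x)) = Lq_dist q f g"
  unfolding Lq_dist_def
  by (rule nn_integral_refl_hyp[OF e, of "\<lambda>x. ennreal (norm (f x - g x) powr q)"]) auto

section \<open>Functions with a weak gradient\<close>

lemma sobolev_exp_gt_2: "3 \<le> N \<Longrightarrow> sobolev_exp N > 2"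
  by (simp add: sobolev_exp_def field_simps)

lemma has_D12_gradient_iff:
  fixes u :: "real^'n \<Rightarrow> real"
  shows "has_D12_gradient u G \<longleftrightarrow> u \<in> borel_measurable lebesgue \<and> G \<in> borel_measurable lebesgue \<and>
    (\<exists>\<phi>. (\<forall>m. test_fun (\<phi> m)) \<and> (\<lambda>m::nat. Lq_dist 2 (grad (\<phi> m)) G) \<longlonglongrightarrow> 0 \<and>
      (\<lambda>m. Lq_dist (sobolev_exp CARD('n)) (\<phi> m) u) \<longlonglongrightarrow> 0)"
  by (simp add: has_D12_gradient_def Lq_dist_def)

lemma smooth_lebesgue_measurable [measurable]:
  "smooth f \<Longrightarrow> f \<in> borel_measurable lebesgue" "smooth f \<Longrightarrow> grad f \<in> borel_measurable lebesgue"
  by (auto intro!: measurable_completion)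

lemma test_fun_lebesgue_measurable [measurable]:
  "test_fun f \<Longrightarrow> f \<in> borel_measurable lebesgue" "test_fun f \<Longrightarrow> grad f \<in> borel_measurable lebesgue"
  by (auto dest: test_fun_smooth)

lemma in_Lq_test_fun:
  assumes "test_fun \<phi>" shows "q > 0 \<Longrightarrow> in_Lq q \<phi>" "in_Lq 2 (grad \<phi>)"
proof -
  show "in_Lq q \<phi>" if "q > 0"
    using integrableD(2)[OF test_fun_powr_integrable[OF assms that]] assms
    by (auto simp: in_Lq_def less_top)
  show "in_Lq 2 (grad \<phi>)"
    using integrableD(2)[OF test_fun_grad_sq_integrable[OF assms]] assms
    by (auto simp: in_Lq_def less_top)
qed

lemma D12_measurable:
  assumes "has_D12_gradient u G"
  shows "u \<in> borel_measurable lebesgue" "G \<in> borel_measurable lebesgue"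
  using assms by (auto simp: has_D12_gradient_def)

lemma D12_approx:
  fixes u :: "real^'n \<Rightarrow> real"
  assumes "has_D12_gradient u G"
  obtains \<phi> where "\<And>m. test_fun (\<phi> m)" "(\<lambda>m::nat. Lq_dist 2 (grad (\<phi> m)) G) \<longlonglongrightarrow> 0"
      "(\<lambda>m. Lq_dist (sobolev_exp CARD('n)) (\<phi> m) u) \<longlonglongrightarrow> 0"
  using assms unfolding has_D12_gradient_iff by blast

lemma D12_approx_AE:
  fixes u :: "real^'n \<Rightarrow> real"
  assumes D: "has_D12_gradient u G" and N: "3 \<le> CARD('n)"
  obtains \<phi> where "\<And>m. test_fun (\<phi> m)" "(\<lambda>m::nat. Lq_dist 2 (grad (\<phi> m)) G) \<longlonglongrightarrow> 0"
      "(\<lambda>m. Lq_dist (sobolev_exp CARD('n)) (\<phi> m) u) \<longlonglongrightarrow> 0"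
      "AE x in lebesgue. (\<lambda>m. \<phi> m x) \<longlonglongrightarrow> u x"
proof -
  obtain \<phi> where \<phi>: "\<And>m. test_fun (\<phi> m)" "(\<lambda>m::nat. Lq_dist 2 (grad (\<phi> m)) G) \<longlonglongrightarrow> 0"
      "(\<lambda>m. Lq_dist (sobolev_exp CARD('n)) (\<phi> m) u) \<longlonglongrightarrow> 0"
    by (rule D12_approx[OF D]) blast
  obtain s where s: "strict_mono s" "AE x in lebesgue. (\<lambda>m. \<phi> (s m) x) \<longlonglongrightarrow> u x"
    by (rule Lq_AE_subseq[OF _ _ _ \<phi>(3)])
       (use sobolev_exp_gt_2[OF N] \<phi>(1) D in \<open>auto simp: D12_measurable\<close>)
  show thesis
    by (rule that[of "\<lambda>m. \<phi> (s m)"])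
       (use \<phi> s LIMSEQ_subseq_LIMSEQ[OF \<phi>(2) s(1)] LIMSEQ_subseq_LIMSEQ[OF \<phi>(3) s(1)] in \<open>auto simp: o_def\<close>)
qed

lemma D12_in_Lq:
  fixes u :: "real^'n \<Rightarrow> real"
  assumes D: "has_D12_gradient u G" and N: "3 \<le> CARD('n)"
  shows "in_Lq (sobolev_exp CARD('n)) u" "in_Lq 2 G"
proof -
  obtain \<phi> where \<phi>: "\<And>m. test_fun (\<phi> m)" "(\<lambda>m::nat. Lq_dist 2 (grad (\<phi> m)) G) \<longlonglongrightarrow> 0"
      "(\<lambda>m. Lq_dist (sobolev_exp CARD('n)) (\<phi> m) u) \<longlonglongrightarrow> 0"
    by (rule D12_approx[OF D]) blast
  show "in_Lq (sobolev_exp CARD('n)) u"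
    by (rule in_Lq_limit[OF _ _ _ \<phi>(3)])
       (use sobolev_exp_gt_2[OF N] in_Lq_test_fun[OF \<phi>(1)] D12_measurable[OF D] in auto)
  show "in_Lq 2 G"
    by (rule in_Lq_limit[OF _ _ _ \<phi>(2)])
       (use in_Lq_test_fun[OF \<phi>(1)] D12_measurable[OF D] in auto)
qed

lemma D12_test_fun: "test_fun \<phi> \<Longrightarrow> has_D12_gradient \<phi> (grad \<phi>)"
  unfolding has_D12_gradient_iff
  by (auto simp: Lq_dist_def intro!: exI[of _ "\<lambda>_. \<phi>"])

text \<open>Diagonal argument: for each m a test function is chosen within
  \<open>1 / real (Suc m)\<close> of \<open>v m\<close> and of its gradient. The truncations below
  all enter \<open>D12\<close> through this closedness.\<close>

lemma D12_closed:
  fixes u :: "real^'n \<Rightarrow> real"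
  assumes D: "\<And>m. has_D12_gradient (v m) (H m)" and N: "3 \<le> CARD('n)"
    and [measurable]: "u \<in> borel_measurable lebesgue" "G \<in> borel_measurable lebesgue"
    and lim: "(\<lambda>m. Lq_dist 2 (H m) G) \<longlonglongrightarrow> 0" "(\<lambda>m. Lq_dist (sobolev_exp CARD('n)) (v m) u) \<longlonglongrightarrow> 0"
  shows "has_D12_gradient u G"
proof -
  have p: "sobolev_exp CARD('n) > 2" by (rule sobolev_exp_gt_2[OF N])
  define \<epsilon> where "\<epsilon> m = ennreal (1 / real (Suc m))" for m
  have \<epsilon>: "\<epsilon> \<longlonglongrightarrow> 0" "\<epsilon> m > 0" for m
    unfolding \<epsilon>_def using LIMSEQ_inverse_real_of_nat by (auto simp: inverse_eq_divide ennreal_tendsto_0_iff)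
  have "\<exists>\<psi>. test_fun \<psi> \<and> Lq_dist 2 (grad \<psi>) (H m) < \<epsilon> m \<and> Lq_dist (sobolev_exp CARD('n)) \<psi> (v m) < \<epsilon> m" for m
  proof -
    obtain \<phi> where \<phi>: "\<And>k. test_fun (\<phi> k)" "(\<lambda>k::nat. Lq_dist 2 (grad (\<phi> k)) (H m)) \<longlonglongrightarrow> 0"
      "(\<lambda>k. Lq_dist (sobolev_exp CARD('n)) (\<phi> k) (v m)) \<longlonglongrightarrow> 0"
      by (rule D12_approx[OF D[of m]]) blast
    from order_tendstoD(2)[OF \<phi>(2) \<epsilon>(2)[of m]] order_tendstoD(2)[OF \<phi>(3) \<epsilon>(2)[of m]]
    have "\<forall>\<^sub>F k in sequentially. Lq_dist 2 (grad (\<phi> k)) (H m) < \<epsilon> m \<and> Lq_dist (sobolev_exp CARD('n)) (\<phi> k) (v m) < \<epsilon> m"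
      by (rule eventually_conj)
    then show ?thesis using \<phi>(1) by (auto simp: eventually_sequentially)
  qed
  then obtain \<psi> where \<psi>: "\<And>m. test_fun (\<psi> m)" "\<And>m. Lq_dist 2 (grad (\<psi> m)) (H m) < \<epsilon> m"
      "\<And>m. Lq_dist (sobolev_exp CARD('n)) (\<psi> m) (v m) < \<epsilon> m" by metis
  have l: "(\<lambda>m. Lq_dist 2 (grad (\<psi> m)) (H m)) \<longlonglongrightarrow> 0" "(\<lambda>m. Lq_dist (sobolev_exp CARD('n)) (\<psi> m) (v m)) \<longlonglongrightarrow> 0"
    by (rule tendsto_0_le_ennreal[OF less_imp_le \<epsilon>(1)], rule \<psi>)+
  have "(\<lambda>m. Lq_dist 2 (grad (\<psi> m)) G) \<longlonglongrightarrow> 0"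
    by (rule Lq_tendsto_trans[OF _ _ _ _ l(1) lim(1)]) (use \<psi>(1) D12_measurable[OF D] in auto)
  moreover have "(\<lambda>m. Lq_dist (sobolev_exp CARD('n)) (\<psi> m) u) \<longlonglongrightarrow> 0"
    by (rule Lq_tendsto_trans[OF _ _ _ _ l(2) lim(2)]) (use \<psi>(1) D12_measurable[OF D] p in auto)
  ultimately show ?thesis unfolding has_D12_gradient_iff using \<psi>(1) by auto
qed

section \<open>Linear operations, reflections, and the Hardy and Sobolev inequalities in
  \<open>D12\<close>\<close>

lemma D12_add:
  fixes u :: "real^'n \<Rightarrow> real"
  assumes D: "has_D12_gradient u G" "has_D12_gradient v H" and N: "3 \<le> CARD('n)"
  shows "has_D12_gradient (\<lambda>x. u x + v x) (\<lambda>x. G x + H x)"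
proof -
  have p: "sobolev_exp CARD('n) > 2" by (rule sobolev_exp_gt_2[OF N])
  obtain \<phi> where \<phi>: "\<And>m. test_fun (\<phi> m)" "(\<lambda>m::nat. Lq_dist 2 (grad (\<phi> m)) G) \<longlonglongrightarrow> 0"
      "(\<lambda>m. Lq_dist (sobolev_exp CARD('n)) (\<phi> m) u) \<longlonglongrightarrow> 0"
    by (rule D12_approx[OF D(1)]) blast
  obtain \<psi> where \<psi>: "\<And>m. test_fun (\<psi> m)" "(\<lambda>m::nat. Lq_dist 2 (grad (\<psi> m)) H) \<longlonglongrightarrow> 0"
      "(\<lambda>m. Lq_dist (sobolev_exp CARD('n)) (\<psi> m) v) \<longlonglongrightarrow> 0"
    by (rule D12_approx[OF D(2)]) blast
  note [measurable] = D12_measurable[OF D(1)] D12_measurable[OF D(2)]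
  have g: "grad (\<lambda>x. \<phi> m x + \<psi> m x) = (\<lambda>x. grad (\<phi> m) x + grad (\<psi> m) x)" for m
    by (rule ext, rule grad_add) (auto intro: test_fun_smooth \<phi> \<psi>)
  have "(\<lambda>m. Lq_dist 2 (\<lambda>x. grad (\<phi> m) x + grad (\<psi> m) x) (\<lambda>x. G x + H x)) \<longlonglongrightarrow> 0"
    by (rule Lq_tendsto_add[OF _ _ _ _ _ \<phi>(2) \<psi>(2)]) (use \<phi>(1) \<psi>(1) in auto)
  moreover have "(\<lambda>m. Lq_dist (sobolev_exp CARD('n)) (\<lambda>x. \<phi> m x + \<psi> m x) (\<lambda>x. u x + v x)) \<longlonglongrightarrow> 0"
    by (rule Lq_tendsto_add[OF _ _ _ _ _ \<phi>(3) \<psi>(3)]) (use \<phi>(1) \<psi>(1) p in auto)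
  ultimately show ?thesis
    unfolding has_D12_gradient_iff
    by (intro conjI exI[of _ "\<lambda>m x. \<phi> m x + \<psi> m x"]) (auto intro!: test_fun_add \<phi> \<psi> simp: g)
qed

lemma D12_cmult:
  fixes u :: "real^'n \<Rightarrow> real"
  assumes D: "has_D12_gradient u G" and N: "3 \<le> CARD('n)"
  shows "has_D12_gradient (\<lambda>x. c * u x) (\<lambda>x. c *\<^sub>R G x)"
proof -
  have p: "sobolev_exp CARD('n) > 2" by (rule sobolev_exp_gt_2[OF N])
  obtain \<phi> where \<phi>: "\<And>m. test_fun (\<phi> m)" "(\<lambda>m::nat. Lq_dist 2 (grad (\<phi> m)) G) \<longlonglongrightarrow> 0"
      "(\<lambda>m. Lq_dist (sobolev_exp CARD('n)) (\<phi> m) u) \<longlonglongrightarrow> 0"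
    by (rule D12_approx[OF D(1)]) blast
  note [measurable] = D12_measurable[OF D(1)]
  have g: "grad (\<lambda>x. c * \<phi> m x) = (\<lambda>x. c *\<^sub>R grad (\<phi> m) x)" for m
    by (rule ext, rule grad_compose) (auto intro!: test_fun_smooth \<phi> derivative_eq_intros)
  have "(\<lambda>m. Lq_dist 2 (\<lambda>x. c *\<^sub>R grad (\<phi> m) x) (\<lambda>x. c *\<^sub>R G x)) \<longlonglongrightarrow> 0"
    by (rule Lq_tendsto_scale[OF _ _ _ _ _ \<phi>(2), where c="\<bar>c\<bar>"])
       (use \<phi>(1) in \<open>auto simp: scaleR_diff_right[symmetric]\<close>)
  moreover have "(\<lambda>m. Lq_dist (sobolev_exp CARD('n)) (\<lambda>x. c * \<phi> m x) (\<lambda>x. c * u x)) \<longlonglongrightarrow> 0"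
    by (rule Lq_tendsto_scale[OF _ _ _ _ _ \<phi>(3), where c="\<bar>c\<bar>"])
       (use \<phi>(1) p in \<open>auto simp: right_diff_distrib[symmetric] abs_mult\<close>)
  ultimately show ?thesis
    unfolding has_D12_gradient_iff
    by (intro conjI exI[of _ "\<lambda>m x. c * \<phi> m x"]) (auto intro!: test_fun_cmult \<phi> simp: g)
qed

lemma D12_diff:
  fixes u :: "real^'n \<Rightarrow> real"
  assumes "has_D12_gradient u G" "has_D12_gradient v H" "3 \<le> CARD('n)"
  shows "has_D12_gradient (\<lambda>x. u x - v x) (\<lambda>x. G x - H x)"
  using D12_add[OF assms(1) D12_cmult[OF assms(2,3), of "-1"] assms(3)] by simp

lemma D12_zero: "has_D12_gradient (\<lambda>x::real^'n. 0) (\<lambda>x. 0)"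
proof -
  have "test_fun (\<lambda>x::real^'n. 0)" by (simp add: test_fun_iff smooth_const)
  moreover have "grad (\<lambda>x::real^'n. 0) = (\<lambda>x. 0)" by (rule ext, rule grad_eqI) simp
  ultimately show ?thesis using D12_test_fun by metis
qed

lemma D12_sum:
  fixes u :: "'i \<Rightarrow> real^'n \<Rightarrow> real"
  assumes "finite I" "\<And>i. i \<in> I \<Longrightarrow> has_D12_gradient (u i) (G i)" "3 \<le> CARD('n)"
  shows "has_D12_gradient (\<lambda>x. \<Sum>i\<in>I. u i x) (\<lambda>x. \<Sum>i\<in>I. G i x)"
  using assms(1,2)
  by (induction I rule: finite_induct) (auto intro: D12_zero D12_add assms(3))

lemma measurable_comp_refl_hyp:
  assumes "norm e = 1" "f \<in> borel_measurable lebesgue"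
  shows "(\<lambda>x. f (refl_hyp e \<mu> x)) \<in> borel_measurable lebesgue"
  by (rule measurable_compose[OF measurable_refl_hyp[OF assms(1)] assms(2)])

lemma measurable_refl_hyp_comp [measurable]:
  assumes [measurable]: "f \<in> borel_measurable M"
  shows "(\<lambda>x. refl_hyp e \<mu> (f x)) \<in> borel_measurable M"
  unfolding refl_hyp_def by measurable

lemma D12_refl:
  fixes u :: "real^'n \<Rightarrow> real"
  assumes D: "has_D12_gradient u G" and e: "norm e = 1"
  shows "has_D12_gradient (\<lambda>x. u (refl_hyp e \<mu> x)) (\<lambda>x. refl_hyp e 0 (G (refl_hyp e \<mu> x)))"
proof -
  obtain \<phi> where \<phi>: "\<And>m. test_fun (\<phi> m)" "(\<lambda>m::nat. Lq_dist 2 (grad (\<phi> m)) G) \<longlonglongrightarrow> 0"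
      "(\<lambda>m. Lq_dist (sobolev_exp CARD('n)) (\<phi> m) u) \<longlonglongrightarrow> 0"
    by (rule D12_approx[OF D(1)]) blast
  note [measurable] = D12_measurable[OF D(1)]
  have g: "grad (\<lambda>x. \<phi> m (refl_hyp e \<mu> x)) = (\<lambda>x. refl_hyp e 0 (grad (\<phi> m) (refl_hyp e \<mu> x)))" for m
    by (rule ext, rule grad_refl) (auto intro!: test_fun_smooth \<phi>)
  have "Lq_dist 2 (\<lambda>x. refl_hyp e 0 (grad (\<phi> m) (refl_hyp e \<mu> x))) (\<lambda>x. refl_hyp e 0 (G (refl_hyp e \<mu> x)))
      = Lq_dist 2 (\<lambda>x. grad (\<phi> m) (refl_hyp e \<mu> x)) (\<lambda>x. G (refl_hyp e \<mu> x))" for m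
    unfolding Lq_dist_def using e by (simp add: refl_hyp_diff)
  also have "\<dots> m = Lq_dist 2 (grad (\<phi> m)) G" for m
    by (rule Lq_dist_refl_hyp[OF e]) (use \<phi>(1) in auto)
  finally have 1: "Lq_dist 2 (\<lambda>x. refl_hyp e 0 (grad (\<phi> m) (refl_hyp e \<mu> x))) (\<lambda>x. refl_hyp e 0 (G (refl_hyp e \<mu> x)))
      = Lq_dist 2 (grad (\<phi> m)) G" for m .
  have 2: "Lq_dist (sobolev_exp CARD('n)) (\<lambda>x. \<phi> m (refl_hyp e \<mu> x)) (\<lambda>x. u (refl_hyp e \<mu> x))
      = Lq_dist (sobolev_exp CARD('n)) (\<phi> m) u" for m
    by (rule Lq_dist_refl_hyp[OF e]) (use \<phi>(1) in auto)
  have 3: "(\<lambda>x. u (refl_hyp e \<mu> x)) \<in> borel_measurable lebesgue"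
      "(\<lambda>x. refl_hyp e 0 (G (refl_hyp e \<mu> x))) \<in> borel_measurable lebesgue"
    by (rule measurable_comp_refl_hyp[OF e], simp, rule measurable_refl_hyp_comp, rule measurable_comp_refl_hyp[OF e], simp)
  show ?thesis
    unfolding has_D12_gradient_iff
    by (intro conjI 3 exI[of _ "\<lambda>m x. \<phi> m (refl_hyp e \<mu> x)"])
       (use \<phi>(2,3) in \<open>auto intro!: test_fun_refl e \<phi>(1) simp: g 1 2\<close>)
qed

text \<open>The strict energy inequality leaves room for some t > 0 with
  \<open>(1 + t) * d < b\<close>. Young's inequality with the coefficients 1 + t and 1 + 1/t then
  keeps the energies of all late approximants below b, which is what preserves the sharp Hardy
  constant in the limit.\<close>

lemma D12_approx_energy:
  fixes u :: "real^'n \<Rightarrow> real"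
  assumes D: "has_D12_gradient u G" and N: "3 \<le> CARD('n)"
    and b: "(\<integral>\<^sup>+x. ennreal ((norm (G x))\<^sup>2) \<partial>lebesgue) < ennreal b"
  obtains \<phi> :: "nat \<Rightarrow> real^'n \<Rightarrow> real" where "\<And>m. test_fun (\<phi> m)" "AE x in lebesgue. (\<lambda>m. \<phi> m x) \<longlonglongrightarrow> u x"
    "\<And>m. (\<integral>\<^sup>+x. ennreal ((norm (grad (\<phi> m) x))\<^sup>2) \<partial>lebesgue) \<le> ennreal b"
proof -
  obtain \<phi> where \<phi>: "\<And>m. test_fun (\<phi> m)" "(\<lambda>m::nat. Lq_dist 2 (grad (\<phi> m)) G) \<longlonglongrightarrow> 0"
      "(\<lambda>m. Lq_dist (sobolev_exp CARD('n)) (\<phi> m) u) \<longlonglongrightarrow> 0"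
      "AE x in lebesgue. (\<lambda>m. \<phi> m x) \<longlonglongrightarrow> u x"
    by (rule D12_approx_AE[OF D N]) blast
  note [measurable] = D12_measurable[OF D(1)]
  define E where "E = (\<integral>\<^sup>+x. ennreal ((norm (G x))\<^sup>2) \<partial>lebesgue)"
  obtain d where d: "E = ennreal d" "0 \<le> d" "d < b"
    using b unfolding E_def[symmetric] by (cases E) (auto simp: ennreal_less_iff)
  define t where "t = (b - d) / (2 * (d + 1))"
  have t: "t > 0" using d by (simp add: t_def)
  have "t * d \<le> t * (d + 1)" using t by simp
  also have "\<dots> = (b - d) / 2" using d by (simp add: t_def field_simps)
  finally have td: "(1 + t) * d < b" using d by (simp add: algebra_simps)
  have le: "(\<integral>\<^sup>+x. ennreal ((norm (grad (\<phi> m) x))\<^sup>2) \<partial>lebesgue) \<le> ennreal ((1 + t) * d) + ennreal (1 + 1 / t) * Lq_dist 2 (grad (\<phi> m)) G" for m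
  proof -
    have pt: "(norm a)\<^sup>2 \<le> (1 + t) * (norm c)\<^sup>2 + (1 + 1 / t) * (norm (a - c))\<^sup>2" for a c :: "real^'n"
    proof -
      have "norm a \<le> norm c + norm (a - c)" using norm_triangle_ineq[of c "a - c"] by simp
      then have "(norm a)\<^sup>2 \<le> (norm c + norm (a - c))\<^sup>2" by (intro power_mono) auto
      moreover have "0 \<le> (t * norm c - norm (a - c))\<^sup>2 / t" using t by simp
      then have "2 * norm c * norm (a - c) \<le> t * (norm c)\<^sup>2 + (norm (a - c))\<^sup>2 / t"
        using t by (simp add: power2_eq_square field_simps)
      ultimately show ?thesis by (simp add: power2_sum algebra_simps)
    qed
    have "(\<integral>\<^sup>+x. ennreal ((norm (grad (\<phi> m) x))\<^sup>2) \<partial>lebesgue) \<le>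
      (\<integral>\<^sup>+x. ennreal (1 + t) * ennreal ((norm (G x))\<^sup>2) + ennreal (1 + 1 / t) * ennreal (norm (grad (\<phi> m) x - G x) powr 2) \<partial>lebesgue)"
      using pt t
      by (intro nn_integral_mono)
         (simp add: ennreal_mult[symmetric] ennreal_plus[symmetric] ennreal_leI del: ennreal_plus)
    also have "\<dots> = ennreal (1 + t) * E + ennreal (1 + 1 / t) * Lq_dist 2 (grad (\<phi> m)) G"
      unfolding E_def Lq_dist_def using \<phi>(1)[of m]
      by (subst nn_integral_add) (auto simp: nn_integral_cmult)
    also have "ennreal (1 + t) * E = ennreal ((1 + t) * d)" using d t by (simp add: ennreal_mult)
    finally show ?thesis .
  qed
  have "(\<lambda>m. ennreal ((1 + t) * d) + ennreal (1 + 1 / t) * Lq_dist 2 (grad (\<phi> m)) G) \<longlonglongrightarrow> ennreal ((1 + t) * d) + ennreal (1 + 1 / t) * 0"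
    by (intro tendsto_add tendsto_const tendsto_mult_ennreal \<phi>(2)) auto
  then have "\<forall>\<^sub>F m in sequentially. ennreal ((1 + t) * d) + ennreal (1 + 1 / t) * Lq_dist 2 (grad (\<phi> m)) G < ennreal b"
    by (rule order_tendstoD(2)) (use td d t in \<open>auto simp: ennreal_less_iff\<close>)
  then obtain M where M: "\<And>m. m \<ge> M \<Longrightarrow> ennreal ((1 + t) * d) + ennreal (1 + 1 / t) * Lq_dist 2 (grad (\<phi> m)) G < ennreal b"
    by (auto simp: eventually_sequentially)
  show thesis
  proof (rule that[of "\<lambda>m. \<phi> (m + M)"])
    show "AE x in lebesgue. (\<lambda>m. \<phi> (m + M) x) \<longlonglongrightarrow> u x"
      using \<phi>(4) by eventually_elim (rule LIMSEQ_ignore_initial_segment)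
    show "(\<integral>\<^sup>+x. ennreal ((norm (grad (\<phi> (m + M)) x))\<^sup>2) \<partial>lebesgue) \<le> ennreal b" for m
      using le[of "m + M"] M[of "m + M"] by simp
  qed (rule \<phi>(1))
qed

text \<open>Common scheme for carrying an integral bound from test functions to \<open>D12\<close>:
  the approximants converge almost everywhere and obey one energy bound.\<close>

lemma D12_Fatou:
  fixes u :: "real^'n \<Rightarrow> real"
  assumes D: "has_D12_gradient u G" and N: "3 \<le> CARD('n)"
    and b: "(\<integral>\<^sup>+x. ennreal ((norm (G x))\<^sup>2) \<partial>lebesgue) < ennreal b"
    and F [measurable]: "\<And>f. f \<in> borel_measurable lebesgue \<Longrightarrow> (\<lambda>x. F x (f x)) \<in> borel_measurable lebesgue"
    and Fc: "\<And>x a s. s \<longlonglongrightarrow> a \<Longrightarrow> (\<lambda>m. F x (s m)) \<longlonglongrightarrow> F x a"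
    and bound: "\<And>\<phi>. test_fun \<phi> \<Longrightarrow> (\<integral>\<^sup>+x. ennreal ((norm (grad \<phi> x))\<^sup>2) \<partial>lebesgue) \<le> ennreal b \<Longrightarrow>
       (\<integral>\<^sup>+x. F x (\<phi> x) \<partial>lebesgue) \<le> B"
  shows "(\<integral>\<^sup>+x. F x (u x) \<partial>lebesgue) \<le> (B :: ennreal)"
proof -
  obtain \<phi> :: "nat \<Rightarrow> real^'n \<Rightarrow> real" where \<phi>: "\<And>m. test_fun (\<phi> m)" "AE x in lebesgue. (\<lambda>m. \<phi> m x) \<longlonglongrightarrow> u x"
    "\<And>m. (\<integral>\<^sup>+x. ennreal ((norm (grad (\<phi> m) x))\<^sup>2) \<partial>lebesgue) \<le> ennreal b"
    by (rule D12_approx_energy[OF D N b]) blast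
  have "(\<integral>\<^sup>+x. F x (u x) \<partial>lebesgue) = (\<integral>\<^sup>+x. liminf (\<lambda>m. F x (\<phi> m x)) \<partial>lebesgue)"
    by (rule nn_integral_cong_AE, rule AE_mp[OF \<phi>(2)])
       (auto intro!: AE_I2 lim_imp_Liminf[OF sequentially_bot, symmetric] Fc)
  also have "\<dots> \<le> liminf (\<lambda>m. \<integral>\<^sup>+x. F x (\<phi> m x) \<partial>lebesgue)"
    by (intro nn_integral_liminf F) (use \<phi>(1) in auto)
  also have "\<dots> \<le> B"
    by (rule Liminf_le) (auto intro!: always_eventually bound \<phi>)
  finally show ?thesis .
qed

proposition Hardy_D12:
  fixes u :: "real^'n \<Rightarrow> real"
  assumes D: "has_D12_gradient u G" and N: "3 \<le> CARD('n)"
  shows "ennreal (hardy_const CARD('n)) * (\<integral>\<^sup>+x. ennreal ((u x)\<^sup>2 / (norm x)\<^sup>2) \<partial>lebesgue)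
    \<le> (\<integral>\<^sup>+x. ennreal ((norm (G x))\<^sup>2) \<partial>lebesgue)"
proof -
  have h: "hardy_const CARD('n) > 0" using N by (simp add: hardy_const_def)
  note [measurable] = D12_measurable[OF D]
  have m: "(\<lambda>x::real^'n. (norm x)\<^sup>2) \<in> borel_measurable lebesgue"
    by (intro measurable_completion) auto
  have *: "(\<integral>\<^sup>+x. ennreal (hardy_const CARD('n) * ((u x)\<^sup>2 / (norm x)\<^sup>2)) \<partial>lebesgue) \<le> ennreal b"
    if b: "(\<integral>\<^sup>+x. ennreal ((norm (G x))\<^sup>2) \<partial>lebesgue) < ennreal b" for b
  proof (rule D12_Fatou[OF D N b, of "\<lambda>x t. ennreal (hardy_const CARD('n) * (t\<^sup>2 / (norm x)\<^sup>2))"])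
    fix f :: "real^'n \<Rightarrow> real" assume [measurable]: "f \<in> borel_measurable lebesgue"
    show "(\<lambda>x. ennreal (hardy_const CARD('n) * ((f x)\<^sup>2 / (norm x)\<^sup>2))) \<in> borel_measurable lebesgue"
      using m by measurable
  next
    fix x :: "real^'n" and a s assume s: "s \<longlonglongrightarrow> (a::real)"
    show "(\<lambda>m. ennreal (hardy_const CARD('n) * ((s m)\<^sup>2 / (norm x)\<^sup>2))) \<longlonglongrightarrow> ennreal (hardy_const CARD('n) * (a\<^sup>2 / (norm x)\<^sup>2))"
      unfolding divide_inverse by (intro tendsto_ennrealI tendsto_intros s)
  next
    fix \<phi> :: "real^'n \<Rightarrow> real"
    assume \<phi>: "test_fun \<phi>" "(\<integral>\<^sup>+x. ennreal ((norm (grad \<phi> x))\<^sup>2) \<partial>lebesgue) \<le> ennreal b"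
    have "(\<integral>\<^sup>+x. ennreal (hardy_const CARD('n) * ((\<phi> x)\<^sup>2 / (norm x)\<^sup>2)) \<partial>lebesgue) =
       ennreal (hardy_const CARD('n)) * (\<integral>\<^sup>+x. ennreal ((\<phi> x)\<^sup>2 / (norm x)\<^sup>2) \<partial>lebesgue)"
      using h \<phi> m by (simp add: ennreal_mult' nn_integral_cmult del: times_divide_eq_right)
    also have "\<dots> \<le> ennreal b" using Hardy_test_fun[OF \<phi>(1) N] \<phi>(2) by (rule order_trans)
    finally show "(\<integral>\<^sup>+x. ennreal (hardy_const CARD('n) * ((\<phi> x)\<^sup>2 / (norm x)\<^sup>2)) \<partial>lebesgue) \<le> ennreal b" .
  qed
  have "ennreal (hardy_const CARD('n)) * (\<integral>\<^sup>+x. ennreal ((u x)\<^sup>2 / (norm x)\<^sup>2) \<partial>lebesgue) =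
     (\<integral>\<^sup>+x. ennreal (hardy_const CARD('n) * ((u x)\<^sup>2 / (norm x)\<^sup>2)) \<partial>lebesgue)"
    using h m by (simp add: ennreal_mult' nn_integral_cmult del: times_divide_eq_right)
  also have "\<dots> \<le> (\<integral>\<^sup>+x. ennreal ((norm (G x))\<^sup>2) \<partial>lebesgue)"
  \<comment> \<open>The approximation requires a bound strictly above the energy; letting this bound
    decrease to the energy loses nothing in the constant.\<close>
  proof (rule dense_ge)
    fix y assume y: "(\<integral>\<^sup>+x. ennreal ((norm (G x))\<^sup>2) \<partial>lebesgue) < y"
    then show "(\<integral>\<^sup>+x. ennreal (hardy_const CARD('n) * ((u x)\<^sup>2 / (norm x)\<^sup>2)) \<partial>lebesgue) \<le> y"
    proof (cases y)
      case (real b)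
      then show ?thesis using y * by blast
    qed simp
  qed
  finally show ?thesis .
qed

proposition Sobolev_D12:
  fixes u :: "real^'n \<Rightarrow> real"
  assumes D: "has_D12_gradient u G" and N: "3 \<le> CARD('n)"
  shows "epow (\<integral>\<^sup>+x. ennreal (\<bar>u x\<bar> powr sobolev_exp CARD('n)) \<partial>lebesgue) (2 / sobolev_exp CARD('n))
    \<le> ennreal ((sobolev_const CARD('n))\<^sup>2) * (\<integral>\<^sup>+x. ennreal ((norm (G x))\<^sup>2) \<partial>lebesgue)"
proof -
  define p where "p = sobolev_exp CARD('n)"
  have p: "p > 2" unfolding p_def by (rule sobolev_exp_gt_2[OF N])
  define C where "C = (sobolev_const CARD('n))\<^sup>2"
  have C: "C > 0" using N by (simp add: C_def sobolev_const_def)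
  note [measurable] = D12_measurable[OF D]
  have *: "epow (\<integral>\<^sup>+x. ennreal (\<bar>u x\<bar> powr p) \<partial>lebesgue) (2 / p) \<le> ennreal (C * b)"
    if b: "(\<integral>\<^sup>+x. ennreal ((norm (G x))\<^sup>2) \<partial>lebesgue) < ennreal b" for b
  proof -
    have b0: "b > 0" using b by (metis ennreal_neg not_less zero_le order_le_less_trans)
    have "(\<integral>\<^sup>+x. ennreal (\<bar>u x\<bar> powr p) \<partial>lebesgue) \<le> epow (ennreal (C * b)) (p / 2)"
    proof (rule D12_Fatou[OF D N b, of "\<lambda>x t. ennreal (\<bar>t\<bar> powr p)"])
      fix x :: "real^'n" and a s assume s: "s \<longlonglongrightarrow> (a::real)"
      show "(\<lambda>m. ennreal (\<bar>s m\<bar> powr p)) \<longlonglongrightarrow> ennreal (\<bar>a\<bar> powr p)"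
        using p by (intro tendsto_ennrealI tendsto_powr' tendsto_rabs tendsto_const s) auto
    next
      fix \<phi> :: "real^'n \<Rightarrow> real"
      assume \<phi>: "test_fun \<phi>" "(\<integral>\<^sup>+x. ennreal ((norm (grad \<phi> x))\<^sup>2) \<partial>lebesgue) \<le> ennreal b"
      have "epow (\<integral>\<^sup>+x. ennreal (\<bar>\<phi> x\<bar> powr p) \<partial>lebesgue) (2 / p) \<le> ennreal C * ennreal b"
        unfolding p_def C_def using Sobolev_test_fun[OF \<phi>(1) N] mult_left_mono[OF \<phi>(2)]
        by (rule order_trans) simp
      then have "epow (epow (\<integral>\<^sup>+x. ennreal (\<bar>\<phi> x\<bar> powr p) \<partial>lebesgue) (2 / p)) (p / 2) \<le> epow (ennreal (C * b)) (p / 2)"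
        using p C b0 by (intro epow_mono) (auto simp: ennreal_mult)
      then show "(\<integral>\<^sup>+x. ennreal (\<bar>\<phi> x\<bar> powr p) \<partial>lebesgue) \<le> epow (ennreal (C * b)) (p / 2)"
        using p by (simp add: epow_epow)
    next
      fix f :: "real^'n \<Rightarrow> real" assume [measurable]: "f \<in> borel_measurable lebesgue"
      show "(\<lambda>x. ennreal (\<bar>f x\<bar> powr p)) \<in> borel_measurable lebesgue" by measurable
    qed
    then have "epow (\<integral>\<^sup>+x. ennreal (\<bar>u x\<bar> powr p) \<partial>lebesgue) (2 / p) \<le> epow (epow (ennreal (C * b)) (p / 2)) (2 / p)"
      using p by (intro epow_mono) auto
    then show ?thesis using p by (simp add: epow_epow)
  qed
  define E where "E = (\<integral>\<^sup>+x. ennreal ((norm (G x))\<^sup>2) \<partial>lebesgue)"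
  have "E < top" using D12_in_Lq(2)[OF D N] by (simp add: in_Lq_def E_def)
  then obtain d where d: "E = ennreal d" "d \<ge> 0" by (cases E) auto
  have "epow (\<integral>\<^sup>+x. ennreal (\<bar>u x\<bar> powr p) \<partial>lebesgue) (2 / p) \<le> ennreal (C * d)"
  proof (rule ennreal_le_epsilon)
    fix \<epsilon> :: real assume \<epsilon>: "\<epsilon> > 0"
    have "E < ennreal (d + \<epsilon> / C)" using d \<epsilon> C by (simp add: ennreal_less_iff)
    then have "epow (\<integral>\<^sup>+x. ennreal (\<bar>u x\<bar> powr p) \<partial>lebesgue) (2 / p) \<le> ennreal (C * (d + \<epsilon> / C))"
      unfolding E_def by (rule *)
    also have "C * (d + \<epsilon> / C) = C * d + \<epsilon>" using C by (simp add: field_simps)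
    finally show "epow (\<integral>\<^sup>+x. ennreal (\<bar>u x\<bar> powr p) \<partial>lebesgue) (2 / p) \<le> ennreal (C * d) + ennreal \<epsilon>"
      using C d \<epsilon> by simp
  qed
  then show ?thesis using d C by (simp add: p_def C_def E_def[symmetric] ennreal_mult)
qed

section \<open>Uniqueness of the gradient\<close>

lemma conjugate_exponent:
  fixes p :: real
  assumes "p > 1"
  shows "p / (p - 1) > 1" "1 / (p / (p - 1)) + 1 / p = 1"
  using assms by (simp_all add: field_simps)

lemma partial_deriv_mult:
  "smooth f \<Longrightarrow> smooth g \<Longrightarrow>
    partial_deriv i (\<lambda>x. f x * g x) x = f x * partial_deriv i g x + g x * partial_deriv i f x"
  using grad_nth[of "\<lambda>x. f x * g x" x i] by (simp add: grad_mult del: grad_nth) simp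

lemma integral_by_parts_test_fun:
  fixes f g :: "real^'n \<Rightarrow> real"
  assumes f: "test_fun f" and g: "test_fun g"
  shows "(\<integral>x. grad f x \<bullet> grad g x \<partial>lebesgue) = - (\<integral>x. f x * (\<Sum>i\<in>UNIV. partial_deriv i (partial_deriv i g) x) \<partial>lebesgue)"
proof -
  have ti: "integrable lebesgue h" if h: "test_fun h" for h :: "real^'n \<Rightarrow> real"
  proof -
    obtain K where "K > 0" "\<And>x. norm x > K \<Longrightarrow> h x = 0"
      by (rule test_fun_support[OF h]) blast
    then show ?thesis by (intro integrable_compact_support smooth_continuous test_fun_smooth h)
  qed
  have g': "test_fun (partial_deriv i g)" "test_fun (partial_deriv i (partial_deriv i g))" for i
    by (intro test_fun_partial_deriv g)+
  have t1: "test_fun (\<lambda>x. f x * partial_deriv i (partial_deriv i g) x)"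
    and t2: "test_fun (\<lambda>x. partial_deriv i f x * partial_deriv i g x)" for i
    by (intro test_fun_mult test_fun_partial_deriv f test_fun_smooth g)+
  have zero: "0 = (\<integral>x. f x * partial_deriv i (partial_deriv i g) x + partial_deriv i f x * partial_deriv i g x \<partial>lebesgue)" for i
  proof -
    have "0 = (\<integral>x. partial_deriv i (\<lambda>x. f x * partial_deriv i g x) x \<partial>lebesgue)"
      by (rule integral_partial_deriv_eq_0[symmetric]) (intro test_fun_mult f test_fun_smooth g')
    then show ?thesis
      by (simp add: partial_deriv_mult test_fun_smooth f g' mult.commute)
  qed
  have eq: "(\<integral>x. partial_deriv i f x * partial_deriv i g x \<partial>lebesgue) = - (\<integral>x. f x * partial_deriv i (partial_deriv i g) x \<partial>lebesgue)" for i
    using Bochner_Integration.integral_add[OF ti[OF t1[of i]] ti[OF t2[of i]]] zero[of i] by linarith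
  have "(\<integral>x. grad f x \<bullet> grad g x \<partial>lebesgue) = (\<Sum>i\<in>UNIV. \<integral>x. partial_deriv i f x * partial_deriv i g x \<partial>lebesgue)"
    unfolding inner_vec_def grad_nth inner_real_def
    by (rule Bochner_Integration.integral_sum) (rule ti[OF t2])
  also have "\<dots> = - (\<Sum>i\<in>UNIV. \<integral>x. f x * partial_deriv i (partial_deriv i g) x \<partial>lebesgue)"
    by (simp add: eq sum_negf)
  also have "(\<Sum>i\<in>UNIV. \<integral>x. f x * partial_deriv i (partial_deriv i g) x \<partial>lebesgue) =
      (\<integral>x. f x * (\<Sum>i\<in>UNIV. partial_deriv i (partial_deriv i g) x) \<partial>lebesgue)"
    unfolding sum_distrib_left
    by (rule Bochner_Integration.integral_sum[symmetric]) (rule ti[OF t1])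
  finally show ?thesis .
qed

text \<open>The gradient is determined by the function: integrating by parts against the
  approximating test functions themselves avoids the fundamental lemma of the calculus of
  variations.\<close>

lemma D12_gradient_zero:
  fixes H :: "real^'n \<Rightarrow> real^'n"
  assumes D: "has_D12_gradient (\<lambda>x. 0) H" and N: "3 \<le> CARD('n)"
  shows "AE x in lebesgue. H x = 0"
proof -
  define p where "p = sobolev_exp CARD('n)"
  have p: "p > 2" unfolding p_def by (rule sobolev_exp_gt_2[OF N])
  obtain \<phi> where \<phi>: "\<And>m. test_fun (\<phi> m)" "(\<lambda>m::nat. Lq_dist 2 (grad (\<phi> m)) H) \<longlonglongrightarrow> 0"
      "(\<lambda>m. Lq_dist p (\<phi> m) (\<lambda>x. 0)) \<longlonglongrightarrow> 0"
    unfolding p_def by (rule D12_approx[OF D]) blast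
  note H = D12_in_Lq(2)[OF D N]
  have two: "(2::real) > 1" "1 / (2::real) + 1 / 2 = 1" by auto
  have zero: "(\<integral>x. grad (\<phi> k) x \<bullet> H x \<partial>lebesgue) = 0" for k
  proof -
    define L where "L x = (\<Sum>i\<in>UNIV. partial_deriv i (partial_deriv i (\<phi> k)) x)" for x
    have "in_Lq (p / (p - 1)) L"
    proof -
      have "in_Lq (p / (p - 1)) (\<lambda>x. \<Sum>i\<in>I. partial_deriv i (partial_deriv i (\<phi> k)) x)" if "finite I" for I
        using that
      proof (induction I rule: finite_induct)
        case empty
        show ?case by (simp add: in_Lq_def)
      next
        case (insert i I)
        then show ?case
          using in_Lq_add[OF in_Lq_test_fun(1) insert.IH, of "partial_deriv i (partial_deriv i (\<phi> k))"] p
          by (simp add: test_fun_partial_deriv \<phi>(1))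
      qed
      then show ?thesis by (simp add: L_def[abs_def])
    qed
    then have "(\<lambda>m. \<integral>x. L x \<bullet> \<phi> m x \<partial>lebesgue) \<longlonglongrightarrow> (\<integral>x. L x \<bullet> 0 \<partial>lebesgue)"
      by (rule Lq_pair_tendsto[rotated 3])
         (use conjugate_exponent[of p] p \<phi> in_Lq_test_fun(1)[OF \<phi>(1)] in \<open>auto simp: in_Lq_def[of _ "\<lambda>_. 0"]\<close>)
    moreover have "(\<integral>x. grad (\<phi> k) x \<bullet> grad (\<phi> m) x \<partial>lebesgue) = - (\<integral>x. L x \<bullet> \<phi> m x \<partial>lebesgue)" for m
      using integral_by_parts_test_fun[OF \<phi>(1)[of m] \<phi>(1)[of k]]
      by (simp add: L_def inner_commute mult.commute)
    ultimately have "(\<lambda>m. \<integral>x. grad (\<phi> k) x \<bullet> grad (\<phi> m) x \<partial>lebesgue) \<longlonglongrightarrow> 0"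
      using tendsto_minus[of "\<lambda>m. \<integral>x. L x \<bullet> \<phi> m x \<partial>lebesgue" 0 sequentially] by simp
    moreover have "(\<lambda>m. \<integral>x. grad (\<phi> k) x \<bullet> grad (\<phi> m) x \<partial>lebesgue) \<longlonglongrightarrow> (\<integral>x. grad (\<phi> k) x \<bullet> H x \<partial>lebesgue)"
      by (rule Lq_pair_tendsto[OF two(1) two(1) two(2) _ _ H \<phi>(2)]) (auto intro!: in_Lq_test_fun \<phi>(1))
    ultimately show ?thesis using LIMSEQ_unique by blast
  qed
  \<comment> \<open>\<open>H\<close> is orthogonal to the gradients of all approximants and is
    itself their limit, so it is orthogonal to itself.\<close>
  have "(\<lambda>m. \<integral>x. H x \<bullet> grad (\<phi> m) x \<partial>lebesgue) \<longlonglongrightarrow> (\<integral>x. H x \<bullet> H x \<partial>lebesgue)"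
    by (rule Lq_pair_tendsto[OF two(1) two(1) two(2) H _ H \<phi>(2)]) (auto intro!: in_Lq_test_fun \<phi>(1))
  then have "(\<integral>x. H x \<bullet> H x \<partial>lebesgue) = 0"
    using zero by (simp add: inner_commute LIMSEQ_const_iff)
  then have "AE x in lebesgue. H x \<bullet> H x = 0"
    using integral_nonneg_eq_0_iff_AE[OF Lq_pair_integrable(1)[OF two(1) two(1) two(2) H H]] by simp
  then show ?thesis by eventually_elim simp
qed

lemma D12_gradient_unique:
  fixes u :: "real^'n \<Rightarrow> real"
  assumes "has_D12_gradient u G" "has_D12_gradient u H" and N: "3 \<le> CARD('n)"
  shows "AE x in lebesgue. G x = H x"
  using D12_gradient_zero[OF _ N, of "\<lambda>x. G x - H x"] D12_diff[OF assms] by simp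

section \<open>Absolute values, positive parts and zero level sets\<close>

lemma sqrt_add_sq_Lipschitz: "\<bar>sqrt (a\<^sup>2 + c\<^sup>2) - sqrt (b\<^sup>2 + c\<^sup>2)\<bar> \<le> \<bar>a - b :: real\<bar>"
  \<comment> \<open>Reverse triangle inequality in the plane for the vectors (a, c) and (b,
    c).\<close>
  using norm_triangle_ineq3[of "Complex a c" "Complex b c"]
  by (simp add: cmod_def)

text \<open>The regularisation \<open>h \<epsilon>\<close> is smooth, 1-Lipschitz and 0 at 0, so it
  maps test functions to test functions. The limit in the approximants is taken at fixed \<epsilon>,
  the limit in \<epsilon> afterwards; on {u = 0} the derivative \<open>h' \<epsilon>\<close> is 0,
  in agreement with \<open>sgn 0 = 0\<close>.\<close>

lemma D12_abs:
  fixes u :: "real^'n \<Rightarrow> real"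
  assumes D: "has_D12_gradient u G" and N: "3 \<le> CARD('n)"
  shows "has_D12_gradient (\<lambda>x. \<bar>u x\<bar>) (\<lambda>x. sgn (u x) *\<^sub>R G x)"
proof -
  define p where "p = sobolev_exp CARD('n)"
  have p: "p > 2" unfolding p_def by (rule sobolev_exp_gt_2[OF N])
  note [measurable] = D12_measurable[OF D]
  note uG = D12_in_Lq[OF D N, folded p_def]
  obtain \<phi> where \<phi>: "\<And>m. test_fun (\<phi> m)" "(\<lambda>m::nat. Lq_dist 2 (grad (\<phi> m)) G) \<longlonglongrightarrow> 0"
      "(\<lambda>m. Lq_dist p (\<phi> m) u) \<longlonglongrightarrow> 0" "AE x in lebesgue. (\<lambda>m. \<phi> m x) \<longlonglongrightarrow> u x"
    unfolding p_def by (rule D12_approx_AE[OF D N]) blast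
  have [measurable]: "\<phi> m \<in> borel_measurable lebesgue" "grad (\<phi> m) \<in> borel_measurable lebesgue" for m
    using \<phi>(1) by auto
  define h where "h \<epsilon> t = sqrt (t\<^sup>2 + \<epsilon>\<^sup>2) - \<epsilon>" for \<epsilon> t :: real
  define h' where "h' \<epsilon> t = t / sqrt (t\<^sup>2 + \<epsilon>\<^sup>2)" for \<epsilon> t :: real
  have h'1: "\<bar>h' \<epsilon> t\<bar> \<le> 1" for \<epsilon> t
  proof -
    define q where "q = sqrt (t\<^sup>2 + \<epsilon>\<^sup>2)"
    have "\<bar>t\<bar> \<le> q" unfolding q_def by (rule real_le_rsqrt) simp
    then show ?thesis unfolding h'_def q_def[symmetric] by (cases "q = 0") (auto simp: divide_le_eq_1)
  qed
  have reg: "has_D12_gradient (\<lambda>x. h \<epsilon> (u x)) (\<lambda>x. h' \<epsilon> (u x) *\<^sub>R G x)" if \<epsilon>: "\<epsilon> > 0" for \<epsilon>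
  proof (rule D12_closed[OF _ N, of "\<lambda>m x. h \<epsilon> (\<phi> m x)" "\<lambda>m x. h' \<epsilon> (\<phi> m x) *\<^sub>R grad (\<phi> m) x"])
    fix m
    have pos: "t\<^sup>2 + \<epsilon>\<^sup>2 > 0" for t using \<epsilon> by (simp add: add_nonneg_pos)
    have "test_fun (\<lambda>x. h \<epsilon> (\<phi> m x))"
    proof (rule test_funI[OF _ \<phi>(1)[of m]])
      have "smooth (\<lambda>x. ((\<phi> m x)\<^sup>2 + \<epsilon>\<^sup>2) powr (1/2) + (- \<epsilon>))"
        by (intro smooth_add smooth_powr smooth_power smooth_const test_fun_smooth \<phi>(1) pos)
      then show "smooth (\<lambda>x. h \<epsilon> (\<phi> m x))"
        using pos by (simp add: h_def powr_half_sqrt less_imp_le)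
      show "\<phi> m x = 0 \<Longrightarrow> h \<epsilon> (\<phi> m x) = 0" for x using \<epsilon> by (simp add: h_def)
    qed
    moreover have "grad (\<lambda>x. h \<epsilon> (\<phi> m x)) = (\<lambda>x. h' \<epsilon> (\<phi> m x) *\<^sub>R grad (\<phi> m) x)"
    proof (rule ext, rule grad_compose[OF test_fun_smooth[OF \<phi>(1)]])
      show "(h \<epsilon> has_real_derivative h' \<epsilon> t) (at t)" for t
        unfolding h_def[abs_def] h'_def using pos[of t]
        by (auto intro!: derivative_eq_intros simp: field_simps)
    qed
    ultimately show "has_D12_gradient (\<lambda>x. h \<epsilon> (\<phi> m x)) (\<lambda>x. h' \<epsilon> (\<phi> m x) *\<^sub>R grad (\<phi> m) x)"
      using D12_test_fun by metis
  next
    show "(\<lambda>x. h \<epsilon> (u x)) \<in> borel_measurable lebesgue" unfolding h_def by measurable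
    show "(\<lambda>x. h' \<epsilon> (u x) *\<^sub>R G x) \<in> borel_measurable lebesgue" unfolding h'_def by measurable
    have [measurable]: "(\<lambda>x. h' \<epsilon> (f x)) \<in> borel_measurable lebesgue" if [measurable]: "f \<in> borel_measurable lebesgue" for f
      unfolding h'_def by measurable
    show "(\<lambda>m. Lq_dist 2 (\<lambda>x. h' \<epsilon> (\<phi> m x) *\<^sub>R grad (\<phi> m) x) (\<lambda>x. h' \<epsilon> (u x) *\<^sub>R G x)) \<longlonglongrightarrow> 0"
    \<comment> \<open>The gradient is exchanged first, under a coefficient bounded by 1; then the
      coefficient, which converges only almost everywhere, under the fixed majorant
      \<open>2 *\<^sub>R G x\<close>.\<close>
    proof (rule Lq_tendsto_trans[where g="\<lambda>m x. h' \<epsilon> (\<phi> m x) *\<^sub>R G x"])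
      show "(\<lambda>m. Lq_dist 2 (\<lambda>x. h' \<epsilon> (\<phi> m x) *\<^sub>R grad (\<phi> m) x) (\<lambda>x. h' \<epsilon> (\<phi> m x) *\<^sub>R G x)) \<longlonglongrightarrow> 0"
      proof (rule Lq_tendsto_scale[OF _ _ _ _ _ \<phi>(2), where c=1])
        show "norm (h' \<epsilon> (\<phi> m x) *\<^sub>R grad (\<phi> m) x - h' \<epsilon> (\<phi> m x) *\<^sub>R G x) \<le> 1 * norm (grad (\<phi> m) x - G x)" for m x
          unfolding scaleR_diff_right[symmetric] norm_scaleR by (rule mult_right_mono[OF h'1]) simp
      qed auto
      show "(\<lambda>m. Lq_dist 2 (\<lambda>x. h' \<epsilon> (\<phi> m x) *\<^sub>R G x) (\<lambda>x. h' \<epsilon> (u x) *\<^sub>R G x)) \<longlonglongrightarrow> 0"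
      proof (rule Lq_dominated[where w="\<lambda>x. 2 *\<^sub>R G x"])
        show "AE x in lebesgue. (\<lambda>m. h' \<epsilon> (\<phi> m x) *\<^sub>R G x) \<longlonglongrightarrow> h' \<epsilon> (u x) *\<^sub>R G x"
          using \<phi>(4)
        proof eventually_elim
          case (elim x)
          have "sqrt ((u x)\<^sup>2 + \<epsilon>\<^sup>2) \<noteq> 0" using \<epsilon> by (simp add: sum_power2_eq_zero_iff)
          then show ?case unfolding h'_def by (intro tendsto_intros elim)
        qed
        have "norm (h' \<epsilon> (\<phi> m x) *\<^sub>R G x - h' \<epsilon> (u x) *\<^sub>R G x) \<le> norm (2 *\<^sub>R G x)" for m x
        proof -
          have "\<bar>h' \<epsilon> (\<phi> m x) - h' \<epsilon> (u x)\<bar> \<le> 2" using h'1[of \<epsilon> "\<phi> m x"] h'1[of \<epsilon> "u x"] by linarith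
          then show ?thesis unfolding scaleR_diff_left[symmetric] norm_scaleR by (intro mult_right_mono) auto
        qed
        then show "AE x in lebesgue. norm (h' \<epsilon> (\<phi> m x) *\<^sub>R G x - h' \<epsilon> (u x) *\<^sub>R G x) \<le> norm (2 *\<^sub>R G x)" for m by simp
        show "in_Lq 2 (\<lambda>x. 2 *\<^sub>R G x)" by (rule in_Lq_mono[OF uG(2), where c=2]) auto
      qed auto
    qed auto
    show "(\<lambda>m. Lq_dist (sobolev_exp CARD('n)) (\<lambda>x. h \<epsilon> (\<phi> m x)) (\<lambda>x. h \<epsilon> (u x))) \<longlonglongrightarrow> 0"
      unfolding p_def[symmetric]
      by (rule Lq_tendsto_scale[OF _ _ _ _ _ \<phi>(3), where c=1])
         (use sqrt_add_sq_Lipschitz p in \<open>auto simp: h_def\<close>)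
  qed
  define \<epsilon> where "\<epsilon> m = 1 / real (Suc m)" for m
  have \<epsilon>: "\<epsilon> m > 0" for m by (simp add: \<epsilon>_def)
  have \<epsilon>0: "\<epsilon> \<longlonglongrightarrow> 0" unfolding \<epsilon>_def using LIMSEQ_inverse_real_of_nat by (simp add: inverse_eq_divide)
  show ?thesis
  proof (rule D12_closed[OF reg[OF \<epsilon>] N])
    show "(\<lambda>m. Lq_dist 2 (\<lambda>x. h' (\<epsilon> m) (u x) *\<^sub>R G x) (\<lambda>x. sgn (u x) *\<^sub>R G x)) \<longlonglongrightarrow> 0"
    proof (rule Lq_dominated[where w="\<lambda>x. 2 *\<^sub>R G x"])
      have "(\<lambda>m. h' (\<epsilon> m) t) \<longlonglongrightarrow> sgn t" for t
      proof (cases "t = 0")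
        case False
        have "(\<lambda>m. h' (\<epsilon> m) t) \<longlonglongrightarrow> t / sqrt (t\<^sup>2 + 0\<^sup>2)"
          unfolding h'_def using False by (intro tendsto_intros \<epsilon>0) auto
        then show ?thesis using False by (simp add: sgn_div_norm real_norm_def divide_inverse mult.commute sgn_real_def abs_if split: if_splits)
      qed (simp add: h'_def)
      then show "AE x in lebesgue. (\<lambda>m. h' (\<epsilon> m) (u x) *\<^sub>R G x) \<longlonglongrightarrow> sgn (u x) *\<^sub>R G x"
        by (intro AE_I2 tendsto_scaleR tendsto_const)
      have "norm (h' (\<epsilon> m) (u x) *\<^sub>R G x - sgn (u x) *\<^sub>R G x) \<le> norm (2 *\<^sub>R G x)" for m x
      proof -
        have "\<bar>h' (\<epsilon> m) (u x) - sgn (u x)\<bar> \<le> 2" using h'1[of "\<epsilon> m" "u x"] by (auto simp: sgn_real_def)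
        then show ?thesis unfolding scaleR_diff_left[symmetric] norm_scaleR by (intro mult_right_mono) auto
      qed
      then show "AE x in lebesgue. norm (h' (\<epsilon> m) (u x) *\<^sub>R G x - sgn (u x) *\<^sub>R G x) \<le> norm (2 *\<^sub>R G x)" for m by simp
      show "in_Lq 2 (\<lambda>x. 2 *\<^sub>R G x)" by (rule in_Lq_mono[OF uG(2), where c=2]) auto
    qed (auto simp: h'_def)
    show "(\<lambda>m. Lq_dist (sobolev_exp CARD('n)) (\<lambda>x. h (\<epsilon> m) (u x)) (\<lambda>x. \<bar>u x\<bar>)) \<longlonglongrightarrow> 0"
      unfolding p_def[symmetric]
    proof (rule Lq_dominated[where w=u])
      have "(\<lambda>m. h (\<epsilon> m) t) \<longlonglongrightarrow> sqrt (t\<^sup>2 + 0\<^sup>2) - 0" for t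
        unfolding h_def by (intro tendsto_intros \<epsilon>0)
      then show "AE x in lebesgue. (\<lambda>m. h (\<epsilon> m) (u x)) \<longlonglongrightarrow> \<bar>u x\<bar>" by simp
      have "norm (h (\<epsilon> m) t - \<bar>t\<bar>) \<le> norm t" for m t
      proof -
        have "sqrt (t\<^sup>2 + (\<epsilon> m)\<^sup>2) \<le> \<bar>t\<bar> + \<bar>\<epsilon> m\<bar>" by (rule sqrt_sum_squares_le_sum_abs)
        moreover have "\<epsilon> m \<le> sqrt (t\<^sup>2 + (\<epsilon> m)\<^sup>2)" by (rule real_le_rsqrt) simp
        ultimately show ?thesis using \<epsilon>[of m] by (simp add: h_def)
      qed
      then show "AE x in lebesgue. norm (h (\<epsilon> m) (u x) - \<bar>u x\<bar>) \<le> norm (u x)" for m by simp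
    qed (use p uG in \<open>auto simp: h_def\<close>)
  qed auto
qed

text \<open>Half of u + \<bar>u\<bar> comes with the gradient G/2 on {u = 0}. Taking the absolute
  value once more does not change this nonnegative function, but multiplies its gradient by the sign
  of the positive part and so makes it vanish on {u = 0}.\<close>

lemma D12_pos:
  fixes u :: "real^'n \<Rightarrow> real"
  assumes D: "has_D12_gradient u G" and N: "3 \<le> CARD('n)"
  shows "has_D12_gradient (\<lambda>x. max 0 (u x)) (\<lambda>x. if u x > 0 then G x else 0)"
proof -
  have "has_D12_gradient (\<lambda>x. (1/2) * (u x + \<bar>u x\<bar>)) (\<lambda>x. (1/2) *\<^sub>R (G x + sgn (u x) *\<^sub>R G x))"
    by (intro D12_cmult D12_add D12_abs D N)
  note 1 = D12_abs[OF this N]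
  have 2: "(\<lambda>x. \<bar>(1/2) * (u x + \<bar>u x\<bar>)\<bar>) = (\<lambda>x. max 0 (u x))" by (auto simp: fun_eq_iff)
  have 3: "(\<lambda>x. sgn ((1/2) * (u x + \<bar>u x\<bar>)) *\<^sub>R (1/2) *\<^sub>R (G x + sgn (u x) *\<^sub>R G x)) =
      (\<lambda>x. if u x > 0 then G x else 0)"
  proof
    fix x show "sgn ((1/2) * (u x + \<bar>u x\<bar>)) *\<^sub>R (1/2) *\<^sub>R (G x + sgn (u x) *\<^sub>R G x) =
      (if u x > 0 then G x else 0)"
      by (cases "u x > 0") (simp_all add: scaleR_half_double)
  qed
  show ?thesis using 1 unfolding 2 3 .
qed

text \<open>Positive and negative part both have gradients that vanish where u = 0; uniqueness of
  the gradient transfers this to \<open>G\<close>.\<close>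

lemma D12_gradient_zero_level:
  fixes u :: "real^'n \<Rightarrow> real"
  assumes D: "has_D12_gradient u G" and N: "3 \<le> CARD('n)"
  shows "AE x in lebesgue. u x = 0 \<longrightarrow> G x = 0"
proof -
  have "has_D12_gradient (\<lambda>x. max 0 (u x) - max 0 (-1 * u x))
     (\<lambda>x. (if u x > 0 then G x else 0) - (if -1 * u x > 0 then -1 *\<^sub>R G x else 0))"
    by (intro D12_diff D12_pos D12_cmult D N)
  also have "(\<lambda>x. max 0 (u x) - max 0 (-1 * u x)) = u" by (auto simp: max_def)
  finally have "has_D12_gradient u (\<lambda>x. (if u x > 0 then G x else 0) - (if -1 * u x > 0 then -1 *\<^sub>R G x else 0))" .
  from D12_gradient_unique[OF D this N] show ?thesis by eventually_elim auto
qed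

section \<open>Zero extension from a half-space\<close>

lemma pred_halfspace [measurable]:
  "Measurable.pred lebesgue (\<lambda>x::real^'n. \<mu> < x \<bullet> e)"
  by (intro measurable_completion) measurable

lemma AE_not_hyperplane:
  fixes e :: "real^'n"
  assumes "norm e = 1"
  shows "AE x in lebesgue. x \<bullet> e \<noteq> \<mu>"
proof -
  have "negligible {x. e \<bullet> x = \<mu>}" by (rule negligible_hyperplane) (use assms in auto)
  then have "{x. e \<bullet> x = \<mu>} \<in> null_sets lebesgue" by (simp add: negligible_iff_null_sets)
  then show ?thesis by (rule AE_I') (auto simp: inner_commute)
qed

text \<open>A smooth step of width \<open>\<delta> m\<close> across the hyperplane has derivative of
  order 1/\<delta>, but \<phi> vanishes on the hyperplane and is therefore at most L\<bar>t\<bar> at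
  distance \<bar>t\<bar>. As \<open>\<bar>s\<bar> * h' m s\<close> is bounded independently of
  \<delta>, dominated convergence removes the transition layer.\<close>

lemma D12_halfspace_test_fun:
  fixes \<phi> :: "real^'n \<Rightarrow> real"
  assumes \<phi>: "test_fun \<phi>" and e: "norm e = 1" and zero: "\<And>x. x \<bullet> e = \<mu> \<Longrightarrow> \<phi> x = 0"
    and N: "3 \<le> CARD('n)"
  shows "has_D12_gradient (\<lambda>x. if \<mu> < x \<bullet> e then \<phi> x else 0) (\<lambda>x. if \<mu> < x \<bullet> e then grad \<phi> x else 0)"
proof -
  define p where "p = sobolev_exp CARD('n)"
  have p: "p > 2" unfolding p_def by (rule sobolev_exp_gt_2[OF N])
  have sm: "smooth \<phi>" by (rule test_fun_smooth[OF \<phi>])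
  have [measurable]: "\<phi> \<in> borel_measurable lebesgue" "grad \<phi> \<in> borel_measurable lebesgue"
    using \<phi> by auto
  have [measurable]: "(\<lambda>x::real^'n. x \<bullet> e) \<in> borel_measurable lebesgue" by (intro measurable_completion) auto
  obtain L where L: "L > 0" "\<And>x y. \<bar>\<phi> x - \<phi> y\<bar> \<le> L * norm (x - y)" by (rule test_fun_Lipschitz[OF \<phi>]) blast
  obtain K where K: "K > 0" "\<And>x. norm x > K \<Longrightarrow> \<phi> x = 0" by (rule test_fun_support[OF \<phi>]) blast
  define t where "t x = x \<bullet> e - \<mu>" for x
  have [measurable]: "t \<in> borel_measurable lebesgue" unfolding t_def[abs_def] by measurable
  have \<phi>t: "\<bar>\<phi> x\<bar> \<le> L * \<bar>t x\<bar>" for x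
  proof -
    have "(x - t x *\<^sub>R e) \<bullet> e = \<mu>" using e by (simp add: t_def inner_diff_left dot_square_norm)
    then have "\<phi> (x - t x *\<^sub>R e) = 0" by (rule zero)
    with L(2)[of x "x - t x *\<^sub>R e"] e show ?thesis by simp
  qed
  define \<delta> where "\<delta> m = 1 / real (Suc m)" for m
  have \<delta>: "\<delta> m > 0" for m by (simp add: \<delta>_def)
  have \<delta>0: "\<delta> \<longlonglongrightarrow> 0" unfolding \<delta>_def using LIMSEQ_inverse_real_of_nat by (simp add: inverse_eq_divide)
  \<comment> \<open>An algebraic step function from 0 to 1, with derivative \<open>h'\<close>; its
    smoothness reduces to that of powers of a positive function.\<close>
  define h where "h m s = (1 + s * inverse (sqrt (s\<^sup>2 + (\<delta> m)\<^sup>2))) / 2" for m and s :: real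
  define h' where "h' m s = ((\<delta> m)\<^sup>2 * inverse (sqrt (s\<^sup>2 + (\<delta> m)\<^sup>2) ^ 3)) / 2" for m and s :: real
  have pos: "s\<^sup>2 + (\<delta> m)\<^sup>2 > 0" for m s using \<delta>[of m] by (simp add: add_nonneg_pos)
  have Dh: "(h m has_real_derivative h' m s) (at s)" for m s
  proof -
    define q where "q = sqrt (s\<^sup>2 + (\<delta> m)\<^sup>2)"
    have q: "q > 0" "q\<^sup>2 = s\<^sup>2 + (\<delta> m)\<^sup>2" using pos[of s m] by (simp_all add: q_def)
    have "((\<lambda>s. sqrt (s\<^sup>2 + (\<delta> m)\<^sup>2)) has_real_derivative s / q) (at s)"
      unfolding q_def using pos[of s m] by (auto intro!: derivative_eq_intros simp: field_simps)
    from DERIV_inverse'[OF this]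
    have "((\<lambda>s. inverse (sqrt (s\<^sup>2 + (\<delta> m)\<^sup>2))) has_real_derivative - (inverse q * (s / q) * inverse q)) (at s)"
      using q(1) \<delta>[of m] by (simp add: q_def)
    from DERIV_cdivide[OF DERIV_add[OF DERIV_const[of 1] DERIV_mult[OF DERIV_ident this]], of 2]
    have "(h m has_real_derivative (inverse q - inverse q * (s / q) * inverse q * s) / 2) (at s)"
      by (simp add: h_def[abs_def] q_def)
    also have "(inverse q - inverse q * (s / q) * inverse q * s) / 2 = ((q\<^sup>2 - s\<^sup>2) * inverse (q ^ 3)) / 2"
      using q(1) by (simp add: field_simps power2_eq_square power3_eq_cube)
    finally show ?thesis using q(2) by (simp add: h'_def q_def)
  qed
  have h01: "0 \<le> h m s" "h m s \<le> 1" for m s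
  proof -
    have "\<bar>s\<bar> \<le> sqrt (s\<^sup>2 + (\<delta> m)\<^sup>2)" by (rule real_le_rsqrt) simp
    then have "\<bar>s * inverse (sqrt (s\<^sup>2 + (\<delta> m)\<^sup>2))\<bar> \<le> 1"
      using pos[of s m] by (simp add: abs_mult field_simps)
    then show "0 \<le> h m s" "h m s \<le> 1" unfolding h_def by (simp_all add: abs_le_iff)
  qed
  have h'b: "0 \<le> h' m s" "\<bar>s\<bar> * h' m s \<le> 1" for m s
  proof -
    define q where "q = sqrt (s\<^sup>2 + (\<delta> m)\<^sup>2)"
    have q: "q > 0" "q\<^sup>2 = s\<^sup>2 + (\<delta> m)\<^sup>2" using pos[of s m] by (simp_all add: q_def)
    have sq: "\<bar>s\<bar> \<le> q" unfolding q_def by (rule real_le_rsqrt) simp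
    have dq: "(\<delta> m)\<^sup>2 \<le> q\<^sup>2" using q by simp
    have "\<bar>s\<bar> * (\<delta> m)\<^sup>2 \<le> q * q\<^sup>2" using sq dq q by (intro mult_mono) auto
    also have "\<dots> \<le> 2 * q ^ 3" using q by (simp add: power3_eq_cube power2_eq_square)
    finally show "\<bar>s\<bar> * h' m s \<le> 1" unfolding h'_def q_def[symmetric] using q by (simp add: field_simps)
    show "0 \<le> h' m s" unfolding h'_def q_def[symmetric] using q by simp
  qed
  have hlim: "(\<lambda>m. h m s) \<longlonglongrightarrow> (if 0 < s then 1 else 0)" "(\<lambda>m. h' m s) \<longlonglongrightarrow> 0" if "s \<noteq> 0" for s
  proof -
    have s: "sqrt (s\<^sup>2 + 0\<^sup>2) \<noteq> 0" using that by simp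
    have "(\<lambda>m. h m s) \<longlonglongrightarrow> (1 + s * inverse (sqrt (s\<^sup>2 + 0\<^sup>2))) / 2"
      unfolding h_def by (intro tendsto_intros \<delta>0 s) simp
    then show "(\<lambda>m. h m s) \<longlonglongrightarrow> (if 0 < s then 1 else 0)" using that by (simp add: abs_if split: if_splits)
    have "(\<lambda>m. h' m s) \<longlonglongrightarrow> (0\<^sup>2 * inverse (sqrt (s\<^sup>2 + 0\<^sup>2) ^ 3)) / 2"
      unfolding h'_def using s by (intro tendsto_intros \<delta>0) auto
    then show "(\<lambda>m. h' m s) \<longlonglongrightarrow> 0" by simp
  qed
  define \<psi> where "\<psi> m x = \<phi> x * h m (t x)" for m x
  define \<Psi> where "\<Psi> m x = \<phi> x *\<^sub>R (h' m (t x) *\<^sub>R e) + h m (t x) *\<^sub>R grad \<phi> x" for m x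
  have [measurable]: "h m \<in> borel_measurable borel" "h' m \<in> borel_measurable borel" for m
    unfolding h_def[abs_def] h'_def[abs_def] by measurable
  have D\<psi>: "has_D12_gradient (\<psi> m) (\<Psi> m)" for m
  proof -
    have smt: "smooth t"
    proof -
      have "smooth (\<lambda>x. x \<bullet> e + (- \<mu>))" by (intro smooth_add smooth_inner smooth_const)
      then show ?thesis by (simp add: t_def[abs_def])
    qed
    have "smooth (\<lambda>x. (1 + t x * ((t x)\<^sup>2 + (\<delta> m)\<^sup>2) powr (- 1/2)) * (1/2))"
      by (intro smooth_mult smooth_add smooth_const smt smooth_powr smooth_power pos)
    also have "(\<lambda>x. (1 + t x * ((t x)\<^sup>2 + (\<delta> m)\<^sup>2) powr (- 1/2)) * (1/2)) = (\<lambda>x. h m (t x))"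
      using pos by (auto simp: h_def powr_minus powr_half_sqrt less_imp_le fun_eq_iff)
    finally have smh: "smooth (\<lambda>x. h m (t x))" .
    have "grad t x = e" for x
      by (rule grad_eqI) (unfold t_def, auto intro!: derivative_eq_intros)
    then have gh: "grad (\<lambda>x. h m (t x)) x = h' m (t x) *\<^sub>R e" for x
      using grad_compose[OF smt Dh] by simp
    have "grad (\<psi> m) = \<Psi> m"
      unfolding \<psi>_def[abs_def] \<Psi>_def[abs_def] by (rule ext) (simp add: grad_mult[OF sm smh] gh)
    moreover have "test_fun (\<psi> m)" unfolding \<psi>_def[abs_def] by (rule test_fun_mult[OF \<phi> smh])
    ultimately show ?thesis using D12_test_fun by metis
  qed
  have AEt: "AE x in lebesgue. t x \<noteq> 0" using AE_not_hyperplane[OF e, of \<mu>] by (simp add: t_def)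
  have te: "\<mu> < x \<bullet> e \<longleftrightarrow> 0 < t x" for x by (simp add: t_def)
  show ?thesis unfolding te
  proof (rule D12_closed[OF D\<psi> N])
    show "(\<lambda>m. Lq_dist (sobolev_exp CARD('n)) (\<psi> m) (\<lambda>x. if 0 < t x then \<phi> x else 0)) \<longlonglongrightarrow> 0"
      unfolding p_def[symmetric]
    proof (rule Lq_dominated[where w=\<phi>])
      show "AE x in lebesgue. (\<lambda>m. \<psi> m x) \<longlonglongrightarrow> (if 0 < t x then \<phi> x else 0)"
        using AEt
      proof eventually_elim
        case (elim x)
        from tendsto_mult[OF tendsto_const[of "\<phi> x"] hlim(1)[OF elim]]
        show ?case by (simp add: \<psi>_def split: if_splits)
      qed
      have "norm (\<psi> m x - (if 0 < t x then \<phi> x else 0)) \<le> norm (\<phi> x)" for m x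
      proof -
        have "\<psi> m x - (if 0 < t x then \<phi> x else 0) = \<phi> x * (h m (t x) - (if 0 < t x then 1 else 0))"
          by (simp add: \<psi>_def algebra_simps)
        moreover have "\<bar>h m (t x) - (if 0 < t x then 1 else 0)\<bar> \<le> 1" using h01[of m "t x"] by auto
        ultimately show ?thesis by (simp add: abs_mult mult_left_le)
      qed
      then show "AE x in lebesgue. norm (\<psi> m x - (if 0 < t x then \<phi> x else 0)) \<le> norm (\<phi> x)" for m by simp
    qed (use p in_Lq_test_fun[OF \<phi>] in \<open>auto simp: \<psi>_def[abs_def]\<close>)
    \<comment> \<open>The first summand dominates the error in the coefficient of the gradient, the
      second the layer term, which lives on the support of \<phi>. The unit vector e below only
      makes the majorant vector valued.\<close>
    define w where "w x = norm (grad \<phi> x) + indicator (cball 0 K) x * L" for x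
    show "(\<lambda>m. Lq_dist 2 (\<Psi> m) (\<lambda>x. if 0 < t x then grad \<phi> x else 0)) \<longlonglongrightarrow> 0"
    proof (rule Lq_dominated[where w="\<lambda>x. w x *\<^sub>R e"])
      show "AE x in lebesgue. (\<lambda>m. \<Psi> m x) \<longlonglongrightarrow> (if 0 < t x then grad \<phi> x else 0)"
        using AEt
      proof eventually_elim
        case (elim x)
        have "(\<lambda>m. \<Psi> m x) \<longlonglongrightarrow> \<phi> x *\<^sub>R (0 *\<^sub>R e) + (if 0 < t x then 1 else 0) *\<^sub>R grad \<phi> x"
          unfolding \<Psi>_def by (intro tendsto_intros hlim elim)
        then show ?case by (simp split: if_splits)
      qed
      have "norm (\<Psi> m x - (if 0 < t x then grad \<phi> x else 0)) \<le> norm (w x *\<^sub>R e)" for m x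
      proof -
        have "\<Psi> m x - (if 0 < t x then grad \<phi> x else 0) =
            \<phi> x *\<^sub>R (h' m (t x) *\<^sub>R e) + (h m (t x) - (if 0 < t x then 1 else 0)) *\<^sub>R grad \<phi> x"
          by (simp add: \<Psi>_def algebra_simps)
        also have "norm \<dots> \<le> norm (\<phi> x *\<^sub>R (h' m (t x) *\<^sub>R e)) + norm ((h m (t x) - (if 0 < t x then 1 else 0)) *\<^sub>R grad \<phi> x)"
          by (rule norm_triangle_ineq)
        also have "norm (\<phi> x *\<^sub>R (h' m (t x) *\<^sub>R e)) = \<bar>\<phi> x\<bar> * h' m (t x)" using e h'b(1)[of m "t x"] by (simp add: abs_mult)
        also have "\<dots> \<le> indicator (cball 0 K) x * L"
        proof (cases "norm x > K")
          case False
          have "\<bar>\<phi> x\<bar> * h' m (t x) \<le> (L * \<bar>t x\<bar>) * h' m (t x)"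
            by (intro mult_right_mono \<phi>t h'b)
          also have "\<dots> = L * (\<bar>t x\<bar> * h' m (t x))" by simp
          also have "\<dots> \<le> L * 1" using L by (intro mult_left_mono h'b) auto
          finally show ?thesis using False by (simp add: indicator_def)
        qed (use K L in \<open>simp add: indicator_def\<close>)
        also have "norm ((h m (t x) - (if 0 < t x then 1 else 0)) *\<^sub>R grad \<phi> x) \<le> 1 * norm (grad \<phi> x)"
          unfolding norm_scaleR using h01[of m "t x"] by (intro mult_right_mono) auto
        also have "indicator (cball 0 K) x * L + 1 * norm (grad \<phi> x) = norm (w x *\<^sub>R e)"
          using e L by (simp add: w_def indicator_def)
        finally show ?thesis by simp
      qed
      then show "AE x in lebesgue. norm (\<Psi> m x - (if 0 < t x then grad \<phi> x else 0)) \<le> norm (w x *\<^sub>R e)" for m by simp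
      have "in_Lq 2 (\<lambda>x. norm (grad \<phi> x) *\<^sub>R e)"
        by (rule in_Lq_mono[OF in_Lq_test_fun(2)[OF \<phi>], where c=1]) (use e in auto)
      moreover have "in_Lq 2 (\<lambda>x::real^'n. (indicator (cball 0 K) x * L) *\<^sub>R e)"
        by (rule in_Lq_mono[OF in_Lq_indicator_cball[of 2 L K], where c=1])
           (use borel_measurable_scaleR[OF in_LqD[OF in_Lq_indicator_cball[of 2 L K]] borel_measurable_const[of e]] e
            in \<open>auto simp: mult.commute\<close>)
      ultimately show "in_Lq 2 (\<lambda>x. w x *\<^sub>R e)" unfolding w_def scaleR_add_left by (rule in_Lq_add) simp
      show "\<Psi> m \<in> borel_measurable lebesgue" for m unfolding \<Psi>_def[abs_def] by measurable
    qed auto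
  qed auto
qed

text \<open>A function minus its reflection vanishes on the mirror, so extension by zero creates no
  jump. The approximating test functions are antisymmetrised in the same way and then satisfy this
  condition exactly.\<close>

lemma D12_halfspace:
  fixes u :: "real^'n \<Rightarrow> real"
  assumes D: "has_D12_gradient u G" and e: "norm e = 1" and N: "3 \<le> CARD('n)"
  shows "has_D12_gradient (\<lambda>x. if \<mu> < x \<bullet> e then u x - u (refl_hyp e \<mu> x) else 0)
    (\<lambda>x. if \<mu> < x \<bullet> e then G x - refl_hyp e 0 (G (refl_hyp e \<mu> x)) else 0)"
proof -
  define p where "p = sobolev_exp CARD('n)"
  have p: "p > 2" unfolding p_def by (rule sobolev_exp_gt_2[OF N])
  obtain \<phi> where \<phi>: "\<And>m. test_fun (\<phi> m)" "(\<lambda>m::nat. Lq_dist 2 (grad (\<phi> m)) G) \<longlonglongrightarrow> 0"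
      "(\<lambda>m. Lq_dist p (\<phi> m) u) \<longlonglongrightarrow> 0"
    unfolding p_def by (rule D12_approx[OF D]) blast
  have [measurable]: "\<phi> m \<in> borel_measurable lebesgue" "grad (\<phi> m) \<in> borel_measurable lebesgue" for m
    using \<phi>(1) by auto
  note [measurable] = D12_measurable[OF D]
  have m1: "(\<lambda>x. f (refl_hyp e \<mu> x)) \<in> borel_measurable lebesgue" if "f \<in> borel_measurable lebesgue" for f :: "real^'n \<Rightarrow> real"
    by (rule measurable_comp_refl_hyp[OF e that])
  have m2: "(\<lambda>x. refl_hyp e 0 (F (refl_hyp e \<mu> x))) \<in> borel_measurable lebesgue" if "F \<in> borel_measurable lebesgue" for F :: "real^'n \<Rightarrow> real^'n"
    by (rule measurable_refl_hyp_comp, rule measurable_comp_refl_hyp[OF e that])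
  note [measurable] = m1[of u] m1[of "\<phi> _"] m2[of G] m2[of "grad (\<phi> _)"]
  define v where "v m x = \<phi> m x - \<phi> m (refl_hyp e \<mu> x)" for m x
  define V where "V m x = grad (\<phi> m) x - refl_hyp e 0 (grad (\<phi> m) (refl_hyp e \<mu> x))" for m x
  have sm: "smooth (\<phi> m)" for m by (rule test_fun_smooth[OF \<phi>(1)])
  have v_eq: "v m = (\<lambda>x. \<phi> m x + (-1) * \<phi> m (refl_hyp e \<mu> x))" for m by (simp add: v_def fun_eq_iff)
  have gV: "grad (v m) = V m" for m
  proof
    fix x
    have "grad (\<lambda>x. (-1) * \<phi> m (refl_hyp e \<mu> x)) x = (-1) *\<^sub>R refl_hyp e 0 (grad (\<phi> m) (refl_hyp e \<mu> x))"
      unfolding grad_refl[OF sm, symmetric]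
      by (rule grad_compose[OF smooth_refl[OF sm]]) (auto intro!: derivative_eq_intros)
    then show "grad (v m) x = V m x"
      unfolding v_eq V_def by (subst grad_add[OF sm smooth_mult[OF smooth_const smooth_refl[OF sm]]]) simp
  qed
  have vt: "test_fun (v m)" for m
    unfolding v_eq by (intro test_fun_add test_fun_cmult test_fun_refl e \<phi>(1))
  have Dv: "has_D12_gradient (\<lambda>x. if \<mu> < x \<bullet> e then v m x else 0) (\<lambda>x. if \<mu> < x \<bullet> e then V m x else 0)" for m
    unfolding gV[symmetric]
    by (rule D12_halfspace_test_fun[OF vt e _ N]) (simp add: v_def refl_hyp_def)
  show ?thesis
  proof (rule D12_closed[OF Dv N])
    have "(\<lambda>m. Lq_dist 2 (\<lambda>x. grad (\<phi> m) x + - refl_hyp e 0 (grad (\<phi> m) (refl_hyp e \<mu> x)))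
        (\<lambda>x. G x + - refl_hyp e 0 (G (refl_hyp e \<mu> x)))) \<longlonglongrightarrow> 0"
    proof (rule Lq_tendsto_add[OF _ _ _ _ _ \<phi>(2)])
      have "Lq_dist 2 (\<lambda>x. - refl_hyp e 0 (grad (\<phi> m) (refl_hyp e \<mu> x))) (\<lambda>x. - refl_hyp e 0 (G (refl_hyp e \<mu> x)))
         = Lq_dist 2 (\<lambda>x. grad (\<phi> m) (refl_hyp e \<mu> x)) (\<lambda>x. G (refl_hyp e \<mu> x))" for m
        unfolding Lq_dist_def using e by (simp add: norm_minus_commute refl_hyp_diff)
      then show "(\<lambda>m. Lq_dist 2 (\<lambda>x. - refl_hyp e 0 (grad (\<phi> m) (refl_hyp e \<mu> x))) (\<lambda>x. - refl_hyp e 0 (G (refl_hyp e \<mu> x)))) \<longlonglongrightarrow> 0"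
        using \<phi>(2) by (simp add: Lq_dist_refl_hyp[OF e])
    qed auto
    then have 1: "(\<lambda>m. Lq_dist 2 (V m) (\<lambda>x. G x - refl_hyp e 0 (G (refl_hyp e \<mu> x)))) \<longlonglongrightarrow> 0"
      by (simp add: V_def[abs_def])
    show "(\<lambda>m. Lq_dist 2 (\<lambda>x. if \<mu> < x \<bullet> e then V m x else 0)
        (\<lambda>x. if \<mu> < x \<bullet> e then G x - refl_hyp e 0 (G (refl_hyp e \<mu> x)) else 0)) \<longlonglongrightarrow> 0"
      by (rule Lq_tendsto_scale[OF _ _ _ _ _ 1, where c=1]) (auto simp: V_def[abs_def])
    have "(\<lambda>m. Lq_dist p (\<lambda>x. \<phi> m x + - \<phi> m (refl_hyp e \<mu> x)) (\<lambda>x. u x + - u (refl_hyp e \<mu> x))) \<longlonglongrightarrow> 0"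
    proof (rule Lq_tendsto_add[OF _ _ _ _ _ \<phi>(3)])
      have "Lq_dist p (\<lambda>x. - \<phi> m (refl_hyp e \<mu> x)) (\<lambda>x. - u (refl_hyp e \<mu> x))
         = Lq_dist p (\<lambda>x. \<phi> m (refl_hyp e \<mu> x)) (\<lambda>x. u (refl_hyp e \<mu> x))" for m
        unfolding Lq_dist_def by (simp add: abs_minus_commute)
      then show "(\<lambda>m. Lq_dist p (\<lambda>x. - \<phi> m (refl_hyp e \<mu> x)) (\<lambda>x. - u (refl_hyp e \<mu> x))) \<longlonglongrightarrow> 0"
        using \<phi>(3) by (simp add: Lq_dist_refl_hyp[OF e])
    qed (use p in auto)
    then have 2: "(\<lambda>m. Lq_dist p (v m) (\<lambda>x. u x - u (refl_hyp e \<mu> x))) \<longlonglongrightarrow> 0"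
      by (simp add: v_def[abs_def])
    show "(\<lambda>m. Lq_dist (sobolev_exp CARD('n)) (\<lambda>x. if \<mu> < x \<bullet> e then v m x else 0)
        (\<lambda>x. if \<mu> < x \<bullet> e then u x - u (refl_hyp e \<mu> x) else 0)) \<longlonglongrightarrow> 0"
      unfolding p_def[symmetric]
      by (rule Lq_tendsto_scale[OF _ _ _ _ _ 2, where c=1]) (use p in \<open>auto simp: v_def[abs_def]\<close>)
  qed auto
qed

section \<open>The elliptic system\<close>

text \<open>Mean value theorem; s \<ge> 1 makes the derivative increasing, so its value at the
  larger point bounds it. The case y = 0 is included because only continuity is used at y.\<close>

lemma powr_diff_le:
  fixes x y s :: real
  assumes "1 \<le> s" "0 \<le> y" "y \<le> x"
  shows "x powr s - y powr s \<le> s * x powr (s - 1) * (x - y)"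
proof (cases "y = x")
  case False
  with assms have yx: "y < x" by simp
  have cont: "continuous_on {y..x} (\<lambda>z. z powr s)"
    using assms by (intro continuous_on_powr' continuous_intros) auto
  have der: "((\<lambda>z. z powr s) has_real_derivative s * z powr (s - 1)) (at z)" if "y < z" for z
    using that assms by (auto intro!: derivative_eq_intros)
  obtain l z where z: "y < z" "z < x" "((\<lambda>z. z powr s) has_real_derivative l) (at z)"
      "x powr s - y powr s = (x - y) * l"
    using MVT[OF yx cont] der real_differentiable_def by blast
  have "l = s * z powr (s - 1)" using DERIV_unique[OF z(3) der[OF z(1)]] .
  moreover have "z powr (s - 1) \<le> x powr (s - 1)" using z assms by (intro powr_mono2) auto
  ultimately have "l \<le> s * x powr (s - 1)" using assms by simp
  then have "(x - y) * l \<le> (x - y) * (s * x powr (s - 1))" using yx by (intro mult_left_mono) auto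
  then show ?thesis using z(4) by (simp add: mult.commute)
qed simp

lemma powr_diff_le':
  fixes x y s M V :: real
  assumes "1 \<le> s" "0 \<le> y" "y \<le> x" "x \<le> M" "x - y \<le> V"
  shows "x powr s - y powr s \<le> s * M powr (s - 1) * V"
proof -
  have "x powr s - y powr s \<le> s * x powr (s - 1) * (x - y)" by (rule powr_diff_le) (use assms in auto)
  also have "\<dots> \<le> s * M powr (s - 1) * V"
    using assms by (intro mult_mono powr_mono2) auto
  finally show ?thesis .
qed

text \<open>The primed values need not lie below the others. Replacing them by minima decreases the
  subtracted product, and the telescoped difference is then covered by the mean value estimate. With
  exponents at least 1, only the upper bound M enters.\<close>

lemma powr_mult_diff_le:
  fixes a b a' b' s t M V :: real
  assumes st: "1 \<le> s" "1 \<le> t" and nn: "0 \<le> a" "0 \<le> b" "0 \<le> a'" "0 \<le> b'"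
    and M: "a \<le> M" "b \<le> M" and V: "a - a' \<le> V" "b - b' \<le> V" "0 \<le> V"
  shows "a powr s * b powr t - a' powr s * b' powr t \<le> (s + t) * M powr (s + t - 1) * V"
proof -
  define x where "x = min a a'"
  define y where "y = min b b'"
  have xy: "0 \<le> x" "x \<le> a" "x \<le> a'" "0 \<le> y" "y \<le> b" "y \<le> b'" "a - x \<le> V" "b - y \<le> V"
    using nn V by (auto simp: x_def y_def)
  have "x powr s * y powr t \<le> a' powr s * b' powr t"
    using xy st by (intro mult_mono powr_mono2) auto
  then have "a powr s * b powr t - a' powr s * b' powr t \<le> a powr s * (b powr t - y powr t) + (a powr s - x powr s) * y powr t"
    by (simp add: algebra_simps)
  also have "\<dots> \<le> M powr s * (t * M powr (t - 1) * V) + (s * M powr (s - 1) * V) * M powr t"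
  proof (intro add_mono mult_mono powr_diff_le')
    show "0 \<le> b powr t - y powr t" using xy st by (simp add: powr_mono2)
  qed (use xy st nn M V in \<open>auto intro!: powr_mono2\<close>)
  also have "\<dots> = (s + t) * M powr (s + t - 1) * V"
  proof -
    have "M powr s * M powr (t - 1) = M powr (s + t - 1)" by (simp add: powr_add[symmetric] algebra_simps)
    moreover have "M powr (s - 1) * M powr t = M powr (s + t - 1)" by (simp add: powr_add[symmetric] algebra_simps)
    ultimately show ?thesis by (simp add: algebra_simps)
  qed
  finally show ?thesis .
qed

lemma in_Lq_mono_AE:
  assumes "in_Lq q f" "g \<in> borel_measurable lebesgue" "AE x in lebesgue. norm (g x) \<le> c * norm (f x)" "c \<ge> 0" "q \<ge> 0"
  shows "in_Lq q g"
proof -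
  note [measurable] = in_LqD[OF assms(1)]
  have "(\<integral>\<^sup>+x. ennreal (norm (g x) powr q) \<partial>lebesgue) \<le> (\<integral>\<^sup>+x. ennreal (norm (c *\<^sub>R f x) powr q) \<partial>lebesgue)"
    by (rule nn_integral_mono_AE) (use assms(3) in eventually_elim, use assms in \<open>auto intro!: ennreal_leI powr_mono2\<close>)
  moreover have "in_Lq q (\<lambda>x. c *\<^sub>R f x)" by (rule in_Lq_mono[OF assms(1), where c=c]) (use assms in auto)
  ultimately show ?thesis using assms(2) by (auto simp: in_Lq_def elim: order_le_less_trans)
qed

lemma AE_not_zero: "AE x in lebesgue. x \<noteq> (0::real^'n)"
  by (rule AE_I'[of "{0}"]) (auto simp: null_sets_def)

locale positive_system =
  fixes r :: nat and lam :: "nat \<Rightarrow> real" and \<alpha> \<beta> :: "nat \<Rightarrow> nat \<Rightarrow> real"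
    and u :: "nat \<Rightarrow> real^'n \<Rightarrow> real"
  assumes N: "3 \<le> CARD('n)"
    and lam: "\<And>j. j \<in> {1..r} \<Longrightarrow> 0 < lam j \<and> lam j < hardy_const CARD('n)"
    and coeffs: "\<And>j k. j \<in> {1..r} \<Longrightarrow> k \<in> {1..r} \<Longrightarrow> k \<noteq> j \<Longrightarrow>
           \<alpha> j k + \<alpha> k j = sobolev_exp CARD('n) \<and> \<alpha> j k \<ge> 2 \<and> \<alpha> k j \<ge> 2 \<and> \<beta> j k > 0"
    and sol: "positive_solution r lam \<alpha> \<beta> u"
begin

abbreviation "J \<equiv> {1..r}"

definition p :: real where "p = sobolev_exp CARD('n)"

lemma p: "p > 2"
  unfolding p_def by (rule sobolev_exp_gt_2[OF N])

definition p' :: real where "p' = p / (p - 1)"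

lemma p': "p' > 1" "1 / p' + 1 / p = 1" "p' * (p - 1) = p"
  using conjugate_exponent[of p] p by (auto simp: p'_def)

definition G :: "nat \<Rightarrow> real^'n \<Rightarrow> real^'n" where "G j = D12_grad (u j)"

lemma D_u: "j \<in> J \<Longrightarrow> has_D12_gradient (u j) (G j)"
proof -
  assume "j \<in> J"
  then have "u j \<in> D12" using sol unfolding positive_solution_def weak_solution_def by blast
  then have "\<exists>G. has_D12_gradient (u j) G" by (simp add: D12_def)
  then show ?thesis unfolding G_def D12_grad_def by (rule someI_ex)
qed

lemma u_measurable [measurable]: "j \<in> J \<Longrightarrow> u j \<in> borel_measurable lebesgue"
  by (rule D12_measurable(1)[OF D_u])

lemma G_measurable [measurable]: "j \<in> J \<Longrightarrow> G j \<in> borel_measurable lebesgue"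
  by (rule D12_measurable(2)[OF D_u])

lemma u_pos: "j \<in> J \<Longrightarrow> x \<noteq> 0 \<Longrightarrow> u j x > 0"
  using sol unfolding positive_solution_def by auto

text \<open>One majorant for all components; its critical norm controls the coefficients of all
  comparison inequalities simultaneously.\<close>

definition U :: "real^'n \<Rightarrow> real" where "U x = (\<Sum>k\<in>J. u k x)"

lemma U_Lp: "in_Lq p U"
  unfolding U_def[abs_def] p_def
  by (rule D12_in_Lq(1)[OF D12_sum[OF _ D_u N] N]) auto

lemma U_measurable [measurable]: "U \<in> borel_measurable lebesgue"
  using U_Lp by (simp add: in_Lq_def)

lemma u_le_U: "j \<in> J \<Longrightarrow> x \<noteq> 0 \<Longrightarrow> u j x \<le> U x"
  unfolding U_def by (rule member_le_sum) (auto simp: less_imp_le u_pos)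

lemma U_nonneg: "x \<noteq> 0 \<Longrightarrow> 0 \<le> U x"
  unfolding U_def by (intro sum_nonneg less_imp_le u_pos) auto

definition F :: "nat \<Rightarrow> (nat \<Rightarrow> real) \<Rightarrow> real" where
  "F j a = a j powr (p - 1) + (\<Sum>k\<in>J - {j}. \<beta> j k * \<alpha> j k * a j powr (\<alpha> j k - 1) * a k powr \<alpha> k j)"

text \<open>The value of \<open>F j\<close> at the all-one vector. As \<open>F j\<close> is
  homogeneous of degree p - 1, it is the constant in every estimate of \<open>F j\<close>.\<close>

definition C\<^sub>F :: "nat \<Rightarrow> real" where "C\<^sub>F j = 1 + (\<Sum>k\<in>J - {j}. \<beta> j k * \<alpha> j k)"

lemma coeff_nonneg: "j \<in> J \<Longrightarrow> k \<in> J - {j} \<Longrightarrow> 0 \<le> \<beta> j k * \<alpha> j k"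
  using coeffs[of j k] by auto

lemma C_F_ge_1: "j \<in> J \<Longrightarrow> 1 \<le> C\<^sub>F j"
proof -
  assume "j \<in> J"
  then have "0 \<le> (\<Sum>k\<in>J - {j}. \<beta> j k * \<alpha> j k)" by (intro sum_nonneg coeff_nonneg)
  then show ?thesis unfolding C\<^sub>F_def by linarith
qed

lemma F_nonneg: "j \<in> J \<Longrightarrow> 0 \<le> F j a"
  unfolding F_def using coeff_nonneg[of j]
  by (intro add_nonneg_nonneg sum_nonneg mult_nonneg_nonneg[OF mult_nonneg_nonneg]) auto

text \<open>The estimate is one-sided: by cooperativity a component with \<open>a k < b k\<close>
  only helps, so V has to dominate the positive differences alone. The bound on the coupling
  exponents enters here, making both exponents in each product at least 1.\<close>

lemma F_diff_le:
  assumes j: "j \<in> J" and a: "\<And>k. k \<in> J \<Longrightarrow> 0 \<le> a k" "\<And>k. k \<in> J \<Longrightarrow> a k \<le> M"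
    and b: "\<And>k. k \<in> J \<Longrightarrow> 0 \<le> b k" and V: "\<And>k. k \<in> J \<Longrightarrow> a k - b k \<le> V" "0 \<le> V"
  shows "F j a - F j b \<le> (p - 1) * C\<^sub>F j * M powr (p - 2) * V"
proof -
  have M: "0 \<le> M" using a[OF j] by simp
  have 1: "a j powr (p - 1) - b j powr (p - 1) \<le> (p - 1) * M powr (p - 2) * V"
  proof (cases "b j \<le> a j")
    case True
    from powr_diff_le'[of "p - 1" "b j" "a j" M V] show ?thesis
      using True a(2)[OF j] b[OF j] V(1)[OF j] p by simp
  next
    case False
    then have "a j powr (p - 1) \<le> b j powr (p - 1)" using a(1)[OF j] p by (intro powr_mono2) auto
    moreover have "0 \<le> (p - 1) * M powr (p - 2) * V" using p V by simp
    ultimately show ?thesis by linarith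
  qed
  have 2: "a j powr (\<alpha> j k - 1) * a k powr \<alpha> k j - b j powr (\<alpha> j k - 1) * b k powr \<alpha> k j \<le> (p - 1) * M powr (p - 2) * V"
    if k: "k \<in> J - {j}" for k
  proof -
    have c: "\<alpha> j k + \<alpha> k j = p" "\<alpha> j k \<ge> 2" "\<alpha> k j \<ge> 2" using coeffs[of j k] k j by (auto simp: p_def)
    have e: "\<alpha> j k - 1 + \<alpha> k j = p - 1" using c by simp
    have "a j powr (\<alpha> j k - 1) * a k powr \<alpha> k j - b j powr (\<alpha> j k - 1) * b k powr \<alpha> k j
        \<le> (\<alpha> j k - 1 + \<alpha> k j) * M powr (\<alpha> j k - 1 + \<alpha> k j - 1) * V"
      by (rule powr_mult_diff_le) (use c j k a b V in auto)
    then show ?thesis unfolding e by simp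
  qed
  have "F j a - F j b = (a j powr (p - 1) - b j powr (p - 1)) +
      (\<Sum>k\<in>J - {j}. \<beta> j k * \<alpha> j k * (a j powr (\<alpha> j k - 1) * a k powr \<alpha> k j - b j powr (\<alpha> j k - 1) * b k powr \<alpha> k j))"
    by (simp add: F_def algebra_simps sum_subtractf)
  also have "\<dots> \<le> (p - 1) * M powr (p - 2) * V + (\<Sum>k\<in>J - {j}. \<beta> j k * \<alpha> j k * ((p - 1) * M powr (p - 2) * V))"
    by (intro add_mono 1 sum_mono mult_left_mono 2 coeff_nonneg j)
  also have "\<dots> = (p - 1) * C\<^sub>F j * M powr (p - 2) * V"
    unfolding C\<^sub>F_def sum_distrib_right[symmetric] by (simp add: algebra_simps)
  finally show ?thesis .
qed

text \<open>The case V = 0 of the difference estimate.\<close>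

lemma F_mono:
  assumes j: "j \<in> J" and a: "\<And>k. k \<in> J \<Longrightarrow> 0 \<le> a k" "\<And>k. k \<in> J \<Longrightarrow> a k \<le> b k"
  shows "F j a \<le> F j b"
proof -
  have "F j a - F j b \<le> (p - 1) * C\<^sub>F j * (\<Sum>k\<in>J. a k) powr (p - 2) * 0"
    by (rule F_diff_le[OF j]) (use a in \<open>auto intro!: member_le_sum intro: order_trans\<close>)
  then show ?thesis by simp
qed

lemma F_le:
  assumes j: "j \<in> J" and a: "\<And>k. k \<in> J \<Longrightarrow> 0 \<le> a k" "\<And>k. k \<in> J \<Longrightarrow> a k \<le> M"
  shows "F j a \<le> C\<^sub>F j * M powr (p - 1)"
proof -
  have M: "0 \<le> M" using a[OF j] by simp
  have "F j a \<le> M powr (p - 1) + (\<Sum>k\<in>J - {j}. \<beta> j k * \<alpha> j k * (M powr (p - 1)))"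
    unfolding F_def
  proof (intro add_mono sum_mono)
    show "a j powr (p - 1) \<le> M powr (p - 1)" using a j p by (intro powr_mono2) auto
    fix k assume k: "k \<in> J - {j}"
    have c: "\<alpha> j k + \<alpha> k j = p" "\<alpha> j k \<ge> 2" "\<alpha> k j \<ge> 2" using coeffs[of j k] k j by (auto simp: p_def)
    have "a j powr (\<alpha> j k - 1) * a k powr \<alpha> k j \<le> M powr (\<alpha> j k - 1) * M powr \<alpha> k j"
      using a[of j] a[of k] j k c by (intro mult_mono powr_mono2) auto
    also have "\<dots> = M powr (p - 1)" using c(1) by (simp add: powr_add[symmetric] algebra_simps)
    finally show "\<beta> j k * \<alpha> j k * a j powr (\<alpha> j k - 1) * a k powr \<alpha> k j \<le> \<beta> j k * \<alpha> j k * M powr (p - 1)"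
      using mult_left_mono[OF _ coeff_nonneg[OF j k]] by (simp only: mult.assoc)
  qed
  also have "\<dots> = C\<^sub>F j * M powr (p - 1)"
    unfolding C\<^sub>F_def sum_distrib_right[symmetric] by (simp add: algebra_simps)
  finally show ?thesis .
qed

definition f :: "nat \<Rightarrow> real^'n \<Rightarrow> real" where "f j x = F j (\<lambda>k. u k x)"

lemma f_measurable [measurable]: "j \<in> J \<Longrightarrow> f j \<in> borel_measurable lebesgue"
  unfolding f_def[abs_def] F_def
  by (intro borel_measurable_add borel_measurable_sum borel_measurable_times powr_real_measurable
      borel_measurable_const u_measurable) auto

text \<open>The bound by \<open>U powr (p - 1)\<close> and \<open>p' * (p - 1) = p\<close> place the
  nonlinearity in the dual of the critical Lebesgue space, so it can be paired with every element of
  \<open>D12\<close>.\<close>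

lemma f_Lp': assumes j: "j \<in> J" shows "in_Lq p' (f j)"
proof (rule in_Lq_mono_AE)
  show "in_Lq p' (\<lambda>x. \<bar>U x\<bar> powr (p - 1))"
  proof -
    have "(\<bar>U x\<bar> powr (p - 1)) powr p' = \<bar>U x\<bar> powr p" for x
      using p'(3) by (simp add: powr_powr mult.commute)
    then show ?thesis using U_Lp by (simp add: in_Lq_def)
  qed
  show "AE x in lebesgue. norm (f j x) \<le> C\<^sub>F j * norm (\<bar>U x\<bar> powr (p - 1))"
    using AE_not_zero
  proof eventually_elim
    case (elim x)
    have "f j x \<le> C\<^sub>F j * U x powr (p - 1)" unfolding f_def
      by (rule F_le[OF j]) (use elim u_pos u_le_U in \<open>auto intro: less_imp_le\<close>)
    then show ?case using F_nonneg[OF j] U_nonneg[OF elim] by (simp add: f_def)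
  qed
qed (use j C_F_ge_1[OF j] p' in auto)

section \<open>The weak formulation tested with arbitrary elements of \<open>D12\<close>\<close>

lemma Hardy_L2:
  fixes v :: "real^'n \<Rightarrow> real"
  assumes D: "has_D12_gradient v V"
  shows "ennreal (hardy_const CARD('n)) * Lq_dist 2 (\<lambda>x. v x / norm x) (\<lambda>x. 0) \<le> Lq_dist 2 V (\<lambda>x. 0)"
proof -
  have "(norm (v x / norm x - 0)) powr 2 = (v x)\<^sup>2 / (norm x)\<^sup>2" for x
    by (simp add: power_divide)
  then show ?thesis using Hardy_D12[OF D N] by (simp add: Lq_dist_def)
qed

lemma hardy_pos: "hardy_const CARD('n) > 0"
  using N by (simp add: hardy_const_def)

lemma measurable_div_norm:
  assumes [measurable]: "v \<in> borel_measurable lebesgue"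
  shows "(\<lambda>x::real^'n. v x / norm x) \<in> borel_measurable lebesgue"
proof -
  have [measurable]: "(\<lambda>x::real^'n. norm x) \<in> borel_measurable lebesgue" by (intro measurable_completion) auto
  show ?thesis by measurable
qed

text \<open>Lets the singular term be read as the product of u/\<bar>x\<bar> and v/\<bar>x\<bar>,
  both square integrable, with no cut-off at the origin.\<close>

lemma div_norm_L2:
  fixes v :: "real^'n \<Rightarrow> real"
  assumes D: "has_D12_gradient v V"
  shows "in_Lq 2 (\<lambda>x. v x / norm x)"
proof -
  have "ennreal (hardy_const CARD('n)) * Lq_dist 2 (\<lambda>x. v x / norm x) (\<lambda>x. 0) < top"
    using Hardy_L2[OF D] D12_in_Lq(2)[OF D N] by (auto simp: in_Lq_iff_dist elim: order_le_less_trans)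
  then have "Lq_dist 2 (\<lambda>x. v x / norm x) (\<lambda>x. 0) < top" using hardy_pos
    by (auto simp: ennreal_mult_less_top)
  then show ?thesis using measurable_div_norm[OF D12_measurable(1)[OF D]] by (simp add: in_Lq_iff_dist)
qed

text \<open>The whole right-hand side of the equation once it is written as minus the Laplacian of
  \<open>u j\<close>.\<close>

definition kf :: "nat \<Rightarrow> real^'n \<Rightarrow> real" where
  "kf j x = lam j / (norm x)\<^sup>2 * u j x + f j x"

lemma kf_measurable [measurable]: "j \<in> J \<Longrightarrow> kf j \<in> borel_measurable lebesgue"
proof -
  assume [measurable]: "j \<in> J"
  have [measurable]: "(\<lambda>x::real^'n. (norm x)\<^sup>2) \<in> borel_measurable lebesgue" by (intro measurable_completion) auto
  show ?thesis unfolding kf_def[abs_def] by measurable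
qed

text \<open>By density: the gradient term, the Hardy term and the nonlinear term are each continuous
  in the convergence that defines \<open>D12\<close>. This admits positive parts as test
  functions.\<close>

lemma weak_eq:
  assumes j: "j \<in> J" and D: "has_D12_gradient v V"
  shows "integrable lebesgue (\<lambda>x. kf j x * v x)" "integrable lebesgue (\<lambda>x. G j x \<bullet> V x)"
    "(\<integral>x. G j x \<bullet> V x \<partial>lebesgue) = (\<integral>x. kf j x * v x \<partial>lebesgue)"
proof -
  have two: "(2::real) > 1" "1 / (2::real) + 1 / 2 = 1" by auto
  note uL = div_norm_L2[OF D_u[OF j]] and GL = D12_in_Lq(2)[OF D_u[OF j] N]
  have i1: "integrable lebesgue (\<lambda>x. G j x \<bullet> H x)" if "in_Lq 2 H" for H
    by (rule Lq_pair_integrable(1)[OF two(1) two(1) two(2) GL that])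
  have i2: "integrable lebesgue (\<lambda>x. (u j x / norm x) * (w x / norm x))" if "has_D12_gradient w H" for w H
    using Lq_pair_integrable(1)[OF two(1) two(1) two(2) uL div_norm_L2[OF that]] by simp
  have i3: "integrable lebesgue (\<lambda>x. f j x * w x)" if "in_Lq p w" for w :: "real^'n \<Rightarrow> real"
    using Lq_pair_integrable(1)[OF p'(1) _ p'(2) f_Lp'[OF j] that] p by simp
  have keq: "kf j x * w x = lam j * ((u j x / norm x) * (w x / norm x)) + f j x * w x" for w :: "real^'n \<Rightarrow> real" and x
    by (simp add: kf_def algebra_simps power2_eq_square)
  obtain \<phi> where \<phi>: "\<And>m. test_fun (\<phi> m)" "(\<lambda>m::nat. Lq_dist 2 (grad (\<phi> m)) V) \<longlonglongrightarrow> 0"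
      "(\<lambda>m. Lq_dist p (\<phi> m) v) \<longlonglongrightarrow> 0"
    unfolding p_def by (rule D12_approx[OF D]) blast
  note D\<phi> = D12_test_fun[OF \<phi>(1)]
  have \<phi>p: "in_Lq p (\<phi> m)" for m using in_Lq_test_fun(1)[OF \<phi>(1)] p by simp
  have \<phi>2: "in_Lq 2 (grad (\<phi> m))" for m by (rule in_Lq_test_fun(2)[OF \<phi>(1)])
  have vp: "in_Lq p v" "in_Lq 2 V" using D12_in_Lq[OF D N] by (auto simp: p_def)
  show "integrable lebesgue (\<lambda>x. G j x \<bullet> V x)" by (rule i1[OF vp(2)])
  show "integrable lebesgue (\<lambda>x. kf j x * v x)"
    unfolding keq by (intro Bochner_Integration.integrable_add integrable_mult_right i2[OF D] i3 vp)
  have eq: "(\<integral>x. G j x \<bullet> grad (\<phi> m) x \<partial>lebesgue) =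
      lam j * (\<integral>x. (u j x / norm x) * (\<phi> m x / norm x) \<partial>lebesgue) + (\<integral>x. f j x * \<phi> m x \<partial>lebesgue)" for m
  proof -
    have "(\<integral>x. G j x \<bullet> grad (\<phi> m) x - lam j / (norm x)\<^sup>2 * u j x * \<phi> m x \<partial>lebesgue) = (\<integral>x. f j x * \<phi> m x \<partial>lebesgue)"
      using sol j \<phi>(1)[of m] unfolding positive_solution_def weak_solution_def
      by (simp add: G_def f_def F_def p_def)
    also have "(\<lambda>x. G j x \<bullet> grad (\<phi> m) x - lam j / (norm x)\<^sup>2 * u j x * \<phi> m x) =
        (\<lambda>x. G j x \<bullet> grad (\<phi> m) x - lam j * ((u j x / norm x) * (\<phi> m x / norm x)))"
      by (simp add: fun_eq_iff power2_eq_square)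
    finally show ?thesis
      using Bochner_Integration.integral_diff[OF i1[OF \<phi>2[of m]] integrable_mult_right[OF i2[OF D\<phi>[of m]], of "lam j"]]
      unfolding integral_mult_right_zero by linarith
  qed
  have l1: "(\<lambda>m. \<integral>x. G j x \<bullet> grad (\<phi> m) x \<partial>lebesgue) \<longlonglongrightarrow> (\<integral>x. G j x \<bullet> V x \<partial>lebesgue)"
    by (rule Lq_pair_tendsto[OF two(1) two(1) two(2) GL \<phi>2 vp(2) \<phi>(2)])
  have l3: "(\<lambda>m. \<integral>x. f j x * \<phi> m x \<partial>lebesgue) \<longlonglongrightarrow> (\<integral>x. f j x * v x \<partial>lebesgue)"
    using Lq_pair_tendsto[OF p'(1) _ p'(2) f_Lp'[OF j] \<phi>p vp(1) \<phi>(3)] p by simp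
  have l2: "(\<lambda>m. \<integral>x. (u j x / norm x) * (\<phi> m x / norm x) \<partial>lebesgue) \<longlonglongrightarrow> (\<integral>x. (u j x / norm x) * (v x / norm x) \<partial>lebesgue)"
  proof -
    \<comment> \<open>Hardy's inequality for \<open>\<phi> m - v\<close> turns convergence of the
      gradients into convergence of the quotients by the norm.\<close>
    have "(\<lambda>m. Lq_dist 2 (\<lambda>x. \<phi> m x / norm x) (\<lambda>x. v x / norm x)) \<longlonglongrightarrow> 0"
    proof (rule tendsto_0_le_ennreal)
      fix m
      have "ennreal (hardy_const CARD('n)) * Lq_dist 2 (\<lambda>x. (\<phi> m x - v x) / norm x) (\<lambda>x. 0)
          \<le> Lq_dist 2 (\<lambda>x. grad (\<phi> m) x - V x) (\<lambda>x. 0)"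
        by (rule Hardy_L2[OF D12_diff[OF D\<phi> D N]])
      then have "ennreal (hardy_const CARD('n)) * Lq_dist 2 (\<lambda>x. \<phi> m x / norm x) (\<lambda>x. v x / norm x) \<le> Lq_dist 2 (grad (\<phi> m)) V"
        by (simp add: Lq_dist_def diff_divide_distrib)
      then have "ennreal (1 / hardy_const CARD('n)) * (ennreal (hardy_const CARD('n)) * Lq_dist 2 (\<lambda>x. \<phi> m x / norm x) (\<lambda>x. v x / norm x))
          \<le> ennreal (1 / hardy_const CARD('n)) * Lq_dist 2 (grad (\<phi> m)) V"
        by (rule mult_left_mono) simp
      then show "Lq_dist 2 (\<lambda>x. \<phi> m x / norm x) (\<lambda>x. v x / norm x) \<le> ennreal (1 / hardy_const CARD('n)) * Lq_dist 2 (grad (\<phi> m)) V"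
        using hardy_pos by (simp add: mult.assoc[symmetric] ennreal_mult[symmetric])
    next
      show "(\<lambda>m. ennreal (1 / hardy_const CARD('n)) * Lq_dist 2 (grad (\<phi> m)) V) \<longlonglongrightarrow> 0"
        using tendsto_mult_ennreal[OF tendsto_const[of "ennreal (1 / hardy_const CARD('n))"] \<phi>(2)] by simp
    qed
    from Lq_pair_tendsto[OF two(1) two(1) two(2) uL div_norm_L2[OF D\<phi>] div_norm_L2[OF D] this]
    show ?thesis by simp
  qed
  have "(\<integral>x. G j x \<bullet> V x \<partial>lebesgue) =
      lam j * (\<integral>x. (u j x / norm x) * (v x / norm x) \<partial>lebesgue) + (\<integral>x. f j x * v x \<partial>lebesgue)"
    by (rule LIMSEQ_unique[OF l1]) (unfold eq, intro tendsto_intros l2 l3)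
  also have "\<dots> = (\<integral>x. kf j x * v x \<partial>lebesgue)"
    unfolding keq Bochner_Integration.integral_add[OF integrable_mult_right[OF i2[OF D]] i3[OF vp(1)]]
      integral_mult_right_zero ..
  finally show "(\<integral>x. G j x \<bullet> V x \<partial>lebesgue) = (\<integral>x. kf j x * v x \<partial>lebesgue)" .
qed

text \<open>Testing the reflected function with v is testing \<open>u j\<close> with the reflection
  of v, by a change of variables. The potential is centred at the origin and not invariant under the
  reflection; its value at the reflected point stays inside \<open>kf\<close>.\<close>

lemma weak_eq_refl:
  assumes j: "j \<in> J" and D: "has_D12_gradient v V" and e: "norm e = 1"
  shows "integrable lebesgue (\<lambda>x. (kf j x - kf j (refl_hyp e \<mu> x)) * v x)"
    "integrable lebesgue (\<lambda>x. (G j x - refl_hyp e 0 (G j (refl_hyp e \<mu> x))) \<bullet> V x)"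
    "(\<integral>x. (G j x - refl_hyp e 0 (G j (refl_hyp e \<mu> x))) \<bullet> V x \<partial>lebesgue) =
     (\<integral>x. (kf j x - kf j (refl_hyp e \<mu> x)) * v x \<partial>lebesgue)"
proof -
  let ?R = "refl_hyp e \<mu>"
  note [measurable] = D12_measurable[OF D] j
  note w = weak_eq[OF j D] and w' = weak_eq[OF j D12_refl[OF D e, of \<mu>]]
  have m: "(\<lambda>x. refl_hyp e 0 (G j (?R x)) \<bullet> V x) \<in> borel_measurable lebesgue"
    "(\<lambda>x. kf j (?R x) * v x) \<in> borel_measurable lebesgue"
    using measurable_comp_refl_hyp[OF e, of "G j" \<mu>] measurable_comp_refl_hyp[OF e, of "kf j" \<mu>] by measurable
  have a: "(\<lambda>x. G j x \<bullet> refl_hyp e 0 (V (?R x))) = (\<lambda>x. refl_hyp e 0 (G j (?R (?R x))) \<bullet> V (?R x))"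
    using e by (simp add: refl_hyp0_adjoint)
  have b: "(\<lambda>x. kf j x * v (?R x)) = (\<lambda>x. kf j (?R (?R x)) * v (?R x))"
    using e by simp
  have A: "integrable lebesgue (\<lambda>x. refl_hyp e 0 (G j (?R x)) \<bullet> V x)"
     "(\<integral>x. G j x \<bullet> refl_hyp e 0 (V (?R x)) \<partial>lebesgue) = (\<integral>x. refl_hyp e 0 (G j (?R x)) \<bullet> V x \<partial>lebesgue)"
    using w'(2) integral_refl_hyp[OF e m(1), of \<mu>] unfolding a by auto
  have B: "integrable lebesgue (\<lambda>x. kf j (?R x) * v x)"
     "(\<integral>x. kf j x * v (?R x) \<partial>lebesgue) = (\<integral>x. kf j (?R x) * v x \<partial>lebesgue)"
    using w'(1) integral_refl_hyp[OF e m(2), of \<mu>] unfolding b by auto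
  show "integrable lebesgue (\<lambda>x. (kf j x - kf j (?R x)) * v x)"
    unfolding left_diff_distrib using w(1) B(1) by (rule Bochner_Integration.integrable_diff)
  show "integrable lebesgue (\<lambda>x. (G j x - refl_hyp e 0 (G j (?R x))) \<bullet> V x)"
    unfolding inner_diff_left using w(2) A(1) by (rule Bochner_Integration.integrable_diff)
  show "(\<integral>x. (G j x - refl_hyp e 0 (G j (?R x))) \<bullet> V x \<partial>lebesgue) = (\<integral>x. (kf j x - kf j (?R x)) * v x \<partial>lebesgue)"
    unfolding left_diff_distrib inner_diff_left
    using w w' A B by (simp add: Bochner_Integration.integral_diff)
qed

end

section \<open>Energy estimates for the comparison with the reflected solution\<close>

lemma norm_sum_sq_le:
  fixes g :: "'i \<Rightarrow> 'b::real_normed_vector"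
  assumes "finite I"
  shows "(norm (\<Sum>i\<in>I. g i))\<^sup>2 \<le> real (card I) * (\<Sum>i\<in>I. (norm (g i))\<^sup>2)"
proof -
  have "(norm (\<Sum>i\<in>I. g i))\<^sup>2 \<le> (\<Sum>i\<in>I. norm (g i))\<^sup>2"
    by (intro power_mono norm_sum) auto
  also have "\<dots> \<le> real (card I) * (\<Sum>i\<in>I. (norm (g i))\<^sup>2)"
    using Cauchy_Schwarz_ineq_sum[of "\<lambda>_. 1" "\<lambda>i. norm (g i)" I] by simp
  finally show ?thesis .
qed

lemma AE_refl_hyp_not_zero:
  fixes e :: "real^'n"
  assumes "norm e = 1"
  shows "AE x in lebesgue. refl_hyp e \<mu> x \<noteq> 0"
  by (rule AE_refl_hyp[OF assms AE_not_zero])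

context positive_system
begin

text \<open>Extended by zero across the mirror, where the difference vanishes, so that it lies in
  \<open>D12\<close> with gradient \<open>w'\<close>; the positive part \<open>v\<close> and its
  gradient \<open>v'\<close> follow the same naming.\<close>

definition w :: "real^'n \<Rightarrow> real \<Rightarrow> nat \<Rightarrow> real^'n \<Rightarrow> real" where
  "w e \<mu> j x = (if \<mu> < x \<bullet> e then u j x - u j (refl_hyp e \<mu> x) else 0)"

definition w' :: "real^'n \<Rightarrow> real \<Rightarrow> nat \<Rightarrow> real^'n \<Rightarrow> real^'n" where
  "w' e \<mu> j x = (if \<mu> < x \<bullet> e then G j x - refl_hyp e 0 (G j (refl_hyp e \<mu> x)) else 0)"

definition v :: "real^'n \<Rightarrow> real \<Rightarrow> nat \<Rightarrow> real^'n \<Rightarrow> real" where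
  "v e \<mu> j x = max 0 (w e \<mu> j x)"

definition v' :: "real^'n \<Rightarrow> real \<Rightarrow> nat \<Rightarrow> real^'n \<Rightarrow> real^'n" where
  "v' e \<mu> j x = (if w e \<mu> j x > 0 then w' e \<mu> j x else 0)"

text \<open>Encodes all r inequalities by the vanishing of one function and bounds every positive
  difference in the coupling terms.\<close>

definition vsum :: "real^'n \<Rightarrow> real \<Rightarrow> real^'n \<Rightarrow> real" where
  "vsum e \<mu> x = (\<Sum>j\<in>J. v e \<mu> j x)"

lemma D_w: "norm e = 1 \<Longrightarrow> j \<in> J \<Longrightarrow> has_D12_gradient (w e \<mu> j) (w' e \<mu> j)"
  unfolding w_def[abs_def] w'_def[abs_def] by (rule D12_halfspace[OF D_u _ N])

lemma D_v: "norm e = 1 \<Longrightarrow> j \<in> J \<Longrightarrow> has_D12_gradient (v e \<mu> j) (v' e \<mu> j)"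
  unfolding v_def[abs_def] v'_def[abs_def] by (rule D12_pos[OF D_w N])

lemma D_vsum: "norm e = 1 \<Longrightarrow> has_D12_gradient (vsum e \<mu>) (\<lambda>x. \<Sum>j\<in>J. v' e \<mu> j x)"
  unfolding vsum_def[abs_def] by (rule D12_sum[OF _ D_v N]) auto

lemma v_nonneg: "0 \<le> v e \<mu> j x" by (simp add: v_def)

lemma vsum_nonneg: "0 \<le> vsum e \<mu> x" unfolding vsum_def by (intro sum_nonneg v_nonneg)

lemma v_le_vsum: "j \<in> J \<Longrightarrow> v e \<mu> j x \<le> vsum e \<mu> x"
  unfolding vsum_def by (rule member_le_sum) (auto intro: v_nonneg)

lemma vsum_eq_0_iff: "vsum e \<mu> x = 0 \<longleftrightarrow> (\<forall>j\<in>J. \<mu> < x \<bullet> e \<longrightarrow> u j x \<le> u j (refl_hyp e \<mu> x))"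
proof -
  have "v e \<mu> j x = 0 \<longleftrightarrow> (\<mu> < x \<bullet> e \<longrightarrow> u j x \<le> u j (refl_hyp e \<mu> x))" for j
    by (auto simp: v_def w_def max_def split: if_splits)
  then show ?thesis unfolding vsum_def by (simp add: sum_nonneg_eq_0_iff v_nonneg)
qed

text \<open>The reflected point is not farther from the origin, and the solution is positive there,
  so its Hardy coefficient may be lowered to the one at x. What remains of the Hardy terms is linear
  in the positive part.\<close>

lemma kf_diff_le:
  assumes j: "j \<in> J" and e: "norm e = 1" and \<mu>: "0 \<le> \<mu>" "\<mu> < x \<bullet> e"
    and x: "x \<noteq> 0" "refl_hyp e \<mu> x \<noteq> 0"
  shows "kf j x - kf j (refl_hyp e \<mu> x) \<le>
     lam j * v e \<mu> j x / (norm x)\<^sup>2 + (p - 1) * C\<^sub>F j * U x powr (p - 2) * vsum e \<mu> x"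
proof -
  let ?y = "refl_hyp e \<mu> x"
  have "(norm ?y)\<^sup>2 \<le> (norm x)\<^sup>2" using norm_refl_hyp_sq[OF e, of \<mu> x] \<mu> by simp
  then have "lam j / (norm x)\<^sup>2 * u j ?y \<le> lam j / (norm ?y)\<^sup>2 * u j ?y"
    using x lam[OF j] u_pos[OF j x(2)] by (intro mult_right_mono divide_left_mono mult_pos_pos) auto
  then have "lam j / (norm x)\<^sup>2 * u j x - lam j / (norm ?y)\<^sup>2 * u j ?y \<le> lam j / (norm x)\<^sup>2 * (u j x - u j ?y)"
    by (simp add: right_diff_distrib)
  also have "\<dots> \<le> lam j / (norm x)\<^sup>2 * v e \<mu> j x"
    using lam[OF j] \<mu> by (intro mult_left_mono) (auto simp: v_def w_def)
  finally have 1: "lam j / (norm x)\<^sup>2 * u j x - lam j / (norm ?y)\<^sup>2 * u j ?y \<le> lam j * v e \<mu> j x / (norm x)\<^sup>2" by simp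
  have 2: "f j x - f j ?y \<le> (p - 1) * C\<^sub>F j * U x powr (p - 2) * vsum e \<mu> x"
    unfolding f_def
  proof (rule F_diff_le[OF j])
    fix k assume k: "k \<in> J"
    show "u k x - u k ?y \<le> vsum e \<mu> x"
      using v_le_vsum[OF k, of e \<mu> x] \<mu> by (simp add: v_def w_def)
  qed (use u_pos x u_le_U vsum_nonneg in \<open>auto intro: less_imp_le\<close>)
  from 1 2 show ?thesis by (simp add: kf_def)
qed

definition energy :: "real^'n \<Rightarrow> real \<Rightarrow> nat \<Rightarrow> real" where
  "energy e \<mu> j = (\<integral>x. (norm (v' e \<mu> j x))\<^sup>2 \<partial>lebesgue)"

text \<open>Where the positive part has nonzero gradient, this gradient equals that of the
  difference; testing the difference equation with the positive part therefore produces its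
  Dirichlet energy.\<close>

lemma energy:
  assumes e: "norm e = 1" and j: "j \<in> J"
  shows "integrable lebesgue (\<lambda>x. (norm (v' e \<mu> j x))\<^sup>2)"
    "(\<integral>\<^sup>+x. ennreal ((norm (v' e \<mu> j x))\<^sup>2) \<partial>lebesgue) = ennreal (energy e \<mu> j)" "0 \<le> energy e \<mu> j"
    "energy e \<mu> j = (\<integral>x. (kf j x - kf j (refl_hyp e \<mu> x)) * v e \<mu> j x \<partial>lebesgue)"
proof -
  have "in_Lq 2 (v' e \<mu> j)" by (rule D12_in_Lq(2)[OF D_v[OF e j] N])
  from Lq_pair_integrable(2)[of 2 2, OF _ _ _ this this]
  show i: "integrable lebesgue (\<lambda>x. (norm (v' e \<mu> j x))\<^sup>2)" by (simp add: power2_eq_square)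
  show "(\<integral>\<^sup>+x. ennreal ((norm (v' e \<mu> j x))\<^sup>2) \<partial>lebesgue) = ennreal (energy e \<mu> j)"
    unfolding energy_def by (rule nn_integral_eq_integral[OF i]) simp
  show "0 \<le> energy e \<mu> j" by (simp add: energy_def)
  have "(\<lambda>x. (norm (v' e \<mu> j x))\<^sup>2) = (\<lambda>x. (G j x - refl_hyp e 0 (G j (refl_hyp e \<mu> x))) \<bullet> v' e \<mu> j x)"
    by (auto simp: v'_def w_def w'_def fun_eq_iff power2_norm_eq_inner)
  then show "energy e \<mu> j = (\<integral>x. (kf j x - kf j (refl_hyp e \<mu> x)) * v e \<mu> j x \<partial>lebesgue)"
    unfolding energy_def using weak_eq_refl(3)[OF j D_v[OF e j] e, of \<mu>] by simp
qed

text \<open>The smallness quantity of the method: the critical norm, to the power p, of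
  \<open>U\<close> on the set where some inequality fails.\<close>

definition mass :: "real^'n \<Rightarrow> real \<Rightarrow> ennreal" where
  "mass e \<mu> = (\<integral>\<^sup>+x. (if 0 < vsum e \<mu> x then ennreal (\<bar>U x\<bar> powr p) else 0) \<partial>lebesgue)"

definition S :: real where "S = (sobolev_const CARD('n))\<^sup>2"

definition total_energy :: "real^'n \<Rightarrow> real \<Rightarrow> real" where
  "total_energy e \<mu> = (\<Sum>j\<in>J. energy e \<mu> j)"

text \<open>Hoelder with the weights (p-2)/p and 2/p. The factor \<open>vsum\<close> allows
  restricting \<open>U\<close> to {vsum > 0}, so only \<open>mass\<close> appears; Sobolev for
  \<open>vsum\<close> and Cauchy-Schwarz over the r components give the energies.\<close>

lemma interaction_le:
  assumes e: "norm e = 1"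
  shows "(\<integral>\<^sup>+x. ennreal (\<bar>U x\<bar> powr (p - 2) * (vsum e \<mu> x)\<^sup>2) \<partial>lebesgue)
    \<le> epow (mass e \<mu>) ((p - 2) / p) * ennreal (S * real r * total_energy e \<mu>)"
proof -
  note [measurable] = D12_measurable(1)[OF D_vsum[OF e, of \<mu>]]
  have S: "S \<ge> 0" by (simp add: S_def)
  have "(\<integral>\<^sup>+x. ennreal (\<bar>U x\<bar> powr (p - 2) * (vsum e \<mu> x)\<^sup>2) \<partial>lebesgue) =
    (\<integral>\<^sup>+x. epow (if 0 < vsum e \<mu> x then ennreal (\<bar>U x\<bar> powr p) else 0) ((p - 2) / p) *
       epow (ennreal (\<bar>vsum e \<mu> x\<bar> powr p)) (2 / p) \<partial>lebesgue)"
  proof (intro nn_integral_cong)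
    fix x
    show "ennreal (\<bar>U x\<bar> powr (p - 2) * (vsum e \<mu> x)\<^sup>2) =
      epow (if 0 < vsum e \<mu> x then ennreal (\<bar>U x\<bar> powr p) else 0) ((p - 2) / p) * epow (ennreal (\<bar>vsum e \<mu> x\<bar> powr p)) (2 / p)"
    proof (cases "0 < vsum e \<mu> x")
      case True
      have "(\<bar>U x\<bar> powr p) powr ((p - 2) / p) = \<bar>U x\<bar> powr (p - 2)" using p by (simp add: powr_powr)
      moreover have "(vsum e \<mu> x powr p) powr (2 / p) = (vsum e \<mu> x)\<^sup>2" using p True by (simp add: powr_powr)
      ultimately show ?thesis using True by (simp add: ennreal_mult)
    next
      case False
      then have "vsum e \<mu> x = 0" using vsum_nonneg[of e \<mu> x] by simp
      then show ?thesis by simp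
    qed
  qed
  also have "\<dots> \<le> epow (mass e \<mu>) ((p - 2) / p) * epow (\<integral>\<^sup>+x. ennreal (\<bar>vsum e \<mu> x\<bar> powr p) \<partial>lebesgue) (2 / p)"
    unfolding mass_def by (rule Hoelder_nn_integral2) (use p in \<open>auto simp: field_simps\<close>)
  also have "epow (\<integral>\<^sup>+x. ennreal (\<bar>vsum e \<mu> x\<bar> powr p) \<partial>lebesgue) (2 / p) \<le>
      ennreal S * (\<integral>\<^sup>+x. ennreal ((norm (\<Sum>j\<in>J. v' e \<mu> j x))\<^sup>2) \<partial>lebesgue)"
    unfolding S_def p_def by (rule Sobolev_D12[OF D_vsum[OF e] N])
  also have "(\<integral>\<^sup>+x. ennreal ((norm (\<Sum>j\<in>J. v' e \<mu> j x))\<^sup>2) \<partial>lebesgue) \<le> (\<integral>\<^sup>+x. ennreal (real r * (\<Sum>j\<in>J. (norm (v' e \<mu> j x))\<^sup>2)) \<partial>lebesgue)"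
    by (intro nn_integral_mono ennreal_leI) (use norm_sum_sq_le[of J] in simp)
  also have "\<dots> = ennreal (\<integral>x. real r * (\<Sum>j\<in>J. (norm (v' e \<mu> j x))\<^sup>2) \<partial>lebesgue)"
    by (rule nn_integral_eq_integral) (auto intro!: integrable_mult_right Bochner_Integration.integrable_sum energy(1)[OF e] sum_nonneg AE_I2 mult_nonneg_nonneg)
  also have "(\<integral>x. real r * (\<Sum>j\<in>J. (norm (v' e \<mu> j x))\<^sup>2) \<partial>lebesgue) = real r * total_energy e \<mu>"
    by (simp add: total_energy_def energy_def Bochner_Integration.integral_sum energy(1)[OF e])
  finally show ?thesis
    using S by (simp add: ennreal_mult' mult.assoc mult_left_mono)
qed

lemma mass_finite: "mass e \<mu> < top"
proof -
  have "mass e \<mu> \<le> (\<integral>\<^sup>+x. ennreal (\<bar>U x\<bar> powr p) \<partial>lebesgue)"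
    unfolding mass_def by (intro nn_integral_mono) auto
  also have "\<dots> < top" using U_Lp by (simp add: in_Lq_def)
  finally show ?thesis .
qed

text \<open>The Hardy term is at most the fraction \<open>lam j / hardy_const CARD('n)\<close> of
  the energy and is moved to the left. Sharpness of the constant keeps the remaining coefficient
  positive on the whole admissible range of \<open>lam j\<close>.\<close>

lemma energy_le:
  assumes e: "norm e = 1" and \<mu>: "0 \<le> \<mu>" and j: "j \<in> J"
    and B: "(\<integral>\<^sup>+x. ennreal (\<bar>U x\<bar> powr (p - 2) * (vsum e \<mu> x)\<^sup>2) \<partial>lebesgue) = ennreal B" "0 \<le> B"
  shows "(1 - lam j / hardy_const CARD('n)) * energy e \<mu> j \<le> (p - 1) * C\<^sub>F j * B"
proof -
  note [measurable] = D12_measurable(1)[OF D_vsum[OF e, of \<mu>]]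
  have iB: "integrable lebesgue (\<lambda>x. \<bar>U x\<bar> powr (p - 2) * (vsum e \<mu> x)\<^sup>2)"
    "(\<integral>x. \<bar>U x\<bar> powr (p - 2) * (vsum e \<mu> x)\<^sup>2 \<partial>lebesgue) = B"
  proof -
    show i: "integrable lebesgue (\<lambda>x. \<bar>U x\<bar> powr (p - 2) * (vsum e \<mu> x)\<^sup>2)"
      by (rule integrableI_nonneg) (use B in auto)
    show "(\<integral>x. \<bar>U x\<bar> powr (p - 2) * (vsum e \<mu> x)\<^sup>2 \<partial>lebesgue) = B"
      using nn_integral_eq_integral[OF i] B by simp
  qed
  define H where "H = (\<integral>x. (v e \<mu> j x / norm x)\<^sup>2 \<partial>lebesgue)"
  have vL: "in_Lq 2 (\<lambda>x. v e \<mu> j x / norm x)" by (rule div_norm_L2[OF D_v[OF e j]])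
  from Lq_pair_integrable(1)[of 2 2, OF _ _ _ this this]
  have iH: "integrable lebesgue (\<lambda>x. (v e \<mu> j x / norm x)\<^sup>2)" by (simp add: power2_eq_square)
  have H: "Lq_dist 2 (\<lambda>x. v e \<mu> j x / norm x) (\<lambda>x. 0) = ennreal H"
    unfolding H_def Lq_dist_def by (subst nn_integral_eq_integral[OF iH, symmetric]) (auto simp: power_divide)
  have H0: "0 \<le> H" by (simp add: H_def)
  have "ennreal (hardy_const CARD('n)) * ennreal H \<le> ennreal (energy e \<mu> j)"
    using Hardy_L2[OF D_v[OF e j], of \<mu>] energy(2)[OF e j, of \<mu>] unfolding H by (simp add: Lq_dist_def)
  then have HE: "hardy_const CARD('n) * H \<le> energy e \<mu> j"
    using hardy_pos H0 energy(3)[OF e j, of \<mu>] by (simp add: ennreal_mult[symmetric])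
  have "energy e \<mu> j \<le> (\<integral>x. lam j * (v e \<mu> j x / norm x)\<^sup>2 + (p - 1) * C\<^sub>F j * (\<bar>U x\<bar> powr (p - 2) * (vsum e \<mu> x)\<^sup>2) \<partial>lebesgue)"
    unfolding energy(4)[OF e j]
  proof (rule integral_mono_AE)
    show "integrable lebesgue (\<lambda>x. (kf j x - kf j (refl_hyp e \<mu> x)) * v e \<mu> j x)"
      by (rule weak_eq_refl(1)[OF j D_v[OF e j] e])
    show "integrable lebesgue (\<lambda>x. lam j * (v e \<mu> j x / norm x)\<^sup>2 + (p - 1) * C\<^sub>F j * (\<bar>U x\<bar> powr (p - 2) * (vsum e \<mu> x)\<^sup>2))"
      by (intro Bochner_Integration.integrable_add integrable_mult_right iH iB)
    show "AE x in lebesgue. (kf j x - kf j (refl_hyp e \<mu> x)) * v e \<mu> j x \<le>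
        lam j * (v e \<mu> j x / norm x)\<^sup>2 + (p - 1) * C\<^sub>F j * (\<bar>U x\<bar> powr (p - 2) * (vsum e \<mu> x)\<^sup>2)"
      using AE_not_zero AE_refl_hyp_not_zero[OF e, of \<mu>]
    proof eventually_elim
      case (elim x)
      have K: "0 \<le> (p - 1) * C\<^sub>F j" using p C_F_ge_1[OF j] by simp
      show ?case
      proof (cases "\<mu> < x \<bullet> e")
        case True
        have "(kf j x - kf j (refl_hyp e \<mu> x)) * v e \<mu> j x \<le>
          (lam j * v e \<mu> j x / (norm x)\<^sup>2 + (p - 1) * C\<^sub>F j * U x powr (p - 2) * vsum e \<mu> x) * v e \<mu> j x"
          by (intro mult_right_mono kf_diff_le j e \<mu> True elim v_nonneg)
        also have "\<dots> = lam j * (v e \<mu> j x / norm x)\<^sup>2 + (p - 1) * C\<^sub>F j * (U x powr (p - 2) * (vsum e \<mu> x * v e \<mu> j x))"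
          by (simp add: power2_eq_square algebra_simps)
        also have "\<dots> \<le> lam j * (v e \<mu> j x / norm x)\<^sup>2 + (p - 1) * C\<^sub>F j * (U x powr (p - 2) * (vsum e \<mu> x * vsum e \<mu> x))"
          by (intro add_left_mono mult_left_mono v_le_vsum j vsum_nonneg K) auto
        finally show ?thesis using U_nonneg[OF elim(1)] by (simp add: power2_eq_square)
      next
        case False
        then have "v e \<mu> j x = 0" by (simp add: v_def w_def)
        then show ?thesis using K by simp
      qed
    qed
  qed
  also have "\<dots> = lam j * H + (p - 1) * C\<^sub>F j * B"
    by (subst Bochner_Integration.integral_add) (auto intro!: integrable_mult_right iH iB simp: H_def iB(2) simp del: integral_divide_zero)
  also have "lam j * H \<le> lam j * (energy e \<mu> j / hardy_const CARD('n))"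
    using HE hardy_pos lam[OF j] by (intro mult_left_mono) (auto simp: field_simps)
  finally show ?thesis by (simp add: algebra_simps)
qed

text \<open>Summing the energy estimates gives T \<le> \<theta>QT for the total energy T, with
  \<theta> a power of the mass. If \<theta>Q < 1, then T = 0, and Sobolev's inequality makes every
  positive part vanish. The threshold depends neither on the direction nor on the offset.\<close>

lemma small_mass:
  obtains \<delta> where "\<delta> > 0"
    "\<And>e \<mu>. norm e = 1 \<Longrightarrow> 0 \<le> \<mu> \<Longrightarrow> mass e \<mu> < ennreal \<delta> \<Longrightarrow> AE x in lebesgue. vsum e \<mu> x = 0"
proof -
  define \<kappa> where "\<kappa> = (\<Sum>j\<in>J. (p - 1) * C\<^sub>F j / (1 - lam j / hardy_const CARD('n)))"
  have th: "0 < 1 - lam j / hardy_const CARD('n)" if "j \<in> J" for j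
    using lam[OF that] hardy_pos by simp
  have \<kappa>: "\<kappa> \<ge> 0"
    unfolding \<kappa>_def using p C_F_ge_1 th by (intro sum_nonneg divide_nonneg_pos mult_nonneg_nonneg) (auto intro: order_trans[of 0 1])
  have S: "S \<ge> 0" by (simp add: S_def)
  define Q where "Q = \<kappa> * (S * real r)"
  have Q: "Q \<ge> 0" using \<kappa> S by (simp add: Q_def)
  \<comment> \<open>Chosen so that \<open>\<delta> powr ((p - 2) / p) = 1 / (Q + 1)\<close>; the
    resulting factor Q/(Q+1) is below 1 also when Q = 0.\<close>
  define \<delta> where "\<delta> = (1 / (Q + 1)) powr (p / (p - 2))"
  show thesis
  proof (rule that[of \<delta>])
    show "\<delta> > 0" using Q by (simp add: \<delta>_def)
    fix e \<mu> assume e: "norm e = 1" and \<mu>: "0 \<le> \<mu>" and m: "mass e \<mu> < ennreal \<delta>"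
    define a where "a = enn2real (mass e \<mu>)"
    have a: "mass e \<mu> = ennreal a" "0 \<le> a" "a < \<delta>"
      using m mass_finite[of e \<mu>] by (auto simp: a_def enn2real_less_iff)
    define \<theta> where "\<theta> = a powr ((p - 2) / p)"
    have \<theta>: "0 \<le> \<theta>" "\<theta> \<le> 1 / (Q + 1)"
    proof -
      have "a powr ((p - 2) / p) \<le> \<delta> powr ((p - 2) / p)" using a p by (intro powr_mono2) auto
      also have "\<dots> = 1 / (Q + 1)" using p Q by (simp add: \<delta>_def powr_powr)
      finally show "\<theta> \<le> 1 / (Q + 1)" by (simp add: \<theta>_def)
    qed (simp add: \<theta>_def)
    define T where "T = total_energy e \<mu>"
    have T: "T \<ge> 0" unfolding T_def total_energy_def by (intro sum_nonneg energy e)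
    define Bn where "Bn = (\<integral>\<^sup>+x. ennreal (\<bar>U x\<bar> powr (p - 2) * (vsum e \<mu> x)\<^sup>2) \<partial>lebesgue)"
    have Bn: "Bn \<le> ennreal (\<theta> * (S * real r * T))"
      using interaction_le[OF e, of \<mu>] a(2) \<theta>(1) S T
      by (simp add: Bn_def a(1) \<theta>_def T_def ennreal_mult)
    then obtain B where B: "Bn = ennreal B" "0 \<le> B" "B \<le> \<theta> * (S * real r * T)"
      using \<theta>(1) S T by (cases Bn) (auto simp: top_unique)
    have "T \<le> (\<Sum>j\<in>J. (p - 1) * C\<^sub>F j / (1 - lam j / hardy_const CARD('n)) * B)"
      unfolding T_def total_energy_def
    proof (rule sum_mono)
      fix j assume j: "j \<in> J"
      from energy_le[OF e \<mu> j B(1)[unfolded Bn_def] B(2)] th[OF j]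
      show "energy e \<mu> j \<le> (p - 1) * C\<^sub>F j / (1 - lam j / hardy_const CARD('n)) * B"
        by (simp add: pos_le_divide_eq mult.commute)
    qed
    also have "\<dots> = \<kappa> * B" by (simp add: \<kappa>_def sum_distrib_right)
    also have "\<dots> \<le> \<kappa> * (\<theta> * (S * real r * T))" by (intro mult_left_mono B \<kappa>)
    also have "\<dots> = \<theta> * (Q * T)" by (simp add: Q_def)
    also have "\<dots> \<le> 1 / (Q + 1) * (Q * T)" using Q T \<theta> by (intro mult_right_mono) auto
    finally have "T \<le> Q * T / (Q + 1)" by simp
    then have "T \<le> 0" using Q T by (simp add: field_simps)
    with T have T0: "T = 0" by simp
    have E0: "energy e \<mu> j = 0" if "j \<in> J" for j
      using T0 energy(3)[OF e] that unfolding T_def total_energy_def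
      by (subst (asm) sum_nonneg_eq_0_iff) auto
    have v0: "AE x in lebesgue. v e \<mu> j x = 0" if j: "j \<in> J" for j
    proof -
      note [measurable] = D12_measurable(1)[OF D_v[OF e j, of \<mu>]]
      have "epow (\<integral>\<^sup>+x. ennreal (\<bar>v e \<mu> j x\<bar> powr p) \<partial>lebesgue) (2 / p) \<le> 0"
        using Sobolev_D12[OF D_v[OF e j] N, of \<mu>] energy(2)[OF e j, of \<mu>] E0[OF j] by (simp add: p_def)
      then have "(\<integral>\<^sup>+x. ennreal (\<bar>v e \<mu> j x\<bar> powr p) \<partial>lebesgue) = 0" by simp
      then have "AE x in lebesgue. ennreal (\<bar>v e \<mu> j x\<bar> powr p) = 0"
        by (subst (asm) nn_integral_0_iff_AE) auto
      then show ?thesis by eventually_elim (simp add: ennreal_eq_0_iff)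
    qed
    have "AE x in lebesgue. \<forall>j\<in>J. v e \<mu> j x = 0"
      by (rule AE_finite_allI) (auto intro: v0)
    then show "AE x in lebesgue. vsum e \<mu> x = 0" by eventually_elim (simp add: vsum_def)
  qed
qed

text \<open>Strictness comes from the potential alone: with \<mu> > 0 the reflected point is
  strictly closer to the origin, and \<open>lam j\<close> and \<open>u j x\<close> are positive. The
  nonlinearity contributes monotonicity.\<close>

lemma kf_strict:
  assumes j: "j \<in> J" and e: "norm e = 1" and \<mu>: "0 < \<mu>" "\<mu> < x \<bullet> e"
    and x: "x \<noteq> 0" "refl_hyp e \<mu> x \<noteq> 0" and le: "\<And>k. k \<in> J \<Longrightarrow> u k x \<le> u k (refl_hyp e \<mu> x)"
  shows "kf j x < kf j (refl_hyp e \<mu> x)"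
proof -
  let ?y = "refl_hyp e \<mu> x"
  have "(norm ?y)\<^sup>2 < (norm x)\<^sup>2" using norm_refl_hyp_sq[OF e, of \<mu> x] \<mu> by simp
  then have "lam j / (norm x)\<^sup>2 < lam j / (norm ?y)\<^sup>2"
    using x lam[OF j] by (intro divide_strict_left_mono mult_pos_pos) auto
  then have "lam j / (norm x)\<^sup>2 * u j x < lam j / (norm ?y)\<^sup>2 * u j x"
    using u_pos[OF j x(1)] by (intro mult_strict_right_mono) auto
  also have "\<dots> \<le> lam j / (norm ?y)\<^sup>2 * u j ?y" using lam[OF j] le[OF j] by (intro mult_left_mono) auto
  finally have 1: "lam j / (norm x)\<^sup>2 * u j x < lam j / (norm ?y)\<^sup>2 * u j ?y" .
  have "f j x \<le> f j ?y" unfolding f_def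
    by (rule F_mono[OF j]) (use u_pos[OF _ x(1)] le in \<open>auto simp: less_imp_le\<close>)
  with 1 show ?thesis by (simp add: kf_def)
qed

text \<open>This replaces the strong maximum principle. Write \<open>z = w e \<mu> j \<le> 0\<close>. Testing with the
  positive part of \<open>\<phi> + m z\<close> and letting \<open>m\<close> tend to infinity, the gradient terms concentrate
  on \<open>{z = 0}\<close>, where the gradient of \<open>z\<close> vanishes, while the right-hand side of the equation
  for \<open>z\<close> is strictly negative there because of the Hardy potential.\<close>

lemma w_nonzero_on_support:
  assumes j: "j \<in> J" and e: "norm e = 1" and \<mu>: "0 < \<mu>"
    and good: "AE x in lebesgue. vsum e \<mu> x = 0"
    and D: "has_D12_gradient \<phi> \<Phi>" and \<phi>: "\<And>x. 0 \<le> \<phi> x" "\<And>x. \<not> \<mu> < x \<bullet> e \<Longrightarrow> \<phi> x = 0"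
  shows "AE x in lebesgue. 0 < \<phi> x \<longrightarrow> w e \<mu> j x \<noteq> 0"
proof -
  let ?R = "refl_hyp e \<mu>"
  define z where "z = w e \<mu> j"
  define Z where "Z = w' e \<mu> j"
  have Dz: "has_D12_gradient z Z" unfolding z_def Z_def by (rule D_w[OF e j])
  note [measurable] = D12_measurable[OF D] D12_measurable[OF Dz] kf_measurable[OF j] measurable_comp_refl_hyp[OF e kf_measurable[OF j], of \<mu>]
  have z0: "AE x in lebesgue. z x \<le> 0"
    using good by eventually_elim (use j in \<open>auto simp: vsum_eq_0_iff z_def w_def\<close>)
  have kf_neg: "AE x in lebesgue. \<mu> < x \<bullet> e \<longrightarrow> kf j x < kf j (?R x)"
    using good AE_not_zero AE_refl_hyp_not_zero[OF e, of \<mu>]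
    by eventually_elim (auto simp: vsum_eq_0_iff intro!: kf_strict[OF j e \<mu>])
  define \<psi> where "\<psi> m x = max 0 (\<phi> x + real m * z x)" for m x
  define \<Psi> where "\<Psi> m x = (if \<phi> x + real m * z x > 0 then \<Phi> x + real m *\<^sub>R Z x else 0)" for m x
  have D\<psi>: "has_D12_gradient (\<psi> m) (\<Psi> m)" for m
    unfolding \<psi>_def[abs_def] \<Psi>_def[abs_def]
    by (intro D12_pos D12_add D12_cmult D Dz N)
  note ZL = D12_in_Lq(2)[OF Dz N] and \<Phi>L = D12_in_Lq(2)[OF D N]
  have two: "(2::real) > 1" "1 / (2::real) + 1 / 2 = 1" by auto
  have iZ\<Phi>: "integrable lebesgue (\<lambda>x. norm (Z x) * norm (\<Phi> x))"
    by (rule Lq_pair_integrable(2)[OF two(1) two(1) two(2) ZL \<Phi>L])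
  \<comment> \<open>Where \<open>\<Psi> m\<close> is nonzero, the product of Z with it is
    \<open>g m x\<close> plus m times the square of the norm of Z. Dropping this nonnegative term
    leaves an integrand bounded independently of m.\<close>
  define g where "g m x = (if \<phi> x + real m * z x > 0 then Z x \<bullet> \<Phi> x else 0)" for m x
  have gm [measurable]: "g m \<in> borel_measurable lebesgue" for m unfolding g_def[abs_def] by measurable
  have gb: "norm (g m x) \<le> norm (Z x) * norm (\<Phi> x)" for m x
    by (simp add: g_def Cauchy_Schwarz_ineq2)
  have ig: "integrable lebesgue (g m)" for m
    by (rule Bochner_Integration.integrable_bound[OF iZ\<Phi>]) (use gb in auto)
  have "(\<lambda>m. \<integral>x. g m x \<partial>lebesgue) \<longlonglongrightarrow> (\<integral>(x::real^'n). 0 \<partial>lebesgue)"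
  proof (rule integral_dominated_convergence[where w="\<lambda>x. norm (Z x) * norm (\<Phi> x)"])
    show "AE x in lebesgue. (\<lambda>m. g m x) \<longlonglongrightarrow> 0"
      using z0 D12_gradient_zero_level[OF Dz N]
    proof eventually_elim
      case (elim x)
      show ?case
      proof (cases "z x = 0")
        case True
        then show ?thesis using elim by (simp add: g_def)
      next
        case False
        with elim have zx: "z x < 0" by simp
        obtain M :: nat where M: "\<phi> x / (- z x) < real M" using reals_Archimedean2 by blast
        have "g m x = 0" if "m \<ge> M" for m
        proof -
          have "\<phi> x / (- z x) < real m" using M that by linarith
          then have "\<phi> x + real m * z x < 0" using zx by (simp add: field_simps)
          then show ?thesis by (simp add: g_def)
        qed
        then show ?thesis by (intro tendsto_eventually) (auto simp: eventually_sequentially)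
      qed
    qed
  qed (use iZ\<Phi> gb in auto)
  then have glim: "(\<lambda>m. \<integral>x. g m x \<partial>lebesgue) \<longlonglongrightarrow> 0" by simp
  \<comment> \<open>On {z = 0} the test function \<open>\<psi> m\<close> equals \<phi> for every m.
    Elsewhere the point lies in the half-space, so the factor from \<open>kf\<close> is negative and
    the integrand is at most 0.\<close>
  define h where "h x = (if z x = 0 then (kf j x - kf j (?R x)) * \<phi> x else 0)" for x
  have hm [measurable]: "h \<in> borel_measurable lebesgue" unfolding h_def[abs_def] by measurable
  have ih: "integrable lebesgue h"
    by (rule Bochner_Integration.integrable_bound[OF weak_eq_refl(1)[OF j D e, of \<mu>]]) (auto simp: h_def)
  have le: "(\<integral>x. g m x \<partial>lebesgue) \<le> (\<integral>x. h x \<partial>lebesgue)" for m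
  proof -
    have "(\<integral>x. g m x \<partial>lebesgue) \<le> (\<integral>x. (G j x - refl_hyp e 0 (G j (?R x))) \<bullet> \<Psi> m x \<partial>lebesgue)"
    proof (rule integral_mono_AE[OF ig weak_eq_refl(2)[OF j D\<psi> e]])
      show "AE x in lebesgue. g m x \<le> (G j x - refl_hyp e 0 (G j (?R x))) \<bullet> \<Psi> m x"
        using z0
      proof eventually_elim
        case (elim x)
        show ?case
        proof (cases "\<phi> x + real m * z x > 0")
          case True
          moreover have "real m * z x \<le> 0" using elim by (simp add: mult_nonneg_nonpos)
          ultimately have "\<phi> x \<noteq> 0" by linarith
          then have "\<mu> < x \<bullet> e" using \<phi>(2) by blast
          then have "G j x - refl_hyp e 0 (G j (?R x)) = Z x" by (simp add: Z_def w'_def)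
          then show ?thesis using True by (simp add: g_def \<Psi>_def inner_add_right)
        qed (simp add: g_def \<Psi>_def)
      qed
    qed
    also have "\<dots> = (\<integral>x. (kf j x - kf j (?R x)) * \<psi> m x \<partial>lebesgue)"
      by (rule weak_eq_refl(3)[OF j D\<psi> e])
    also have "\<dots> \<le> (\<integral>x. h x \<partial>lebesgue)"
    proof (rule integral_mono_AE[OF weak_eq_refl(1)[OF j D\<psi> e] ih])
      show "AE x in lebesgue. (kf j x - kf j (?R x)) * \<psi> m x \<le> h x"
        using z0 kf_neg
      proof eventually_elim
        case (elim x)
        show ?case
        proof (cases "z x = 0")
          case True
          then show ?thesis using \<phi>(1)[of x] by (simp add: h_def \<psi>_def)
        next
          case False
          then have "\<mu> < x \<bullet> e" unfolding z_def w_def by (auto split: if_splits)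
          then have "kf j x - kf j (?R x) \<le> 0" using elim by simp
          then have "(kf j x - kf j (?R x)) * \<psi> m x \<le> 0" by (rule mult_nonpos_nonneg) (simp add: \<psi>_def)
          then show ?thesis using False by (simp add: h_def)
        qed
      qed
    qed
    finally show ?thesis .
  qed
  have h_le: "AE x in lebesgue. 0 \<le> - h x"
    using kf_neg
  proof eventually_elim
    case (elim x)
    show ?case
    proof (cases "\<mu> < x \<bullet> e")
      case True
      then have "(kf j x - kf j (?R x)) * \<phi> x \<le> 0" using elim \<phi>(1)[of x] by (intro mult_nonpos_nonneg) auto
      then show ?thesis by (simp add: h_def)
    qed (simp add: h_def \<phi>(2))
  qed
  \<comment> \<open>The limit of the gradient terms gives the integral of h a sign opposite to that
    of h itself, so h = 0 almost everywhere; as the factor from \<open>kf\<close> is strictly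
    negative in the half-space, {z = 0} meets {\<phi> > 0} in a null set.\<close>
  have "0 \<le> (\<integral>x. h x \<partial>lebesgue)" by (rule LIMSEQ_le_const2[OF glim]) (use le in auto)
  moreover have "0 \<le> (\<integral>x. - h x \<partial>lebesgue)" by (rule integral_nonneg_AE[OF h_le])
  ultimately have "(\<integral>x. - h x \<partial>lebesgue) = 0" by simp
  then have "AE x in lebesgue. - h x = 0"
    using integral_nonneg_eq_0_iff_AE[of lebesgue "\<lambda>x. - h x"] ih h_le by simp
  then show ?thesis
    using kf_neg
  proof eventually_elim
    case (elim x)
    show ?case
    proof (intro impI notI)
      assume "0 < \<phi> x" "w e \<mu> j x = 0"
      then have "\<mu> < x \<bullet> e" "(kf j x - kf j (?R x)) * \<phi> x = 0" using \<phi>(2)[of x] elim(1) by (auto simp: h_def z_def)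
      with elim(2) \<open>0 < \<phi> x\<close> show False by simp
    qed
  qed
qed

text \<open>Countably many supports exhaust the half-space: take the approximants of
  \<open>u j\<close> itself, multiplied by \<open>x \<bullet> e - \<mu>\<close> so that they vanish
  on the mirror, and their absolute values. Because \<open>u j\<close> is positive, almost every
  point lies in one of these supports.\<close>

lemma strict_inequality:
  assumes j: "j \<in> J" and e: "norm e = 1" and \<mu>: "0 < \<mu>"
    and good: "AE x in lebesgue. vsum e \<mu> x = 0"
  shows "AE x in lebesgue. \<mu> < x \<bullet> e \<longrightarrow> u j x < u j (refl_hyp e \<mu> x)"
proof -
  obtain \<phi> where \<phi>: "\<And>m. test_fun (\<phi> m)" "AE x in lebesgue. (\<lambda>m::nat. \<phi> m x) \<longlonglongrightarrow> u j x"
    by (rule D12_approx_AE[OF D_u[OF j] N]) blast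
  have *: "AE x in lebesgue. \<mu> < x \<bullet> e \<and> \<phi> m x \<noteq> 0 \<longrightarrow> w e \<mu> j x \<noteq> 0" for m
  proof -
    define \<zeta> where "\<zeta> x = \<phi> m x * (x \<bullet> e + (- \<mu>))" for x
    have "test_fun \<zeta>"
      unfolding \<zeta>_def[abs_def] by (intro test_fun_mult \<phi> smooth_add smooth_inner smooth_const)
    then have "has_D12_gradient (\<lambda>x. if \<mu> < x \<bullet> e then \<zeta> x else 0) (\<lambda>x. if \<mu> < x \<bullet> e then grad \<zeta> x else 0)"
      by (rule D12_halfspace_test_fun[OF _ e _ N]) (simp add: \<zeta>_def)
    note D12_abs[OF this N]
    from w_nonzero_on_support[OF j e \<mu> good this] show ?thesis
      by (rule eventually_mono[rotated 2]) (auto simp: \<zeta>_def)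
  qed
  have "AE x in lebesgue. \<forall>m. \<mu> < x \<bullet> e \<and> \<phi> m x \<noteq> 0 \<longrightarrow> w e \<mu> j x \<noteq> 0"
    using * by (subst AE_all_countable) auto
  then show ?thesis
    using \<phi>(2) good AE_not_zero
  proof eventually_elim
    case (elim x)
    show ?case
    proof
      assume x: "\<mu> < x \<bullet> e"
      have "\<exists>m. \<phi> m x \<noteq> 0"
      proof (rule ccontr)
        assume "\<nexists>m. \<phi> m x \<noteq> 0"
        with elim(2) have "(\<lambda>m::nat. 0) \<longlonglongrightarrow> u j x" by simp
        with u_pos[OF j elim(4)] show False by (simp add: LIMSEQ_const_iff)
      qed
      with elim(1) x have "w e \<mu> j x \<noteq> 0" by auto
      moreover have "u j x \<le> u j (refl_hyp e \<mu> x)" using elim(3) j x by (auto simp: vsum_eq_0_iff)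
      ultimately show "u j x < u j (refl_hyp e \<mu> x)" using x by (simp add: w_def)
    qed
  qed
qed

end

section \<open>Moving planes and radial symmetry\<close>

text \<open>Bounded offsets keep all reflected supports inside one ball, which supplies the
  majorant; pointwise convergence is continuity of \<phi>.\<close>

lemma test_fun_refl_tendsto:
  fixes \<phi> :: "real^'n \<Rightarrow> real"
  assumes \<phi>: "test_fun \<phi>" and e: "norm e = 1" and q: "q > 0" and \<mu>: "\<mu> \<longlonglongrightarrow> \<mu>0"
  shows "(\<lambda>m. Lq_dist q (\<lambda>x. \<phi> (refl_hyp e (\<mu> m) x)) (\<lambda>x. \<phi> (refl_hyp e \<mu>0 x))) \<longlonglongrightarrow> 0"
proof -
  obtain K where K: "K > 0" "\<And>x. norm x > K \<Longrightarrow> \<phi> x = 0" by (rule test_fun_support[OF \<phi>]) blast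
  obtain B where B: "B > 0" "\<And>x. \<bar>\<phi> x\<bar> \<le> B" by (rule test_fun_bounded[OF \<phi>]) blast
  obtain M where M: "\<And>m. \<bar>\<mu> m\<bar> \<le> M"
    using convergent_imp_Bseq[of \<mu>] \<mu> by (auto simp: convergent_def Bseq_def)
  have M0: "\<bar>\<mu>0\<bar> \<le> M" by (rule LIMSEQ_le_const2[OF tendsto_rabs[OF \<mu>]]) (use M in auto)
  have zero: "\<phi> (refl_hyp e c x) = 0" if "\<bar>c\<bar> \<le> M" "norm x > K + 2 * M" for c x
  proof (rule K(2))
    have "norm x = norm (refl_hyp e 0 x)" using e by simp
    also have "\<dots> = norm (refl_hyp e c x - (2 * c) *\<^sub>R e)" by (subst refl_hyp_shift[of e c]) simp
    also have "\<dots> \<le> norm (refl_hyp e c x) + 2 * \<bar>c\<bar>"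
      using norm_triangle_ineq4[of "refl_hyp e c x" "(2 * c) *\<^sub>R e"] e by simp
    finally show "norm (refl_hyp e c x) > K" using that by linarith
  qed
  show ?thesis
  proof (rule Lq_dominated[where w="\<lambda>x::real^'n. 2 * B * indicator (cball 0 (K + 2 * M)) x"])
    show "(\<lambda>x. \<phi> (refl_hyp e (\<mu> m) x)) \<in> borel_measurable lebesgue" for m
      by (rule measurable_comp_refl_hyp[OF e]) (use \<phi> in auto)
    show "(\<lambda>x. \<phi> (refl_hyp e \<mu>0 x)) \<in> borel_measurable lebesgue"
      by (rule measurable_comp_refl_hyp[OF e]) (use \<phi> in auto)
    have "(\<lambda>m. \<phi> (refl_hyp e (\<mu> m) x)) \<longlonglongrightarrow> \<phi> (refl_hyp e \<mu>0 x)" for x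
    proof (rule isCont_tendsto_compose[where g=\<phi>])
      show "isCont \<phi> (refl_hyp e \<mu>0 x)"
        using smooth_continuous[OF test_fun_smooth[OF \<phi>], of UNIV] by (simp add: continuous_on_eq_continuous_at)
      show "(\<lambda>m. refl_hyp e (\<mu> m) x) \<longlonglongrightarrow> refl_hyp e \<mu>0 x"
        unfolding refl_hyp_def by (intro tendsto_intros \<mu>)
    qed
    then show "AE x in lebesgue. (\<lambda>m. \<phi> (refl_hyp e (\<mu> m) x)) \<longlonglongrightarrow> \<phi> (refl_hyp e \<mu>0 x)" by simp
    have "norm (\<phi> (refl_hyp e (\<mu> m) x) - \<phi> (refl_hyp e \<mu>0 x)) \<le> norm (2 * B * indicator (cball 0 (K + 2 * M)) x :: real)" for m x
    proof (cases "norm x > K + 2 * M")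
      case True
      then show ?thesis using zero[OF M True, of m] zero[OF M0 True] by simp
    next
      case False
      then show ?thesis
        using B(2)[of "refl_hyp e (\<mu> m) x"] B(2)[of "refl_hyp e \<mu>0 x"] B(1) by (simp add: indicator_def)
    qed
    then show "AE x in lebesgue. norm (\<phi> (refl_hyp e (\<mu> m) x) - \<phi> (refl_hyp e \<mu>0 x)) \<le> norm (2 * B * indicator (cball 0 (K + 2 * M)) x :: real)" for m
      by simp
  qed (auto intro: in_Lq_indicator_cball q)
qed

text \<open>Reflections preserve the distance to an approximating test function, so the error made
  by the approximation is the same for all offsets, and continuity has to be checked for one fixed
  test function only.\<close>

lemma D12_refl_tendsto:
  fixes u :: "real^'n \<Rightarrow> real"
  assumes D: "has_D12_gradient u G" and N: "3 \<le> CARD('n)" and e: "norm e = 1" and \<mu>: "\<mu> \<longlonglongrightarrow> \<mu>0"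
  shows "(\<lambda>m. Lq_dist (sobolev_exp CARD('n)) (\<lambda>x. u (refl_hyp e (\<mu> m) x)) (\<lambda>x. u (refl_hyp e \<mu>0 x))) \<longlonglongrightarrow> 0"
proof -
  define p where "p = sobolev_exp CARD('n)"
  have p: "p > 2" unfolding p_def by (rule sobolev_exp_gt_2[OF N])
  obtain \<phi> where \<phi>: "\<And>k. test_fun (\<phi> k)" "(\<lambda>k::nat. Lq_dist p (\<phi> k) u) \<longlonglongrightarrow> 0"
    unfolding p_def by (rule D12_approx[OF D]) blast
  define C where "C = ennreal (2 powr p)"
  define a where "a m = Lq_dist p (\<lambda>x. u (refl_hyp e (\<mu> m) x)) (\<lambda>x. u (refl_hyp e \<mu>0 x))" for m
  define b where "b k m = Lq_dist p (\<lambda>x. \<phi> k (refl_hyp e (\<mu> m) x)) (\<lambda>x. \<phi> k (refl_hyp e \<mu>0 x))" for k m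
  have meas: "(\<lambda>x. u (refl_hyp e c x)) \<in> borel_measurable lebesgue" "(\<lambda>x. \<phi> k (refl_hyp e c x)) \<in> borel_measurable lebesgue" for c k
    by (rule measurable_comp_refl_hyp[OF e], use D12_measurable[OF D] \<phi>(1) in auto)+
  have d: "Lq_dist p (\<lambda>x. \<phi> k (refl_hyp e c x)) (\<lambda>x. u (refl_hyp e c x)) = Lq_dist p (\<phi> k) u" for c k
    by (rule Lq_dist_refl_hyp[OF e]) (use D12_measurable[OF D] \<phi>(1) in auto)
  \<comment> \<open>Two applications of the quasi-triangle inequality: the first summand collects
    the approximation errors at both ends, with factors C and C^2, the second is the distance
    between the two reflections of \<open>\<phi> k\<close>.\<close>
  have le: "a m \<le> (C * Lq_dist p (\<phi> k) u + C * (C * Lq_dist p (\<phi> k) u)) + C * (C * b k m)" for k m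
  proof -
    have "a m \<le> C * (Lq_dist p (\<lambda>x. u (refl_hyp e (\<mu> m) x)) (\<lambda>x. \<phi> k (refl_hyp e (\<mu> m) x)) +
        Lq_dist p (\<lambda>x. \<phi> k (refl_hyp e (\<mu> m) x)) (\<lambda>x. u (refl_hyp e \<mu>0 x)))"
      unfolding a_def C_def by (rule Lq_dist_triangle[OF meas(1) meas(2) meas(1)]) (use p in simp)
    also have "Lq_dist p (\<lambda>x. u (refl_hyp e (\<mu> m) x)) (\<lambda>x. \<phi> k (refl_hyp e (\<mu> m) x)) = Lq_dist p (\<phi> k) u"
      by (subst Lq_dist_commute) (rule d)
    also have "Lq_dist p (\<lambda>x. \<phi> k (refl_hyp e (\<mu> m) x)) (\<lambda>x. u (refl_hyp e \<mu>0 x)) \<le>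
        C * (b k m + Lq_dist p (\<lambda>x. \<phi> k (refl_hyp e \<mu>0 x)) (\<lambda>x. u (refl_hyp e \<mu>0 x)))"
      unfolding b_def C_def by (rule Lq_dist_triangle[OF meas(2) meas(2) meas(1)]) (use p in simp)
    also have "Lq_dist p (\<lambda>x. \<phi> k (refl_hyp e \<mu>0 x)) (\<lambda>x. u (refl_hyp e \<mu>0 x)) = Lq_dist p (\<phi> k) u" by (rule d)
    finally show ?thesis by (simp add: distrib_left add.commute add.left_commute mult_left_mono)
  qed
  have lim0: "(\<lambda>k. C * X k) \<longlonglongrightarrow> 0" if "X \<longlonglongrightarrow> 0" for X :: "nat \<Rightarrow> ennreal"
    using tendsto_mult_ennreal[OF tendsto_const[of C] that] by (simp add: C_def)
  have "a \<longlonglongrightarrow> 0"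
  proof (rule order_tendstoI)
    fix \<epsilon> :: ennreal assume "0 < \<epsilon>"
    obtain s where s: "s > 0" "ennreal s < \<epsilon>"
    proof (cases \<epsilon>)
      case (real t)
      then show ?thesis using \<open>0 < \<epsilon>\<close> that[of "t / 2"] by (auto simp: ennreal_less_iff)
    qed (use that[of 1] in auto)
    have s2: "ennreal (s / 2) > 0" using s by simp
    have "(\<lambda>k. C * Lq_dist p (\<phi> k) u + C * (C * Lq_dist p (\<phi> k) u)) \<longlonglongrightarrow> 0"
      using tendsto_add[OF lim0[OF \<phi>(2)] lim0[OF lim0[OF \<phi>(2)]]] by simp
    from order_tendstoD(2)[OF this s2] obtain k where
      k: "C * Lq_dist p (\<phi> k) u + C * (C * Lq_dist p (\<phi> k) u) < ennreal (s / 2)"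
      by (auto simp: eventually_sequentially)
    have "(\<lambda>m. C * (C * b k m)) \<longlonglongrightarrow> 0"
      unfolding b_def by (intro lim0 test_fun_refl_tendsto[OF \<phi>(1) e _ \<mu>]) (use p in simp)
    from order_tendstoD(2)[OF this s2] show "\<forall>\<^sub>F m in sequentially. a m < \<epsilon>"
    proof eventually_elim
      case (elim m)
      have "a m \<le> ennreal (s / 2) + ennreal (s / 2)"
        by (rule order_trans[OF le[of m k]]) (intro add_mono less_imp_le k elim)
      also have "\<dots> = ennreal s" using s by (simp add: ennreal_plus[symmetric] del: ennreal_plus)
      also note s(2)
      finally show ?case .
    qed
  qed simp
  then show ?thesis by (simp add: a_def[abs_def] p_def)
qed

section \<open>The continuity argument in the offset \<mu>\<close>

context positive_system
begin

text \<open>Convergence in the critical norm gives convergence almost everywhere only along a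
  subsequence; summing over the components before extracting yields one subsequence for all of
  them.\<close>

lemma refl_subseq:
  assumes e: "norm e = 1" and \<mu>: "\<mu> \<longlonglongrightarrow> \<mu>0"
  obtains s where "strict_mono s"
    "AE x in lebesgue. \<forall>j\<in>J. (\<lambda>m::nat. u j (refl_hyp e (\<mu> (s m)) x)) \<longlonglongrightarrow> u j (refl_hyp e \<mu>0 x)"
proof -
  have meas: "j \<in> J \<Longrightarrow> (\<lambda>x. u j (refl_hyp e c x)) \<in> borel_measurable lebesgue" for c j
    by (rule measurable_comp_refl_hyp[OF e u_measurable])
  define h where "h m x = (\<Sum>j\<in>J. ennreal (norm (u j (refl_hyp e (\<mu> m) x) - u j (refl_hyp e \<mu>0 x)) powr p))" for m x
  have meas': "(\<lambda>x. ennreal (norm (a x - b x) powr p)) \<in> borel_measurable lebesgue"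
    if [measurable]: "a \<in> borel_measurable lebesgue" "b \<in> borel_measurable lebesgue" for a b :: "real^'n \<Rightarrow> real"
    by measurable
  have hm: "h m \<in> borel_measurable lebesgue" for m
    unfolding h_def[abs_def] by (intro borel_measurable_sum meas' meas)
  have "(\<lambda>m. \<integral>\<^sup>+x. h m x \<partial>lebesgue) \<longlonglongrightarrow> 0"
  proof -
    have "(\<integral>\<^sup>+x. h m x \<partial>lebesgue) = (\<Sum>j\<in>J. Lq_dist p (\<lambda>x. u j (refl_hyp e (\<mu> m) x)) (\<lambda>x. u j (refl_hyp e \<mu>0 x)))" for m
      unfolding h_def Lq_dist_def by (intro nn_integral_sum meas' meas)
    moreover have "(\<lambda>m. \<Sum>j\<in>J. Lq_dist p (\<lambda>x. u j (refl_hyp e (\<mu> m) x)) (\<lambda>x. u j (refl_hyp e \<mu>0 x))) \<longlonglongrightarrow> (\<Sum>j\<in>J. 0)"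
      unfolding p_def by (intro tendsto_sum D12_refl_tendsto[OF D_u N e \<mu>])
    ultimately show ?thesis by simp
  qed
  from L1_AE_subseq[OF hm this] obtain s where
    s: "strict_mono s" "AE x in lebesgue. (\<lambda>m. h (s m) x) \<longlonglongrightarrow> 0" by blast
  have "AE x in lebesgue. \<forall>j\<in>J. (\<lambda>m::nat. u j (refl_hyp e (\<mu> (s m)) x)) \<longlonglongrightarrow> u j (refl_hyp e \<mu>0 x)"
    using s(2)
  proof eventually_elim
    case (elim x)
    show ?case
    proof
      fix j assume j: "j \<in> J"
      have "(\<lambda>m. ennreal (norm (u j (refl_hyp e (\<mu> (s m)) x) - u j (refl_hyp e \<mu>0 x)) powr p)) \<longlonglongrightarrow> 0"
        by (rule tendsto_0_le_ennreal[OF _ elim]) (unfold h_def, rule member_le_sum, use j in auto)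
      then have "(\<lambda>m. norm (u j (refl_hyp e (\<mu> (s m)) x) - u j (refl_hyp e \<mu>0 x)) powr p) \<longlonglongrightarrow> 0"
        by (subst (asm) ennreal_tendsto_0_iff) auto
      then have "(\<lambda>m. (norm (u j (refl_hyp e (\<mu> (s m)) x) - u j (refl_hyp e \<mu>0 x)) powr p) powr (1 / p)) \<longlonglongrightarrow> 0 powr (1 / p)"
        by (rule tendsto_powr'[OF _ tendsto_const]) (use p in auto)
      then have "(\<lambda>m. norm (u j (refl_hyp e (\<mu> (s m)) x) - u j (refl_hyp e \<mu>0 x))) \<longlonglongrightarrow> 0"
        using p by (simp add: powr_powr)
      then show "(\<lambda>m. u j (refl_hyp e (\<mu> (s m)) x)) \<longlonglongrightarrow> u j (refl_hyp e \<mu>0 x)"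
        unfolding tendsto_norm_zero_iff by (rule LIM_zero_cancel)
    qed
  qed
  with s(1) show thesis by (rule that)
qed

definition good :: "real^'n \<Rightarrow> real \<Rightarrow> bool" where
  "good e \<mu> \<longleftrightarrow> (AE x in lebesgue. vsum e \<mu> x = 0)"

text \<open>A point beyond the limiting hyperplane eventually lies beyond the approximating ones,
  where the non-strict inequality holds and passes to the limit.\<close>

lemma good_limit:
  assumes e: "norm e = 1" and \<mu>: "\<mu> \<longlonglongrightarrow> \<mu>0" and g: "\<And>m::nat. good e (\<mu> m)"
  shows "good e \<mu>0"
proof -
  obtain s where s: "strict_mono s"
    "AE x in lebesgue. \<forall>j\<in>J. (\<lambda>m::nat. u j (refl_hyp e (\<mu> (s m)) x)) \<longlonglongrightarrow> u j (refl_hyp e \<mu>0 x)"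
    by (rule refl_subseq[OF e \<mu>]) blast
  have \<mu>s: "(\<lambda>m. \<mu> (s m)) \<longlonglongrightarrow> \<mu>0" using LIMSEQ_subseq_LIMSEQ[OF \<mu> s(1)] by (simp add: o_def)
  have "AE x in lebesgue. \<forall>m. vsum e (\<mu> m) x = 0"
    using g unfolding good_def by (subst AE_all_countable) auto
  then show ?thesis unfolding good_def using s(2)
  proof eventually_elim
    case (elim x)
    show ?case unfolding vsum_eq_0_iff
    proof (intro ballI impI)
      fix j assume j: "j \<in> J" and x: "\<mu>0 < x \<bullet> e"
      from order_tendstoD(2)[OF \<mu>s x]
      have "\<forall>\<^sub>F m in sequentially. u j x \<le> u j (refl_hyp e (\<mu> (s m)) x)"
        by eventually_elim (use elim(1) j in \<open>auto simp: vsum_eq_0_iff\<close>)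
      with elim(2) j show "u j x \<le> u j (refl_hyp e \<mu>0 x)"
        by (intro tendsto_lowerbound[of _ _ sequentially]) auto
    qed
  qed
qed

lemma mass_integrand_measurable:
  "norm e = 1 \<Longrightarrow> (\<lambda>x. if 0 < vsum e \<mu> x then ennreal (\<bar>U x\<bar> powr p) else 0) \<in> borel_measurable lebesgue"
proof -
  assume e: "norm e = 1"
  note [measurable] = D12_measurable(1)[OF D_vsum[OF e, of \<mu>]]
  show ?thesis by measurable
qed

text \<open>Almost every point eventually leaves the failure set: beyond the hyperplane at
  \<open>\<mu>0\<close> by the strict inequality there, on the other side because it is outside the
  half-space, while the hyperplane itself is null. The majorant is \<open>U powr p\<close>.\<close>

lemma mass_tendsto_0:
  assumes e: "norm e = 1" and \<mu>: "\<mu> \<longlonglongrightarrow> \<mu>0" and \<mu>0: "0 < \<mu>0" and g: "good e \<mu>0"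
  obtains s where "strict_mono s" "(\<lambda>m::nat. mass e (\<mu> (s m))) \<longlonglongrightarrow> 0"
proof -
  obtain s where s: "strict_mono s"
    "AE x in lebesgue. \<forall>j\<in>J. (\<lambda>m::nat. u j (refl_hyp e (\<mu> (s m)) x)) \<longlonglongrightarrow> u j (refl_hyp e \<mu>0 x)"
    by (rule refl_subseq[OF e \<mu>]) blast
  have \<mu>s: "(\<lambda>m. \<mu> (s m)) \<longlonglongrightarrow> \<mu>0" using LIMSEQ_subseq_LIMSEQ[OF \<mu> s(1)] by (simp add: o_def)
  have strict: "AE x in lebesgue. \<forall>j\<in>J. \<mu>0 < x \<bullet> e \<longrightarrow> u j x < u j (refl_hyp e \<mu>0 x)"
    by (rule AE_finite_allI) (auto intro!: strict_inequality e \<mu>0 g[unfolded good_def])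
  have "(\<lambda>m. mass e (\<mu> (s m))) \<longlonglongrightarrow> (\<integral>\<^sup>+(x::real^'n). 0 \<partial>lebesgue)"
    unfolding mass_def
  proof (rule nn_integral_dominated_convergence[where w="\<lambda>x. ennreal (\<bar>U x\<bar> powr p)"])
    show "AE x in lebesgue. (\<lambda>m. if 0 < vsum e (\<mu> (s m)) x then ennreal (\<bar>U x\<bar> powr p) else 0) \<longlonglongrightarrow> 0"
      using s(2) strict AE_not_hyperplane[OF e, of \<mu>0]
    proof eventually_elim
      case (elim x)
      have "\<forall>\<^sub>F m in sequentially. vsum e (\<mu> (s m)) x = 0"
      proof (cases "\<mu>0 < x \<bullet> e")
        case True
        have "\<forall>\<^sub>F m in sequentially. \<forall>j\<in>J. u j x < u j (refl_hyp e (\<mu> (s m)) x)"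
        proof (rule eventually_ball_finite)
          show "\<forall>j\<in>J. \<forall>\<^sub>F m in sequentially. u j x < u j (refl_hyp e (\<mu> (s m)) x)"
            using elim(1,2) True order_tendstoD(1) by blast
        qed simp
        then show ?thesis by eventually_elim (auto simp: vsum_eq_0_iff)
      next
        case False
        with elim(3) have "x \<bullet> e < \<mu>0" by simp
        from order_tendstoD(1)[OF \<mu>s this] show ?thesis
          by eventually_elim (auto simp: vsum_eq_0_iff)
      qed
      then have "\<forall>\<^sub>F m in sequentially. (if 0 < vsum e (\<mu> (s m)) x then ennreal (\<bar>U x\<bar> powr p) else 0) = 0"
        by eventually_elim simp
      then show ?case by (rule tendsto_eventually)
    qed
  qed (use U_Lp mass_integrand_measurable[OF e] in \<open>auto simp: in_Lq_def\<close>)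
  with s(1) show thesis by (intro that) auto
qed

text \<open>Failure sets lie inside the half-spaces, and far half-spaces carry little of the
  integral of \<open>U powr p\<close>.\<close>

lemma good_large:
  assumes e: "norm e = 1"
  obtains M where "M > 0" "\<And>\<mu>. M \<le> \<mu> \<Longrightarrow> good e \<mu>"
proof -
  obtain \<delta> where \<delta>: "\<delta> > 0"
    "\<And>e \<mu>. norm e = 1 \<Longrightarrow> 0 \<le> \<mu> \<Longrightarrow> mass e \<mu> < ennreal \<delta> \<Longrightarrow> AE x in lebesgue. vsum e \<mu> x = 0"
    by (rule small_mass) blast
  define T where "T m = (\<integral>\<^sup>+x. (if real m < x \<bullet> e then ennreal (\<bar>U x\<bar> powr p) else 0) \<partial>lebesgue)" for m :: nat
  have "T \<longlonglongrightarrow> (\<integral>\<^sup>+(x::real^'n). 0 \<partial>lebesgue)"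
    unfolding T_def
  proof (rule nn_integral_dominated_convergence[where w="\<lambda>x. ennreal (\<bar>U x\<bar> powr p)"])
    have "(\<lambda>m. if real m < x \<bullet> e then ennreal (\<bar>U x\<bar> powr p) else 0) \<longlonglongrightarrow> 0" for x
    proof (rule tendsto_eventually)
      obtain M :: nat where "x \<bullet> e \<le> real M" using real_arch_simple by blast
      then show "\<forall>\<^sub>F m in sequentially. (if real m < x \<bullet> e then ennreal (\<bar>U x\<bar> powr p) else 0) = 0"
        by (intro eventually_sequentiallyI[of M]) auto
    qed
    then show "AE x in lebesgue. (\<lambda>m. if real m < x \<bullet> e then ennreal (\<bar>U x\<bar> powr p) else 0) \<longlonglongrightarrow> 0" by simp
  qed (use U_Lp in \<open>auto simp: in_Lq_def\<close>)
  then have "T \<longlonglongrightarrow> 0" by simp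
  from order_tendstoD(2)[OF this, of "ennreal \<delta>"] obtain M where M: "T M < ennreal \<delta>"
    using \<delta>(1) by (auto simp: eventually_sequentially)
  show thesis
  proof (rule that[of "real M + 1"])
    fix \<mu> assume \<mu>: "real M + 1 \<le> \<mu>"
    have "mass e \<mu> \<le> T M"
      unfolding mass_def T_def
    proof (intro nn_integral_mono)
      fix x
      have "real M < x \<bullet> e" if "0 < vsum e \<mu> x"
      proof (rule ccontr)
        assume "\<not> real M < x \<bullet> e"
        then have "vsum e \<mu> x = 0" unfolding vsum_eq_0_iff using \<mu> by auto
        with that show False by simp
      qed
      then show "(if 0 < vsum e \<mu> x then ennreal (\<bar>U x\<bar> powr p) else 0) \<le> (if real M < x \<bullet> e then ennreal (\<bar>U x\<bar> powr p) else 0)"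
        by auto
    qed
    then show "good e \<mu>" unfolding good_def using \<delta>(2)[OF e, of \<mu>] M \<mu> by simp
  qed simp
qed

text \<open>By contradiction: bad offsets approaching \<open>\<mu>0\<close> from below would have a
  subsequence whose mass tends to 0, and the uniform threshold makes one of them good.\<close>

lemma good_near:
  assumes e: "norm e = 1" and \<mu>0: "0 < \<mu>0" and g: "good e \<mu>0"
  obtains \<epsilon> where "0 < \<epsilon>" "\<epsilon> < \<mu>0" "\<And>\<mu>. \<mu>0 - \<epsilon> < \<mu> \<Longrightarrow> \<mu> < \<mu>0 \<Longrightarrow> good e \<mu>"
proof -
  obtain \<delta> where \<delta>: "\<delta> > 0"
    "\<And>e \<mu>. norm e = 1 \<Longrightarrow> 0 \<le> \<mu> \<Longrightarrow> mass e \<mu> < ennreal \<delta> \<Longrightarrow> AE x in lebesgue. vsum e \<mu> x = 0"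
    by (rule small_mass) blast
  \<comment> \<open>The denominator \<open>real m + 2\<close> keeps the width at most
    \<open>\<mu>0 / 2\<close>, so all offsets considered are positive and the width is below
    \<open>\<mu>0\<close>.\<close>
  have "\<exists>m::nat. \<forall>\<mu>. \<mu>0 - \<mu>0 / (real m + 2) < \<mu> \<and> \<mu> < \<mu>0 \<longrightarrow> good e \<mu>"
  proof (rule ccontr)
    assume "\<nexists>m::nat. \<forall>\<mu>. \<mu>0 - \<mu>0 / (real m + 2) < \<mu> \<and> \<mu> < \<mu>0 \<longrightarrow> good e \<mu>"
    then have "\<forall>m::nat. \<exists>\<mu>. \<mu>0 - \<mu>0 / (real m + 2) < \<mu> \<and> \<mu> < \<mu>0 \<and> \<not> good e \<mu>" by blast
    then obtain \<mu> where \<mu>: "\<And>m::nat. \<mu>0 - \<mu>0 / (real m + 2) < \<mu> m" "\<And>m. \<mu> m < \<mu>0" "\<And>m. \<not> good e (\<mu> m)" by metis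
    have "(\<lambda>m. \<mu>0 / (real m + 2)) \<longlonglongrightarrow> 0"
      using LIMSEQ_ignore_initial_segment[OF lim_const_over_n[of \<mu>0], of 2] by (simp add: add.commute)
    then have "(\<lambda>m. \<mu>0 - \<mu>0 / (real m + 2)) \<longlonglongrightarrow> \<mu>0 - 0" by (intro tendsto_intros)
    then have l: "(\<lambda>m. \<mu>0 - \<mu>0 / (real m + 2)) \<longlonglongrightarrow> \<mu>0" by simp
    have lim: "\<mu> \<longlonglongrightarrow> \<mu>0"
      by (rule tendsto_sandwich[OF _ _ l tendsto_const]) (use \<mu> in \<open>auto intro!: always_eventually less_imp_le\<close>)
    obtain s where s: "strict_mono s" "(\<lambda>m::nat. mass e (\<mu> (s m))) \<longlonglongrightarrow> 0"
      by (rule mass_tendsto_0[OF e lim \<mu>0 g]) blast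
    from order_tendstoD(2)[OF s(2), of "ennreal \<delta>"] obtain m where m: "mass e (\<mu> (s m)) < ennreal \<delta>"
      using \<delta>(1) by (auto simp: eventually_sequentially)
    have "\<mu>0 / (real (s m) + 2) \<le> \<mu>0" using \<mu>0 by (simp add: field_simps)
    then have "0 \<le> \<mu> (s m)" using \<mu>(1)[of "s m"] by linarith
    from \<delta>(2)[OF e this m] \<mu>(3)[of "s m"] show False by (simp add: good_def)
  qed
  then obtain m :: nat where m: "\<And>\<mu>. \<mu>0 - \<mu>0 / (real m + 2) < \<mu> \<Longrightarrow> \<mu> < \<mu>0 \<Longrightarrow> good e \<mu>" by blast
  show thesis
    by (rule that[of "\<mu>0 / (real m + 2)"]) (use m \<mu>0 in \<open>auto simp: field_simps intro!: add_pos_nonneg\<close>)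
qed

lemma good_0:
  assumes e: "norm e = 1"
  shows "good e 0"
proof -
  \<comment> \<open>Requiring all larger offsets to be good makes \<open>P\<close> upward closed, so
    that every offset above its infimum is good.\<close>
  define P where "P = {\<mu>. 0 < \<mu> \<and> (\<forall>\<mu>'\<ge>\<mu>. good e \<mu>')}"
  obtain M where M: "M > 0" "\<And>\<mu>. M \<le> \<mu> \<Longrightarrow> good e \<mu>" by (rule good_large[OF e]) blast
  have ne: "P \<noteq> {}" using M by (auto simp: P_def)
  have bdd: "bdd_below P" by (rule bdd_belowI[of _ 0]) (auto simp: P_def)
  define I where "I = Inf P"
  have I0: "0 \<le> I" unfolding I_def by (rule cInf_greatest[OF ne]) (auto simp: P_def)
  have above: "good e \<mu>" if "I < \<mu>" for \<mu>
  proof -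
    from that obtain \<nu> where "\<nu> \<in> P" "\<nu> < \<mu>" unfolding I_def using cInf_less_iff[OF ne bdd] by auto
    then show ?thesis by (auto simp: P_def)
  qed
  have gI: "good e I"
  proof (rule good_limit[OF e])
    have "(\<lambda>m. I + 1 / real (Suc m)) \<longlonglongrightarrow> I + 0"
      using LIMSEQ_inverse_real_of_nat by (intro tendsto_intros) (simp add: inverse_eq_divide)
    then show "(\<lambda>m. I + 1 / real (Suc m)) \<longlonglongrightarrow> I" by simp
  qed (rule above, simp)
  have "I = 0"
  proof (rule ccontr)
    assume "I \<noteq> 0"
    with I0 have "0 < I" by simp
    obtain \<epsilon> where \<epsilon>: "0 < \<epsilon>" "\<epsilon> < I" "\<And>\<mu>. I - \<epsilon> < \<mu> \<Longrightarrow> \<mu> < I \<Longrightarrow> good e \<mu>"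
      by (rule good_near[OF e \<open>0 < I\<close> gI]) blast
    have "good e \<mu>" if "\<mu> \<ge> I - \<epsilon> / 2" for \<mu>
    proof -
      consider "\<mu> < I" | "\<mu> = I" | "I < \<mu>" by linarith
      then show ?thesis using that \<epsilon> gI above by cases auto
    qed
    then have "I - \<epsilon> / 2 \<in> P" using \<epsilon> by (simp add: P_def)
    then have "I \<le> I - \<epsilon> / 2" unfolding I_def by (rule cInf_lower[OF _ bdd])
    with \<epsilon> show False by simp
  qed
  with gI show ?thesis by simp
qed

section \<open>Reflection invariance and radial symmetry\<close>

lemma reflection_symmetric:
  assumes e: "norm e = 1" and j: "j \<in> J"
  shows "AE x in lebesgue. u j (refl_hyp e 0 x) = u j x"
proof -
  have e': "norm (- e) = 1" using e by simp
  \<comment> \<open>The directions e and -e define the same reflection but opposite half-spaces, so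
    the inequality at offset 0 holds on both sides; evaluated at the reflected point, it is the
    reverse inequality.\<close>
  have R: "refl_hyp (- e) 0 x = refl_hyp e 0 x" for x by (simp add: refl_hyp_def)
  have 1: "AE x in lebesgue. 0 < x \<bullet> e \<longrightarrow> u j x \<le> u j (refl_hyp e 0 x)"
    using good_0[OF e] unfolding good_def by eventually_elim (use j in \<open>auto simp: vsum_eq_0_iff\<close>)
  have 2: "AE x in lebesgue. x \<bullet> e < 0 \<longrightarrow> u j x \<le> u j (refl_hyp e 0 x)"
    using good_0[OF e'] unfolding good_def by eventually_elim (use j in \<open>auto simp: vsum_eq_0_iff R\<close>)
  show ?thesis
    using 1 2 AE_refl_hyp[OF e 1, of 0] AE_refl_hyp[OF e 2, of 0] AE_not_hyperplane[OF e, of 0]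
    by eventually_elim (use e in \<open>auto simp: refl_hyp_inner\<close>)
qed

end

text \<open>For a point \<open>x\<close>, the map \<open>e \<mapsto> \<bar>e\<bar>\<^sup>2 R\<^sub>e x\<close>, where \<open>R\<^sub>e\<close> is the reflection that maps \<open>e\<close>
  to \<open>-e\<close>, is polynomial and preserves null sets. So if \<open>u (R\<^sub>e x) = u x\<close> for almost all \<open>e\<close>,
  then \<open>u\<close> takes the value \<open>u x\<close> at almost all points of the sphere through \<open>x\<close>, the points
  being parametrised by radial projection from the whole space.\<close>

lemma negligible_sphere_values:
  fixes u :: "real^'n \<Rightarrow> real"
  assumes x: "x \<noteq> 0" and neg: "negligible {e. u (x - (2 * (x \<bullet> e) / (e \<bullet> e)) *\<^sub>R e) \<noteq> u x}"
  shows "negligible {z. u ((norm x / norm z) *\<^sub>R z) \<noteq> u x}"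
proof -
  define E where "E = {e. u (x - (2 * (x \<bullet> e) / (e \<bullet> e)) *\<^sub>R e) \<noteq> u x}"
  define F where "F e = (e \<bullet> e) *\<^sub>R x - (2 * (x \<bullet> e)) *\<^sub>R e" for e
  have "negligible (F ` E)"
  proof (rule negligible_differentiable_image_negligible)
    show "negligible E" using neg by (simp add: E_def)
    show "F differentiable_on E"
      unfolding F_def
      by (rule differentiable_at_imp_differentiable_on, rule differentiableI)
         (auto intro!: derivative_eq_intros)
  qed simp
  then have "negligible (insert 0 (F ` E))" by (simp add: negligible_insert)
  moreover have "{z. u ((norm x / norm z) *\<^sub>R z) \<noteq> u x} \<subseteq> insert 0 (F ` E)"
  proof
    fix z assume z: "z \<in> {z. u ((norm x / norm z) *\<^sub>R z) \<noteq> u x}"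
    show "z \<in> insert 0 (F ` E)"
    proof (cases "z = 0")
      case False
      define a where "a = x /\<^sub>R norm x"
      define b where "b = z /\<^sub>R norm z"
      \<comment> \<open>The reflection along the difference of two unit vectors exchanges them, so
        this direction carries x to the prescribed point of its sphere.\<close>
      define d where "d = a - b"
      have ab: "a \<bullet> a = 1" "b \<bullet> b = 1" "x = norm x *\<^sub>R a" "z = norm z *\<^sub>R b"
        using x False by (simp_all add: a_def b_def dot_square_norm power2_eq_square)
      have xb: "(norm x / norm z) *\<^sub>R z = norm x *\<^sub>R b" by (simp add: b_def divide_inverse)
      have "d \<noteq> 0"
      proof
        assume "d = 0"
        then have "norm x *\<^sub>R b = x" using ab(3) by (simp add: d_def)
        with z xb show False by simp
      qed
      then have dd: "d \<bullet> d > 0" by simp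
      have ad: "2 * (a \<bullet> d) = d \<bullet> d"
        using ab by (simp add: d_def inner_diff_left inner_diff_right inner_commute)
      \<comment> \<open>\<open>F\<close> is homogeneous of degree 2 and \<open>F d\<close> has norm
        \<open>norm x * (d \<bullet> d)\<close>; the factor s adjusts its length to that of z
        without changing the reflection.\<close>
      define s where "s = sqrt (norm z / (norm x * (d \<bullet> d)))"
      have s: "s > 0" "s * s * (norm x * (d \<bullet> d)) = norm z"
        using False x dd by (simp_all add: s_def)
      define e where "e = s *\<^sub>R d"
      have xe: "2 * (x \<bullet> e) = norm x * s * (d \<bullet> d)"
        by (subst ab(3)) (simp add: e_def ad[symmetric])
      have ee: "e \<bullet> e = s * s * (d \<bullet> d)" by (simp add: e_def)
      have "2 * (x \<bullet> e) / (e \<bullet> e) = norm x / s" unfolding xe ee using s(1) dd by (simp add: field_simps)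
      then have "(2 * (x \<bullet> e) / (e \<bullet> e)) *\<^sub>R e = norm x *\<^sub>R d" using s(1) by (simp add: e_def)
      then have rx: "x - (2 * (x \<bullet> e) / (e \<bullet> e)) *\<^sub>R e = norm x *\<^sub>R b"
        using ab(3) by (simp add: d_def scaleR_diff_right)
      have "e \<in> E" unfolding E_def using z xb rx by simp
      moreover have "F e = z"
      proof -
        have "F e = (e \<bullet> e) *\<^sub>R (x - (2 * (x \<bullet> e) / (e \<bullet> e)) *\<^sub>R e)"
          using s(1) dd by (simp add: F_def scaleR_diff_right ee)
        also have "\<dots> = (s * s * (norm x * (d \<bullet> d))) *\<^sub>R b" unfolding rx by (simp add: ee mult_ac)
        also have "\<dots> = z" using s(2) ab(4) by simp
        finally show ?thesis .
      qed
      ultimately show ?thesis by blast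
    qed simp
  qed
  ultimately show ?thesis by (rule negligible_subset)
qed

text \<open>Fubini exchanges the quantifiers over directions and points, which requires a Borel
  representative \<open>u0\<close> for joint measurability. For almost every x the function
  \<open>u0\<close> is then essentially constant along the sphere through x, and this constant,
  picked by \<open>SOME\<close>, depends on \<open>norm x\<close> alone.\<close>

proposition radially_symmetric_if_reflection_symmetric:
  fixes u :: "real^'n \<Rightarrow> real"
  assumes u: "u \<in> borel_measurable lebesgue"
    and invariant: "\<And>e. norm e = 1 \<Longrightarrow> AE x in lebesgue. u (refl_hyp e 0 x) = u x"
  shows "radially_symmetric u"
proof -
  obtain u0 where [measurable]: "u0 \<in> borel_measurable lborel" and u0: "AE x in lborel. u x = u0 x"
    using completion_ex_borel_measurable_real[OF u] by blast
  have u0': "AE x in lebesgue. u x = u0 x" using u0 by (rule AE_completion)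
  \<comment> \<open>Directions range over the whole space, so that Lebesgue measure can be used for
    them; dividing by \<open>e \<bullet> e\<close> replaces normalisation, and at e = 0 the
    convention x / 0 = 0 gives the identity.\<close>
  define \<rho> where "\<rho> e x = x - (2 * (x \<bullet> e) / (e \<bullet> e)) *\<^sub>R e" for e x :: "real^'n"
  have "AE x in lborel. u0 (\<rho> e x) = u0 x" for e
  proof (cases "e = 0")
    case True
    then show ?thesis by (simp add: \<rho>_def)
  next
    case False
    define n where "n = e /\<^sub>R norm e"
    have n: "norm n = 1" using False by (simp add: n_def)
    have \<rho>: "\<rho> e x = refl_hyp n 0 x" for x
      using False by (simp add: \<rho>_def refl_hyp_def n_def dot_square_norm power2_eq_square divide_inverse mult_ac)
    have "AE x in lebesgue. u0 (\<rho> e x) = u0 x"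
      using invariant[OF n] u0' AE_refl_hyp[OF n u0', of 0] by eventually_elim (simp add: \<rho>)
    then show ?thesis by (simp add: AE_completion_iff \<rho>)
  qed
  then have "AE e in lborel. AE x in lborel. u0 (\<rho> e x) = u0 x" by simp
  then have "AE x in lborel. AE e in lborel. u0 (\<rho> e x) = u0 x"
    by (subst (asm) lborel_pair.AE_commute) (unfold \<rho>_def, measurable)
  then have "AE x in lborel. x \<noteq> 0 \<longrightarrow> u0 x = (SOME c. AE z in lborel. u0 ((norm x / norm z) *\<^sub>R z) = c)"
  proof eventually_elim
    case (elim x)
    show ?case
    proof
      assume x: "x \<noteq> 0"
      have "negligible {e. u0 (x - (2 * (x \<bullet> e) / (e \<bullet> e)) *\<^sub>R e) \<noteq> u0 x}"
        using AE_completion[OF elim] by (simp add: eventually_ae_filter_negligible \<rho>_def negligible_subset) (meson negligible_subset)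
      then have "negligible {z. u0 ((norm x / norm z) *\<^sub>R z) \<noteq> u0 x}" by (rule negligible_sphere_values[OF x])
      then have "AE z in lebesgue. u0 ((norm x / norm z) *\<^sub>R z) = u0 x"
        unfolding eventually_ae_filter_negligible by blast
      then have ae: "AE z in lborel. u0 ((norm x / norm z) *\<^sub>R z) = u0 x"
        by (subst (asm) AE_completion_iff) auto
      show "u0 x = (SOME c. AE z in lborel. u0 ((norm x / norm z) *\<^sub>R z) = c)"
      proof (rule some_equality[where P="\<lambda>c. AE z in lborel. u0 ((norm x / norm z) *\<^sub>R z) = c", THEN sym], rule ae)
        \<comment> \<open>Two constants that both hold almost everywhere coincide because the space
          is not a null set.\<close>
        fix c assume "AE z in lborel. u0 ((norm x / norm z) *\<^sub>R z) = c"
        with ae have "AE z in (lborel :: (real^'n) measure). c = u0 x" by eventually_elim simp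
        then have "c \<noteq> u0 x \<Longrightarrow> ae_filter (lborel :: (real^'n) measure) = bot" by (simp add: trivial_limit_def)
        then show "c = u0 x" by (auto simp: ae_filter_eq_bot_iff)
      qed
    qed
  qed
  then have "AE x in lebesgue. x \<noteq> 0 \<longrightarrow> u0 x = (SOME c. AE z in lborel. u0 ((norm x / norm z) *\<^sub>R z) = c)"
    by (rule AE_completion)
  then have "AE x in lebesgue. u x = (SOME c. AE z in lborel. u0 ((norm x / norm z) *\<^sub>R z) = c)"
    using u0' AE_not_zero by eventually_elim simp
  then show ?thesis
    unfolding radially_symmetric_def
    by (intro exI[of _ "\<lambda>s. SOME c. AE z in lborel. u0 ((s / norm z) *\<^sub>R z) = c"])
qed

theorem theorem1p2:
  fixes r :: nat and lam :: "nat \<Rightarrow> real" and \<alpha> \<beta> :: "nat \<Rightarrow> nat \<Rightarrow> real"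
    and u :: "nat \<Rightarrow> real^'n \<Rightarrow> real"
  assumes "CARD('n) = 3 \<or> CARD('n) = 4"
    and "r \<ge> 2"
    and "\<And>j. j \<in> {1..r} \<Longrightarrow> 0 < lam j \<and> lam j < hardy_const CARD('n)"
    and "\<And>j k. j \<in> {1..r} \<Longrightarrow> k \<in> {1..r} \<Longrightarrow> k \<noteq> j \<Longrightarrow>
           \<alpha> j k + \<alpha> k j = sobolev_exp CARD('n) \<and> \<alpha> j k \<ge> 2 \<and> \<alpha> k j \<ge> 2 \<and>
           \<beta> j k = \<beta> k j \<and> \<beta> j k > 0"
    and "positive_solution r lam \<alpha> \<beta> u"
  shows "\<forall>j\<in>{1..r}. radially_symmetric (u j)"
proof -
  interpret positive_system r lam \<alpha> \<beta> u
    by unfold_locales (use assms in auto)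
  show ?thesis
    using radially_symmetric_if_reflection_symmetric[OF u_measurable reflection_symmetric] by blast
qed

end
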